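(* Let $k\ge 2$ be an integer, let $n_0$ be a positive integer, let $\mathbf{n} = (n_1,\dots,n_k)$ and $\mathbf{d} = (d_1,\dots,d_k)$ be $k$-tuples of positive integers, let $|\mathbf{n}| = \sum_{i=1}^k n_i$, and let $N_{\mathbf{n},\mathbf{d}} = \prod_{i=1}^k \binom{n_i+d_i}{n_i}$. Let $m$ be a positive integer. If $d_1, d_2, \dots, d_k \ge 3$ and if \[ m \le (n_0+1)\left\lfloor \frac{N_{\mathbf{n},\mathbf{d}}}{n_0+|\mathbf{n}|+1}\right\rfloor \quad\text{ or }\quad m \ge (n_0+1)\left\lceil \frac{N_{\mathbf{n},\mathbf{d}}}{n_0+|\mathbf{n}|+1}\right\rceil, \] then the Segre-Veronese variety $\mathrm{SV}_{(n_0,\mathbf{n})}^{(1,\mathbf{d})}$ is not $m$-defective, where $(n_0,\mathbf{n})=(n_0,n_1,\dots,n_k)$ and $(1,\mathbf{d})=(1,d_1,\dots,d_k)$.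
   Context: The base field $\Bbbk$ is algebraically closed of characteristic zero. For tuples of positive integers $\mathbf{a}=(a_1,\dots,a_l)$ and $\mathbf{e}=(e_1,\dots,e_l)$ of the same length, $\mathrm{SV}^{\mathbf{e}}_{\mathbf{a}}$ denotes the Segre-Veronese variety, i.e. the image of $\mathbb{P}^{a_1}\times\cdots\times\mathbb{P}^{a_l}$ under the embedding into $\mathbb{P}^{N-1}$, $N=\prod_{i=1}^l\binom{a_i+e_i}{e_i}$, given by the complete linear system $|\mathcal{O}(e_1,\dots,e_l)|$. For a variety $X\subset\mathbb{P}^M$ and a positive integer $m$, the $m$-th secant variety $\sigma_m(X)$ is the Zariski closure of the union of all linear spans $\langle x_1,\dots,x_m\rangle$ with $x_1,\dots,x_m\in X$. Its expected dimension is $\min\{M,\ m\dim X+m-1\}$. $X$ is called $m$-defective if $\dim\sigma_m(X)$ is strictly smaller than its expected dimension. *)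

theory Defs
  imports
    "HOL-Analysis.Abstract_Topology"
    "HOL-Library.Function_Algebras"
    "HOL-Library.Multiset"
    "HOL-Library.FuncSet"
    "HOL-Library.Extended_Nat"
    "HOL-Computational_Algebra.Polynomial"
begin

section \<open>Projective space over a field\<close>

text \<open>
  Homogeneous coordinates are indexed by a finite nonempty set \<open>I\<close>, so that \<open>proj_space I\<close> is the
  projective space of dimension \<open>card I - 1\<close>.  A coordinate vector is a function vanishing outside
  \<open>I\<close>, and a point is the class of a nonzero vector modulo nonzero scalars.
\<close>

definition fscale :: "'k::field \<Rightarrow> ('i \<Rightarrow> 'k) \<Rightarrow> 'i \<Rightarrow> 'k" where
  "fscale c v = (\<lambda>i. c * v i)"

global_interpretation fvs: vector_space fscale
  by unfold_locales (auto simp: fscale_def fun_eq_iff algebra_simps)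

definition coord_vecs :: "'i set \<Rightarrow> ('i \<Rightarrow> 'k::field) set" where
  "coord_vecs I = {v. \<forall>i. i \<notin> I \<longrightarrow> v i = 0}"

definition proj_pt :: "('i \<Rightarrow> 'k::field) \<Rightarrow> ('i \<Rightarrow> 'k) set" where
  "proj_pt v = {fscale c v | c. c \<noteq> 0}"

definition proj_space :: "'i set \<Rightarrow> ('i \<Rightarrow> 'k::field) set set" where
  "proj_space I = proj_pt ` (coord_vecs I - {0})"

definition proj_span :: "'i set \<Rightarrow> ('i \<Rightarrow> 'k::field) set set \<Rightarrow> ('i \<Rightarrow> 'k) set set" where
  "proj_span I P = {p \<in> proj_space I. p \<subseteq> fvs.span (\<Union>P)}"


section \<open>Forms and the Zariski topology\<close>

definition exponents :: "'i set \<Rightarrow> nat \<Rightarrow> ('i \<Rightarrow> nat) set" where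
  "exponents I d = {\<alpha>. (\<forall>i. i \<notin> I \<longrightarrow> \<alpha> i = 0) \<and> (\<Sum>i\<in>I. \<alpha> i) = d}"

definition monomial :: "'i set \<Rightarrow> ('i \<Rightarrow> nat) \<Rightarrow> ('i \<Rightarrow> 'k::field) \<Rightarrow> 'k" where
  "monomial I \<alpha> v = (\<Prod>i\<in>I. v i ^ \<alpha> i)"

text \<open>Homogeneous polynomials in the variables \<open>I\<close>, as functions of the coordinate vector.\<close>

definition form :: "'i set \<Rightarrow> nat \<Rightarrow> (('i \<Rightarrow> nat) \<Rightarrow> 'k) \<Rightarrow> ('i \<Rightarrow> 'k::field) \<Rightarrow> 'k" where
  "form I d c v = (\<Sum>\<alpha>\<in>exponents I d. c \<alpha> * monomial I \<alpha> v)"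

definition forms :: "'i set \<Rightarrow> (('i \<Rightarrow> 'k::field) \<Rightarrow> 'k) set" where
  "forms I = {form I d c | d c. True}"

definition zero_locus :: "'i set \<Rightarrow> (('i \<Rightarrow> 'k::field) \<Rightarrow> 'k) set \<Rightarrow> ('i \<Rightarrow> 'k) set set" where
  "zero_locus I S = {p \<in> proj_space I. \<forall>F\<in>S. \<forall>v\<in>p. F v = 0}"

definition zariski :: "'i set \<Rightarrow> ('i \<Rightarrow> 'k::field) set topology" where
  "zariski I = topology (\<lambda>U. \<exists>S\<subseteq>forms I. U = proj_space I - zero_locus I S)"

lemma finite_exponents:
  assumes "finite I" shows "finite (exponents I d)"
proof -
  let ?g = "\<lambda>f i. if i \<in> I then f i else (0::nat)"
  have "exponents I d \<subseteq> ?g ` (\<Pi>\<^sub>E i\<in>I. {..d})"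
  proof
    fix \<alpha> assume a: "\<alpha> \<in> exponents I d"
    have "\<alpha> i \<le> d" if "i \<in> I" for i
      using a that assms member_le_sum[of i I \<alpha>] by (auto simp: exponents_def)
    then have "restrict \<alpha> I \<in> (\<Pi>\<^sub>E i\<in>I. {..d})" by auto
    moreover have "\<alpha> = ?g (restrict \<alpha> I)" using a by (auto simp: exponents_def fun_eq_iff)
    ultimately show "\<alpha> \<in> ?g ` (\<Pi>\<^sub>E i\<in>I. {..d})" by blast
  qed
  moreover have "finite (\<Pi>\<^sub>E i\<in>I. {..d})" using assms by (intro finite_PiE) auto
  ultimately show ?thesis by (meson finite_imageI finite_subset)
qed

lemma form_mult:
  assumes "finite I" "F \<in> forms I" "G \<in> forms I"
  shows "(\<lambda>v. F v * G v) \<in> forms I"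
proof -
  obtain d c d' c' where F: "F = form I d c" and G: "G = form I d' c'"
    using assms by (auto simp: forms_def)
  let ?A = "exponents I d \<times> exponents I d'"
  let ?s = "\<lambda>(\<alpha>,\<beta>) i. \<alpha> i + \<beta> i :: nat"
  let ?c = "\<lambda>\<gamma>. \<Sum>(\<alpha>,\<beta>) | (\<alpha>,\<beta>) \<in> ?A \<and> ?s (\<alpha>,\<beta>) = \<gamma>. c \<alpha> * c' \<beta>"
  have fin: "finite ?A" "finite (exponents I (d + d'))"
    using finite_exponents[OF assms(1)] by auto
  have "F v * G v = form I (d + d') ?c v" for v
  proof -
    have sub: "?s ` ?A \<subseteq> exponents I (d + d')"
      by (auto simp: exponents_def sum.distrib)
    have "F v * G v = (\<Sum>(\<alpha>,\<beta>)\<in>?A. (c \<alpha> * monomial I \<alpha> v) * (c' \<beta> * monomial I \<beta> v))"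
      by (simp add: F G form_def sum_product sum.cartesian_product)
    also have "\<dots> = (\<Sum>p\<in>?A. case p of (\<alpha>,\<beta>) \<Rightarrow> c \<alpha> * c' \<beta> * monomial I (?s (\<alpha>,\<beta>)) v)"
      by (intro sum.cong) (auto simp: monomial_def power_add prod.distrib)
    also have "\<dots> = (\<Sum>\<gamma>\<in>exponents I (d + d'). \<Sum>p | p \<in> ?A \<and> ?s p = \<gamma>.
        case p of (\<alpha>,\<beta>) \<Rightarrow> c \<alpha> * c' \<beta> * monomial I (?s (\<alpha>,\<beta>)) v)"
      by (rule sum.group[OF fin sub, symmetric])
    also have "\<dots> = form I (d + d') ?c v"
      unfolding form_def sum_distrib_right
      by (intro sum.cong) auto
    finally show ?thesis .
  qed
  then have "(\<lambda>v. F v * G v) = form I (d + d') ?c" by blast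
  then show ?thesis unfolding forms_def by blast
qed

lemma form_fscale: "form I d c (fscale a v) = a ^ d * form I d c v"
proof -
  have "monomial I \<alpha> (fscale a v) = a ^ d * monomial I \<alpha> v" if "\<alpha> \<in> exponents I d" for \<alpha>
    using that by (auto simp: monomial_def fscale_def power_mult_distrib prod.distrib
        exponents_def power_sum)
  then show ?thesis
    by (simp add: form_def sum_distrib_left mult.left_commute)
qed

lemma form_zero_on_pt:
  assumes "F \<in> forms I" "p \<in> proj_space I" "v \<in> p" "w \<in> p" "F v = 0"
  shows "F w = 0"
proof -
  obtain u a b where ab: "v = fscale a u" "w = fscale b u" "a \<noteq> 0"
    using assms by (auto simp: proj_space_def proj_pt_def)
  then have "w = fscale (b / a) v" by (auto simp: fscale_def)
  then show ?thesis using assms(1,5) by (auto simp: forms_def form_fscale)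
qed

lemma istopology_zariski:
  assumes "finite I"
  shows "istopology (\<lambda>U. \<exists>S\<subseteq>forms I. U = proj_space I - zero_locus I S)"
  unfolding istopology_def
proof (intro conjI allI impI)
  fix U V :: "('a \<Rightarrow> 'b) set set"
  assume "\<exists>S\<subseteq>forms I. U = proj_space I - zero_locus I S"
    and "\<exists>S\<subseteq>forms I. V = proj_space I - zero_locus I S"
  then obtain S T where ST: "S \<subseteq> forms I" "T \<subseteq> forms I"
    "U = proj_space I - zero_locus I S" "V = proj_space I - zero_locus I T" by blast
  let ?R = "{\<lambda>v. F v * G v | F G. F \<in> S \<and> G \<in> T}"
  have "U \<inter> V = proj_space I - zero_locus I ?R"
  proof (intro equalityI subsetI)
    fix p assume "p \<in> U \<inter> V"
    then obtain F G v w where p: "p \<in> proj_space I" "F \<in> S" "G \<in> T" "v \<in> p" "w \<in> p"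
      "F v \<noteq> 0" "G w \<noteq> 0" unfolding ST(3,4) zero_locus_def by blast
    then have "G v \<noteq> 0" using form_zero_on_pt[of G I p v w] ST(2) by blast
    then have nz: "F v * G v \<noteq> 0" using p by simp
    have R: "(\<lambda>v. F v * G v) \<in> ?R" using p(2,3) by blast
    have "p \<notin> zero_locus I ?R"
    proof
      assume "p \<in> zero_locus I ?R"
      then have "\<forall>H\<in>?R. \<forall>v\<in>p. H v = 0" 
        unfolding zero_locus_def mem_Collect_eq by (rule conjunct2)
      from bspec[OF bspec[OF this R] p(4)] nz show False by simp
    qed
    with p(1) show "p \<in> proj_space I - zero_locus I ?R" by simp
  next
    fix p assume "p \<in> proj_space I - zero_locus I ?R"
    then obtain F G v where p: "p \<in> proj_space I" "F \<in> S" "G \<in> T" "v \<in> p" "F v * G v \<noteq> 0"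
      by (auto simp: zero_locus_def)
    then have "F v \<noteq> 0" "G v \<noteq> 0" by auto
    with p show "p \<in> U \<inter> V" by (auto simp: ST(3,4) zero_locus_def)
  qed
  moreover have "?R \<subseteq> forms I" using form_mult[OF assms] ST(1,2) by blast
  ultimately show "\<exists>S\<subseteq>forms I. U \<inter> V = proj_space I - zero_locus I S" by blast
next
  fix K :: "('a \<Rightarrow> 'b) set set set"
  assume "\<forall>U\<in>K. \<exists>S\<subseteq>forms I. U = proj_space I - zero_locus I S"
  then obtain f where "\<forall>U\<in>K. f U \<subseteq> forms I \<and> U = proj_space I - zero_locus I (f U)"
    by (rule bchoice[THEN exE])
  then have f: "f U \<subseteq> forms I" "U = proj_space I - zero_locus I (f U)" if "U \<in> K" for U
    using that by auto
  have "\<Union>K = (\<Union>U\<in>K. proj_space I - zero_locus I (f U))" using f by auto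
  also have "\<dots> = proj_space I - zero_locus I (\<Union>(f ` K))"
    by (auto simp: zero_locus_def)
  finally show "\<exists>S\<subseteq>forms I. \<Union>K = proj_space I - zero_locus I S"
    using f by (intro exI[of _ "\<Union>(f ` K)"]) blast
qed

lemma openin_zariski:
  assumes "finite I"
  shows "openin (zariski I) U \<longleftrightarrow> (\<exists>S\<subseteq>forms I. U = proj_space I - zero_locus I S)"
  unfolding zariski_def topology_inverse'[OF istopology_zariski[OF assms]] ..

lemma topspace_zariski:
  assumes "finite I" shows "topspace (zariski I) = (proj_space I :: ('i \<Rightarrow> 'k::field) set set)"
proof -
  let ?one = "form I 0 (\<lambda>_. 1) :: ('i \<Rightarrow> 'k) \<Rightarrow> 'k"
  have "exponents I 0 = {\<lambda>_. 0}" using assms by (auto simp: exponents_def)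
  then have one: "?one v = 1" for v by (simp add: form_def monomial_def)
  have "v \<in> p \<longrightarrow> ?one v \<noteq> 0" for v p using one by simp
  moreover have "p \<noteq> {}" if "p \<in> proj_space I" for p :: "('i \<Rightarrow> 'k) set"
    using that by (auto simp: proj_space_def proj_pt_def intro: exI[of _ 1])
  ultimately have "zero_locus I {?one} = {}" by (auto simp: zero_locus_def)
  then have "openin (zariski I) (proj_space I :: ('i \<Rightarrow> 'k) set set)"
    unfolding openin_zariski[OF assms]
    by (intro exI[of _ "{?one}"]) (auto simp: forms_def)
  moreover have "topspace (zariski I) \<subseteq> (proj_space I :: ('i \<Rightarrow> 'k) set set)"
    using openin_zariski[OF assms] openin_topspace by blast
  ultimately show ?thesis by (simp add: openin_subset subset_antisym)
qed

lemma closedin_zariski: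
  assumes "finite I"
  shows "closedin (zariski I) (Z :: ('i \<Rightarrow> 'k::field) set set) \<longleftrightarrow> (\<exists>S\<subseteq>forms I. Z = zero_locus I S)"
proof -
  have sub: "zero_locus I S \<subseteq> proj_space I" for S :: "(('i \<Rightarrow> 'k) \<Rightarrow> 'k) set"
    by (auto simp: zero_locus_def)
  have "Z \<subseteq> proj_space I \<and> proj_space I - Z = proj_space I - zero_locus I S \<longleftrightarrow> Z = zero_locus I S" for S
    using sub[of S] by blast
  then show ?thesis
    unfolding closedin_def topspace_zariski[OF assms] openin_zariski[OF assms] by blast
qed


section \<open>Dimension\<close>

definition irreducible_in :: "'a topology \<Rightarrow> 'a set \<Rightarrow> bool" where
  "irreducible_in T Z \<longleftrightarrow> Z \<noteq> {} \<and> Z \<subseteq> topspace T \<and>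
     (\<forall>A B. closedin T A \<and> closedin T B \<and> Z \<subseteq> A \<union> B \<longrightarrow> Z \<subseteq> A \<or> Z \<subseteq> B)"

text \<open>
  The Krull dimension: the supremum of the lengths \<open>n\<close> of chains \<open>Z 0 \<subset> \<dots> \<subset> Z n\<close> of irreducible
  closed subsets.  It is \<open>0\<close> for the empty space, which does not occur below.
\<close>

definition krull_dim :: "'a topology \<Rightarrow> enat" where
  "krull_dim T = Sup {enat n | n. \<exists>Z. (\<forall>i\<le>n. closedin T (Z i) \<and> irreducible_in T (Z i)) \<and>
                                     (\<forall>i<n. Z i \<subset> Z (Suc i))}"

definition proj_dim :: "'i set \<Rightarrow> ('i \<Rightarrow> 'k::field) set set \<Rightarrow> enat" where
  "proj_dim I X = krull_dim (subtopology (zariski I) X)"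


section \<open>Secant varieties and defectivity\<close>

definition secant_variety ::
    "'i set \<Rightarrow> nat \<Rightarrow> ('i \<Rightarrow> 'k::field) set set \<Rightarrow> ('i \<Rightarrow> 'k) set set" where
  "secant_variety I m X =
     zariski I closure_of (\<Union>x \<in> {..<m} \<rightarrow> X. proj_span I (x ` {..<m}))"

definition expected_dim :: "'i set \<Rightarrow> nat \<Rightarrow> ('i \<Rightarrow> 'k::field) set set \<Rightarrow> enat" where
  "expected_dim I m X = min (enat (card I - 1)) (enat m * proj_dim I X + enat (m - 1))"

definition defective :: "'i set \<Rightarrow> nat \<Rightarrow> ('i \<Rightarrow> 'k::field) set set \<Rightarrow> bool" where
  "defective I m X \<longleftrightarrow> proj_dim I (secant_variety I m X) < expected_dim I m X"


section \<open>Segre-Veronese varieties\<close>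

text \<open>
  A basis of the sections of \<open>O(e\<^sub>1,\<dots>,e\<^sub>l)\<close> is given by the monomials of multidegree
  \<open>(e\<^sub>1,\<dots>,e\<^sub>l)\<close>; these index the coordinates of the target.  The lists \<open>a\<close>, \<open>e\<close> are numbered from
  \<open>0\<close>, and the homogeneous coordinates of the \<open>i\<close>-th factor are \<open>x i 0, \<dots>, x i (a ! i)\<close>.
\<close>

definition sv_index :: "nat list \<Rightarrow> nat list \<Rightarrow> (nat \<Rightarrow> nat \<Rightarrow> nat) set" where
  "sv_index a e = (\<Pi>\<^sub>E i\<in>{..<length a}. exponents {..a ! i} (e ! i))"

definition sv_map ::
    "nat list \<Rightarrow> nat list \<Rightarrow> (nat \<Rightarrow> nat \<Rightarrow> 'k::field) \<Rightarrow> (nat \<Rightarrow> nat \<Rightarrow> nat) \<Rightarrow> 'k" where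
  "sv_map a e x = (\<lambda>\<alpha>. if \<alpha> \<in> sv_index a e
                        then \<Prod>i<length a. monomial {..a ! i} (\<alpha> i) (x i) else 0)"

definition segre_veronese ::
    "nat list \<Rightarrow> nat list \<Rightarrow> ((nat \<Rightarrow> nat \<Rightarrow> nat) \<Rightarrow> 'k::field) set set" where
  "segre_veronese a e =
     {proj_pt (sv_map a e x) | x. \<forall>i<length a. proj_pt (x i) \<in> proj_space {..a ! i}}"

lemma card_exponents:
  assumes "finite I" "I \<noteq> {}"
  shows "card (exponents I d) = (card I - 1 + d) choose d"
proof -
  have "bij_betw count (multisets_of_size I d) (exponents I d)"
  proof (rule bij_betw_byWitness[where f' = Abs_multiset])
    have fin: "finite {x. 0 < \<alpha> x}" if "\<alpha> \<in> exponents I d" for \<alpha>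
    proof (rule finite_subset[OF _ assms(1)])
      show "{x. 0 < \<alpha> x} \<subseteq> I" using that by (force simp: exponents_def)
    qed
    show "\<forall>X\<in>multisets_of_size I d. Abs_multiset (count X) = X"
      by (simp add: count_inverse)
    show "\<forall>\<alpha>\<in>exponents I d. count (Abs_multiset \<alpha>) = \<alpha>"
      using fin by (simp add: Abs_multiset_inverse)
    have size: "size X = (\<Sum>i\<in>I. count X i)" if "set_mset X \<subseteq> I" for X
      unfolding size_multiset_overloaded_eq
      using that assms(1) by (intro sum.mono_neutral_left) (auto simp: count_eq_zero_iff)
    show "count ` (multisets_of_size I d) \<subseteq> exponents I d"
      using size by (auto simp: multisets_of_size_def exponents_def count_eq_zero_iff)
    show "Abs_multiset ` exponents I d \<subseteq> multisets_of_size I d"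
    proof (intro subsetI, elim imageE, hypsubst)
      fix \<alpha> assume a: "\<alpha> \<in> exponents I d"
      then have c: "count (Abs_multiset \<alpha>) = \<alpha>" using fin by (simp add: Abs_multiset_inverse)
      have *: "x \<in> I" if "x \<in># Abs_multiset \<alpha>" for x
      proof (rule ccontr)
        assume "x \<notin> I"
        then have "count (Abs_multiset \<alpha>) x = 0" using a by (simp add: c exponents_def)
        then have "x \<notin># Abs_multiset \<alpha>" by (simp only: not_in_iff)
        then show False using that by contradiction
      qed
      then have "set_mset (Abs_multiset \<alpha>) \<subseteq> I" by blast
      with size[OF this] a c show "Abs_multiset \<alpha> \<in> multisets_of_size I d"
        by (simp add: multisets_of_size_def exponents_def)
    qed
  qed
  then have "card (exponents I d) = card (multisets_of_size I d)"
    by (simp add: bij_betw_same_card)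
  also have "\<dots> = (card I + d - 1) choose d"
    using card_multisets_of_size[OF assms(1)] by simp
  also have "card I + d - 1 = card I - 1 + d"
    using assms by (simp add: Suc_le_eq card_gt_0_iff)
  finally show ?thesis .
qed

lemma card_sv_index:
  "card (sv_index a e) = (\<Prod>i<length a. (a ! i + e ! i) choose (e ! i))"
  by (simp add: sv_index_def card_PiE card_exponents)

end

theory Submission
  imports Defs
begin

text \<open>
  Write \<open>X\<close> for the Segre-Veronese variety with the factor of degree one and \<open>Y\<close> for the one without
  it.  Differentiating a parametrisation bounds the dimension of a secant variety from below by the
  rank of a span of tangent spaces at special points, so it suffices to find points of \<open>X\<close> where this
  rank is as large as possible.

  Place \<open>S\<close> points over each of the \<open>n0 + 1\<close> coordinate points of the first factor.  The span of
  their tangent spaces splits into \<open>n0 + 1\<close> blocks, each spanned by \<open>S\<close> tangent spaces of \<open>Y\<close> and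
  \<open>n0 S\<close> further points of \<open>Y\<close>.  General points always add the expected rank, and with \<open>S\<close> the
  floor or the ceiling of \<open>N / (n0 + |n| + 1)\<close> the claim reduces to the independence of \<open>S\<close> general
  tangent spaces of \<open>Y\<close>.

  This leaves some room, because the expected maximum for \<open>Y\<close> is about \<open>N / (|n| + 1)\<close>.  Let \<open>r j\<close> be the
  rank of \<open>j\<close> general tangent spaces of \<open>Y\<close>.  Its increments do not increase, and two equal
  increments below \<open>|n| + 1\<close> force \<open>r j = N\<close>: the intersection of a general tangent space with
  the span of \<open>j\<close> others is then independent of these others, and so this span contains the orbit of a
  nonzero vector under linear substitutions in every factor, which spans everything (an argument of
  Nenashev and of Blomenhofer and Casarotti).  Hence a defect of \<open>Y\<close> can only occur if
  \<open>2 N \<le> 2 (S - 1) D + D (D - 1)\<close> with \<open>D = |n| + 1\<close>, which is excluded by \<open>k \<ge> 2\<close> and \<open>d\<^sub>i \<ge> 3\<close>.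
\<close>

section \<open>Linear algebra\<close>

text \<open>Dimension is the Krull dimension of the Zariski topology. The expected dimension grows
  with dim X, so it is enough to bound the secant variety from below and X from above. Both bounds
  come from counting monomials in suitable forms against the dimension of a space of pulled back
  polynomials. "General" is made precise along lines: a condition is open if it fails at only
  finitely many parameters of every line through a configuration that satisfies it. Over an infinite
  field finitely many such conditions can be met together, and polynomial identities extend from
  general to special parameters. A block has expected rank S (|n| + 1) + n0 S = S (n0 + |n| + 1) in
  a space of dimension N. So the floor is the largest S for which all blocks can be independent, and
  the ceiling the smallest for which all can be full; other m are reached by dropping or adding
  points. The term D (D - 1) is twice (D - 1) + (D - 2) + ... + 1, the most that the increments can
  add once they are below D and strictly decrease.\<close>

context vector_space
begin

text \<open>The function spaces in use may have infinite dimension. The finite set \<open>B0\<close>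
  stands in for a finite-dimensional ambient space: inside \<open>span B0\<close> all bases are
  finite.\<close>

lemma finite_basis_extend:
  assumes "finite B0" "T \<subseteq> span B0" "S \<subseteq> T" "independent S"
  obtains B where "S \<subseteq> B" "B \<subseteq> T" "finite B" "independent B" "T \<subseteq> span B" "card B = dim T"
proof -
  obtain B where B: "S \<subseteq> B" "B \<subseteq> T" "independent B" "T \<subseteq> span B"
    using maximal_independent_subset_extend[OF assms(3,4)] by metis
  have "finite B" using independent_span_bound[OF assms(1) B(3)] B(2) assms(2) by auto
  moreover have "card B = dim T" using basis_card_eq_dim B by blast
  ultimately show ?thesis using that B by blast
qed

lemma finite_basis:
  assumes "finite B0" "T \<subseteq> span B0"
  obtains B where "B \<subseteq> T" "finite B" "independent B" "T \<subseteq> span B" "card B = dim T"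
  using finite_basis_extend[OF assms, of "{}"] independent_empty by auto

lemma dim_mono_finite:
  assumes "finite B0" "T \<subseteq> span B0" "S \<subseteq> span T"
  shows "dim S \<le> dim T"
proof -
  obtain B where B: "B \<subseteq> T" "finite B" "T \<subseteq> span B" "card B = dim T"
    using finite_basis[OF assms(1,2)] by metis
  then have "S \<subseteq> span B" using assms(3) by (meson span_minimal subset_trans subspace_span)
  then show ?thesis using dim_le_card B by metis
qed

lemma independent_card_le_dim_finite:
  assumes "finite B0" "T \<subseteq> span B0" "S \<subseteq> span T" "independent S"
  shows "finite S" "card S \<le> dim T"
proof -
  have "S \<subseteq> span B0" using assms by (meson span_minimal subset_trans subspace_span)
  then show "finite S" using independent_span_bound[OF assms(1,4)] by auto
  show "card S \<le> dim T" 
    using dim_mono_finite[OF assms(1-3)] dim_eq_card_independent[OF assms(4)] by simp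
qed

lemma independent_if_card_le_dim:
  assumes "finite B" "card B \<le> dim B"
  shows "independent B"
proof -
  obtain C where C: "C \<subseteq> B" "finite C" "independent C" "card C = dim B"
    using finite_basis[OF assms(1) span_superset] by metis
  then have "C = B" using assms card_seteq by metis
  then show ?thesis using C by simp
qed

lemma dim_Un_le:
  assumes "finite B0" "S \<subseteq> span B0" "T \<subseteq> span B0"
  shows "dim (S \<union> T) \<le> dim S + dim T"
proof -
  obtain A where A: "A \<subseteq> S" "finite A" "S \<subseteq> span A" "card A = dim S"
    using finite_basis[OF assms(1,2)] by metis
  obtain B where B: "B \<subseteq> T" "finite B" "T \<subseteq> span B" "card B = dim T"
    using finite_basis[OF assms(1,3)] by metis
  have "S \<union> T \<subseteq> span (A \<union> B)"
    using A(3) B(3) span_mono[of A "A \<union> B"] span_mono[of B "A \<union> B"] by blast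
  then have "dim (S \<union> T) \<le> card (A \<union> B)" using dim_le_card A B by blast
  then show ?thesis using card_Un_le[of A B] A B by simp
qed

lemma dim_Union_le:
  assumes "finite B0" "finite H" "\<And>h. h \<in> H \<Longrightarrow> S h \<subseteq> span B0" 
  shows "dim (\<Union>h\<in>H. S h) \<le> (\<Sum>h\<in>H. dim (S h))"
  using assms(2,3)
proof (induction H)
  case empty
  then show ?case using dim_eq_card_independent[OF independent_empty] by simp
next
  case (insert h H)
  have "dim (S h \<union> (\<Union>h\<in>H. S h)) \<le> dim (S h) + dim (\<Union>h\<in>H. S h)"
    by (rule dim_Un_le[OF assms(1)]) (use insert in auto)
  then show ?case using insert by (simp add: le_trans)
qed

lemma independent_Un_span_Int:
  assumes "independent (A \<union> B)" "A \<inter> B = {}" "x \<in> span A" "x \<in> span B"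
  shows "x = 0"
proof -
  obtain S u where S: "finite S" "S \<subseteq> A" "x = (\<Sum>v\<in>S. scale (u v) v)"
    using assms(3) unfolding span_explicit by blast
  obtain T w where T: "finite T" "T \<subseteq> B" "x = (\<Sum>v\<in>T. scale (w v) v)"
    using assms(4) unfolding span_explicit by blast
  have d: "S \<inter> T = {}" using S T assms(2) by blast
  let ?c = "\<lambda>v. if v \<in> S then u v else - w v"
  have t: "(\<Sum>v\<in>T. scale (?c v) v) = (\<Sum>v\<in>T. - scale (w v) v)"
    by (rule sum.cong) (use d in auto)
  have "(\<Sum>v\<in>S \<union> T. scale (?c v) v) = (\<Sum>v\<in>S. scale (?c v) v) + (\<Sum>v\<in>T. scale (?c v) v)"
    using S T d by (simp add: sum.union_disjoint)
  also have "\<dots> = x - x" unfolding t using S(3) T(3) by (simp add: sum_negf)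
  finally have z: "(\<Sum>v\<in>S \<union> T. scale (?c v) v) = 0" by simp
  have "?c v = 0" if "v \<in> S \<union> T" for v
    by (rule independentD[OF assms(1) _ _ z that]) (use S T in auto)
  then have "u v = 0" if "v \<in> S" for v using that by fastforce
  then show ?thesis using S by simp
qed

lemma independent_Un:
  assumes "independent A" "independent B" "span A \<inter> span B \<subseteq> {0}"
  shows "independent (A \<union> B)" "A \<inter> B = {}"
proof -
  have nz: "0 \<notin> A" "0 \<notin> B" using assms dependent_zero by blast+
  then show d: "A \<inter> B = {}" using assms(3) span_base by blast
  show "independent (A \<union> B)"
    unfolding dependent_explicit
  proof (safe)
    fix S u v assume S: "finite S" "S \<subseteq> A \<union> B" "(\<Sum>v\<in>S. scale (u v) v) = 0" "v \<in> S" "u v \<noteq> 0"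
    let ?f = "\<lambda>v. scale (u v) v"
    have SE: "S = (S \<inter> A) \<union> (S \<inter> B)" using S by blast
    have "sum ?f S = sum ?f (S \<inter> A) + sum ?f (S \<inter> B)"
      by (subst SE, rule sum.union_disjoint) (use S d in auto)
    then have eq: "sum ?f (S \<inter> A) = - sum ?f (S \<inter> B)" using S(3) by (simp add: eq_neg_iff_add_eq_0)
    have a: "sum ?f (S \<inter> A) \<in> span A" by (intro span_sum span_scale span_base) auto
    have "sum ?f (S \<inter> B) \<in> span B" by (intro span_sum span_scale span_base) auto
    then have "sum ?f (S \<inter> A) \<in> span B" using eq span_neg by simp
    then have z: "sum ?f (S \<inter> A) = 0" using a assms(3) by blast
    then have z': "sum ?f (S \<inter> B) = 0" using eq by simp
    have "u v = 0"
    proof (cases "v \<in> A")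
      case True
      show ?thesis by (rule independentD[OF assms(1) _ _ z]) (use S True in auto)
    next
      case False
      show ?thesis by (rule independentD[OF assms(2) _ _ z']) (use S False in auto)
    qed
    then show False using S by simp
  qed
qed

lemma dim_Un_disjoint:
  assumes "finite B0" "S \<subseteq> span B0" "T \<subseteq> span B0" "span S \<inter> span T \<subseteq> {0}"
  shows "dim (S \<union> T) = dim S + dim T"
proof -
  obtain A where A: "A \<subseteq> S" "finite A" "independent A" "S \<subseteq> span A" "card A = dim S"
    using finite_basis[OF assms(1,2)] by metis
  obtain B where B: "B \<subseteq> T" "finite B" "independent B" "T \<subseteq> span B" "card B = dim T"
    using finite_basis[OF assms(1,3)] by metis
  have "span A \<inter> span B \<subseteq> {0}" using span_mono[OF A(1)] span_mono[OF B(1)] assms(4) by blast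
  note AB = independent_Un[OF A(3) B(3) this]
  have "card (A \<union> B) = dim (S \<union> T)"
  proof (rule basis_card_eq_dim)
    show "S \<union> T \<subseteq> span (A \<union> B)"
      using A(4) B(4) span_mono[of A "A \<union> B"] span_mono[of B "A \<union> B"] by blast
  qed (use A B AB in auto)
  then show ?thesis using A B AB by (simp add: card_Un_disjoint)
qed

text \<open>Let \<open>B\<close> be the vectors that extend a basis of \<open>U\<close> to one of
  \<open>U \<union> T\<close>. Together with a basis \<open>A'\<close> of \<open>W\<close> they span
  \<open>W \<union> T\<close>, which gives the inequality. In the equality case
  \<open>A' \<union> B\<close> is independent; an element of \<open>span T\<close> is a part in
  \<open>span U\<close> plus a part in \<open>span B\<close>, and membership in
  \<open>span W\<close> kills the second part.\<close>

lemma dim_submodular: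
  assumes fin: "finite B0" and W: "W \<subseteq> span B0" and T: "T \<subseteq> span B0" and U: "U \<subseteq> span W"
  shows "dim (W \<union> T) + dim U \<le> dim (U \<union> T) + dim W"
    and "dim (U \<union> T) + dim W \<le> dim (W \<union> T) + dim U \<Longrightarrow> span T \<inter> span W \<subseteq> span U"
proof -
  have U': "U \<subseteq> span B0" using U W by (meson span_minimal subset_trans subspace_span)
  obtain A where A: "A \<subseteq> U" "finite A" "independent A" "U \<subseteq> span A" "card A = dim U"
    using finite_basis[OF fin U'] by metis
  obtain C where C: "A \<subseteq> C" "C \<subseteq> U \<union> T" "finite C" "independent C" "U \<union> T \<subseteq> span C"
      "card C = dim (U \<union> T)"
    using finite_basis_extend[OF fin Un_least[OF U' T] le_supI1[OF A(1)] A(3)] by metis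
  obtain A' where A': "A' \<subseteq> W" "finite A'" "independent A'" "W \<subseteq> span A'" "card A' = dim W"
    using finite_basis[OF fin W] by metis
  define B where "B = C - A"
  have cB: "card B + dim U = dim (U \<union> T)"
    unfolding B_def using A C card_mono[OF C(3,1)] by (simp add: card_Diff_subset)
  have CB: "C = A \<union> B" using C B_def by blast
  have spWA: "span W = span A'"
    using A' by (meson span_minimal span_mono subset_antisym subspace_span)
  have AW: "A \<subseteq> span A'" using A(1) U spWA by blast
  have "C \<subseteq> span (A' \<union> B)"
    unfolding CB using AW span_mono[of A' "A' \<union> B"] span_superset[of "A' \<union> B"] by blast
  then have TC: "T \<subseteq> span (A' \<union> B)" using C(5) span_minimal[OF _ subspace_span] by blast
  have WT: "W \<union> T \<subseteq> span (A' \<union> B)" using TC A'(4) span_mono[of A' "A' \<union> B"] by blast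
  have fB: "finite B" using C B_def by simp
  then have le: "dim (W \<union> T) \<le> card (A' \<union> B)" using dim_le_card[OF WT] A' by blast
  then show "dim (W \<union> T) + dim U \<le> dim (U \<union> T) + dim W"
    using card_Un_le[of A' B] A' cB by linarith
  assume "dim (U \<union> T) + dim W \<le> dim (W \<union> T) + dim U"
  then have ge: "card A' + card B \<le> dim (W \<union> T)" using cB A' by linarith
  then have ceq: "card (A' \<union> B) = card A' + card B" using le card_Un_le[of A' B] by linarith
  then have disj: "A' \<inter> B = {}" using card_Un_Int[OF A'(2) fB] A'(2) by simp
  have "dim (W \<union> T) \<le> dim (A' \<union> B)" by (rule dim_mono_finite[OF _ span_superset WT]) (use A' fB in auto)
  then have ind: "independent (A' \<union> B)"
    using independent_if_card_le_dim[of "A' \<union> B"] ceq ge A' fB by auto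
  show "span T \<inter> span W \<subseteq> span U"
  proof
    fix x assume x: "x \<in> span T \<inter> span W"
    have "T \<subseteq> span (A \<union> B)" using C(5) CB by simp
    then have "x \<in> span (A \<union> B)" using x span_minimal[OF _ subspace_span] by blast
    then obtain a b where ab: "x = a + b" "a \<in> span A" "b \<in> span B"
      unfolding span_Un by blast
    have "a \<in> span A'" using ab(2) AW span_minimal[OF _ subspace_span] by blast
    then have "x - a \<in> span A'" using x spWA span_diff by blast
    then have "b \<in> span A'" using ab by simp
    then have "b = 0" using independent_Un_span_Int[OF ind disj] ab by simp
    then show "x \<in> span U" using ab A(1) span_mono by auto
  qed
qed

end

section \<open>Coordinate spaces, linear forms on them, and independent families\<close>

definition unit_vec :: "'i \<Rightarrow> 'i \<Rightarrow> 'k::field" where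
  "unit_vec j = (\<lambda>i. if i = j then 1 else 0)"

lemma unit_vec_same [simp]: "unit_vec j j = 1"
  and unit_vec_other [simp]: "i \<noteq> j \<Longrightarrow> unit_vec j i = 0"
  by (auto simp: unit_vec_def)

lemma sum_apply: "(sum f A) x = (\<Sum>a\<in>A. f a x)"
  by (induction A rule: infinite_finite_induct) auto

lemma coord_vecs_expand:
  assumes "finite I" "v \<in> coord_vecs I"
  shows "v = (\<Sum>i\<in>I. fscale (v i) (unit_vec i))"
proof
  fix x
  have "(\<Sum>i\<in>I. v i * unit_vec i x) = (\<Sum>i\<in>I. if i = x then v i else 0)"
    by (rule sum.cong) (auto simp: unit_vec_def)
  also have "\<dots> = v x" using assms by (auto simp: coord_vecs_def)
  finally show "v x = (\<Sum>i\<in>I. fscale (v i) (unit_vec i)) x" by (simp add: sum_apply fscale_def)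
qed

lemma coord_vecs_subset_span:
  assumes "finite I"
  shows "coord_vecs I \<subseteq> fvs.span (unit_vec ` I :: ('i \<Rightarrow> 'k::field) set)"
proof
  fix v :: "'i \<Rightarrow> 'k" assume "v \<in> coord_vecs I"
  note * = coord_vecs_expand[OF assms this]
  show "v \<in> fvs.span (unit_vec ` I)"
    by (subst *) (intro fvs.span_sum fvs.span_scale fvs.span_base imageI)
qed

lemma subspace_coord_vecs: "fvs.subspace (coord_vecs I)"
  by (auto simp: fvs.subspace_def coord_vecs_def fscale_def)

lemma span_subset_coord_vecs: "S \<subseteq> coord_vecs I \<Longrightarrow> fvs.span S \<subseteq> coord_vecs I"
  using fvs.span_minimal subspace_coord_vecs by blast

lemma independent_unit_vec: 
  assumes "finite I" shows "fvs.independent (unit_vec ` I :: ('i \<Rightarrow> 'k::field) set)"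
    "card (unit_vec ` I :: ('i \<Rightarrow> 'k::field) set) = card I"
proof -
  have inj: "inj (unit_vec :: 'i \<Rightarrow> 'i \<Rightarrow> 'k)"
    by (rule injI) (metis unit_vec_same unit_vec_other zero_neq_one)
  then show "card (unit_vec ` I :: ('i \<Rightarrow> 'k::field) set) = card I"
    by (meson card_image inj_on_subset subset_UNIV)
  show "fvs.independent (unit_vec ` I :: ('i \<Rightarrow> 'k::field) set)"
  proof (rule fvs.independent_if_scalars_zero)
    show "finite (unit_vec ` I :: ('i \<Rightarrow> 'k::field) set)" using assms by simp
    fix f :: "('i \<Rightarrow> 'k) \<Rightarrow> 'k" and x :: "'i \<Rightarrow> 'k"
    assume s: "(\<Sum>x\<in>unit_vec ` I. fscale (f x) x) = 0" and x: "x \<in> unit_vec ` I"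
    then obtain j where j: "j \<in> I" "x = unit_vec j" by blast
    have "(\<Sum>x\<in>unit_vec ` I. fscale (f x) x) = (\<Sum>i\<in>I. fscale (f (unit_vec i)) (unit_vec i))"
      using inj by (subst sum.reindex) (auto intro: inj_on_subset)
    then have "(\<Sum>i\<in>I. f (unit_vec i) * unit_vec i j) = (0 :: 'k)"
      using s by (metis (no_types, lifting) fscale_def sum.cong sum_apply zero_fun_apply)
    moreover have "(\<Sum>i\<in>I. f (unit_vec i) * unit_vec i j) = (\<Sum>i\<in>I. if i = j then f (unit_vec i) else 0)"
      by (rule sum.cong) (auto simp: unit_vec_def)
    ultimately show "f x = 0" using j assms by simp
  qed
qed

lemma dim_coord_vecs:
  assumes "finite I" shows "fvs.dim (coord_vecs I :: ('i \<Rightarrow> 'k::field) set) = card I"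
proof -
  have "card (unit_vec ` I :: ('i \<Rightarrow> 'k) set) = fvs.dim (coord_vecs I :: ('i \<Rightarrow> 'k) set)"
    by (rule fvs.basis_card_eq_dim)
       (auto simp: independent_unit_vec[OF assms] coord_vecs_subset_span[OF assms], auto simp: coord_vecs_def unit_vec_def)
  then show ?thesis using independent_unit_vec(2)[OF assms] by (metis (no_types))
qed

text \<open>The functional comes as a coefficient vector \<open>F\<close>, so it is at the same time
  a linear form in the homogeneous coordinates: a hyperplane through the span that misses
  \<open>v\<close>.\<close>

lemma coord_vecs_dual:
  fixes v :: "'i \<Rightarrow> 'k::field"
  assumes "finite I" "S \<subseteq> coord_vecs I" "v \<in> coord_vecs I" "v \<notin> fvs.span S"
  obtains F where "\<And>s. s \<in> fvs.span S \<Longrightarrow> (\<Sum>i\<in>I. F i * s i) = 0" "(\<Sum>i\<in>I. F i * v i) = 1"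
proof -
  interpret vp: vector_space_pair fscale "(*) :: 'k \<Rightarrow> 'k \<Rightarrow> 'k"
    by unfold_locales (auto simp: algebra_simps)
  obtain B where B: "B \<subseteq> S" "fvs.independent B" "S \<subseteq> fvs.span B"
    using fvs.maximal_independent_subset[of S] by metis
  then have sp: "fvs.span S = fvs.span B"
    by (meson fvs.span_minimal fvs.span_mono fvs.subspace_span subset_antisym)
  then have "fvs.independent (insert v B)"
    using B assms(4) fvs.independent_insertI by blast
  then obtain g where g: "Vector_Spaces.linear fscale (*) g" 
      "\<forall>x\<in>insert v B. g x = (if x = v then 1 else 0)"
    using vp.linear_independent_extend[of "insert v B" "\<lambda>x. if x = v then 1 else 0"] by blast
  have lin: "g (a + b) = g a + g b" "g (fscale c a) = c * g a" for a b c
    using vp.linear_add[OF g(1)] vp.linear_scale[OF g(1)] by auto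
  have gs: "g s = (\<Sum>i\<in>I. g (unit_vec i) * s i)" if "s \<in> coord_vecs I" for s
  proof -
    have "g s = g (\<Sum>i\<in>I. fscale (s i) (unit_vec i))"
      by (rule arg_cong[where f = g], rule coord_vecs_expand[OF assms(1) that])
    also have "\<dots> = (\<Sum>i\<in>I. g (fscale (s i) (unit_vec i)))"
      by (rule vp.linear_sum[OF g(1)])
    finally show ?thesis by (simp add: lin(2) mult.commute)
  qed
  show ?thesis
  proof (rule that[of "\<lambda>i. g (unit_vec i)"])
    fix s assume s: "s \<in> fvs.span S"
    have "v \<notin> B" using sp assms(4) fvs.span_base by blast
    then have "g b = 0" if "b \<in> B" for b using that g(2) by auto
    then have "g s = 0" using vp.linear_eq_0_on_span[OF g(1)] s sp by blast
    then show "(\<Sum>i\<in>I. g (unit_vec i) * s i) = 0"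
      using gs[of s] span_subset_coord_vecs[OF assms(2)] s by auto
  next
    show "(\<Sum>i\<in>I. g (unit_vec i) * v i) = 1" using gs[OF assms(3)] g(2) by auto
  qed
qed

text \<open>Independence of a family and not of its image: vectors that depend on a parameter may
  coincide for special values, and the image would then lose members without becoming
  dependent.\<close>

definition indep_family :: "'r set \<Rightarrow> ('r \<Rightarrow> 'i \<Rightarrow> 'k::field) \<Rightarrow> bool" where
  "indep_family R v \<longleftrightarrow> (\<forall>c. (\<Sum>r\<in>R. fscale (c r) (v r)) = 0 \<longrightarrow> (\<forall>r\<in>R. c r = 0))"

lemma indep_family_iff:
  assumes "finite R"
  shows "indep_family R v \<longleftrightarrow> inj_on v R \<and> fvs.independent (v ` R)"
proof
  assume L: "indep_family R v"
  have inj: "inj_on v R"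
  proof (rule inj_onI, rule ccontr)
    fix r s assume rs: "r \<in> R" "s \<in> R" "v r = v s" "r \<noteq> s"
    let ?c = "\<lambda>x. if x = r then 1 else if x = s then -1 else (0::'c)"
    have "(\<Sum>x\<in>R. fscale (?c x) (v x)) = (\<Sum>x\<in>{r,s}. fscale (?c x) (v x))"
      by (rule sum.mono_neutral_right) (use rs assms in \<open>auto simp: fscale_def\<close>)
    also have "\<dots> = 0" using rs by (auto simp: fscale_def fun_eq_iff)
    finally have "\<forall>r\<in>R. ?c r = 0" using L unfolding indep_family_def by (elim allE impE)
    then show False using rs(1) by force
  qed
  moreover have "fvs.independent (v ` R)"
  proof (rule fvs.independent_if_scalars_zero)
    fix f x assume "(\<Sum>x\<in>v ` R. fscale (f x) x) = 0" "x \<in> v ` R"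
    then have "(\<Sum>r\<in>R. fscale (f (v r)) (v r)) = 0"
      using inj by (simp add: sum.reindex)
    then have "\<forall>r\<in>R. f (v r) = 0" using L[unfolded indep_family_def, THEN spec, of "\<lambda>r. f (v r)"] by blast
    then show "f x = 0" using \<open>x \<in> v ` R\<close> by auto
  qed (use assms in simp)
  ultimately show "inj_on v R \<and> fvs.independent (v ` R)" ..
next
  assume R: "inj_on v R \<and> fvs.independent (v ` R)"
  show "indep_family R v"
    unfolding indep_family_def
  proof (intro allI impI ballI)
    fix c r assume c: "(\<Sum>r\<in>R. fscale (c r) (v r)) = 0" and r: "r \<in> R"
    let ?u = "\<lambda>x. c (inv_into R v x)"
    have "(\<Sum>x\<in>v ` R. fscale (?u x) x) = 0"
      using c R by (subst sum.reindex) (auto cong: sum.cong)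
    then have "?u (v r) = 0"
      using fvs.independentD[of "v ` R" "v ` R" ?u "v r"] R r assms by auto
    then show "c r = 0" using R r by simp
  qed
qed

lemma indep_familyD:
  "indep_family R v \<Longrightarrow> (\<And>i. (\<Sum>r\<in>R. c r * v r i) = 0) \<Longrightarrow> r \<in> R \<Longrightarrow> c r = 0"
  unfolding indep_family_def fun_eq_iff by (simp add: sum_apply fscale_def)

lemma indep_familyI:
  "(\<And>c r. (\<And>i. (\<Sum>r\<in>R. c r * v r i) = 0) \<Longrightarrow> r \<in> R \<Longrightarrow> c r = 0) \<Longrightarrow> indep_family R v"
  unfolding indep_family_def fun_eq_iff by (simp add: sum_apply fscale_def)

lemma dim_ge_indep_family:
  assumes "finite I" "\<And>r. r \<in> R \<Longrightarrow> v r \<in> coord_vecs I"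
    and "finite R" "R' \<subseteq> R" "indep_family R' v"
  shows "card R' \<le> fvs.dim (v ` R)"
proof -
  have fin: "finite R'" using assms finite_subset by blast
  have "v ` R \<subseteq> fvs.span (unit_vec ` I)"
    using assms(2) coord_vecs_subset_span[OF assms(1)] by blast
  moreover have "v ` R' \<subseteq> fvs.span (v ` R)" using assms(4) fvs.span_superset by blast
  ultimately have "card (v ` R') \<le> fvs.dim (v ` R)"
    using fvs.independent_card_le_dim_finite(2)[of "unit_vec ` I" "v ` R" "v ` R'"] assms(1,5)
      indep_family_iff[OF fin, of v] by auto
  then show ?thesis using assms(5) indep_family_iff[OF fin, of v] by (metis card_image)
qed

lemma indep_subfamily_dim:
  assumes "finite I" "\<And>r. r \<in> R \<Longrightarrow> v r \<in> coord_vecs I" "finite R"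
  obtains R' where "R' \<subseteq> R" "indep_family R' v" "card R' = fvs.dim (v ` R)"
proof -
  obtain B where B: "B \<subseteq> v ` R" "finite B" "fvs.independent B" "card B = fvs.dim (v ` R)"
    using fvs.finite_basis[OF finite_imageI[OF assms(3)] fvs.span_superset] by metis
  obtain R' where R': "R' \<subseteq> R" "inj_on v R'" "v ` R' = B"
    using B(1)[unfolded subset_image_inj] by auto
  have "finite R'" using R' assms(3) finite_subset by blast
  then have "indep_family R' v" using R' B by (simp add: indep_family_iff)
  moreover have "card R' = card B" using R' by (metis card_image)
  ultimately show ?thesis using that R' B by metis
qed

lemma dependent_family_card:
  assumes "finite B" "finite E" "card B < card E" "\<And>e. e \<in> E \<Longrightarrow> v e \<in> fvs.span B"
  obtains c e where "e \<in> E" "c e \<noteq> 0" "\<And>i. (\<Sum>e\<in>E. c e * v e i) = 0"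
proof -
  have "\<not> indep_family E v"
  proof
    assume "indep_family E v"
    then have "inj_on v E" "fvs.independent (v ` E)" using indep_family_iff[OF assms(2)] by auto
    then have "card E \<le> card B"
      using fvs.independent_span_bound[OF assms(1), of "v ` E"] assms(4) by (auto simp: card_image)
    then show False using assms(3) by simp
  qed
  then show ?thesis using that unfolding indep_family_def fun_eq_iff
    by (auto simp: sum_apply fscale_def)
qed

section \<open>Polynomial functions and generic points\<close>

definition poly_fun :: "('k::field \<Rightarrow> 'k) \<Rightarrow> bool" where
  "poly_fun f \<longleftrightarrow> (\<exists>p. \<forall>t. f t = poly p t)"

lemma poly_fun_const [intro, simp]: "poly_fun (\<lambda>t. c)"
  unfolding poly_fun_def by (rule exI[of _ "[:c:]"]) simp

lemma poly_fun_id [intro, simp]: "poly_fun (\<lambda>t. t)"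
  unfolding poly_fun_def by (rule exI[of _ "[:0, 1:]"]) simp

lemma poly_fun_add [intro]: "poly_fun f \<Longrightarrow> poly_fun g \<Longrightarrow> poly_fun (\<lambda>t. f t + g t)"
  unfolding poly_fun_def by (metis poly_add)

lemma poly_fun_diff [intro]: "poly_fun f \<Longrightarrow> poly_fun g \<Longrightarrow> poly_fun (\<lambda>t. f t - g t)"
  unfolding poly_fun_def by (metis poly_diff)

lemma poly_fun_mult [intro]: "poly_fun f \<Longrightarrow> poly_fun g \<Longrightarrow> poly_fun (\<lambda>t. f t * g t)"
  unfolding poly_fun_def by (metis poly_mult)

lemma poly_fun_power [intro]: "poly_fun f \<Longrightarrow> poly_fun (\<lambda>t. f t ^ n)"
  unfolding poly_fun_def by (metis poly_power)

lemma poly_fun_sum [intro]: "(\<And>i. i \<in> A \<Longrightarrow> poly_fun (f i)) \<Longrightarrow> poly_fun (\<lambda>t. \<Sum>i\<in>A. f i t)"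
  by (induction A rule: infinite_finite_induct) auto

lemma poly_fun_prod [intro]: "(\<And>i. i \<in> A \<Longrightarrow> poly_fun (f i)) \<Longrightarrow> poly_fun (\<lambda>t. \<Prod>i\<in>A. f i t)"
  by (induction A rule: infinite_finite_induct) auto

lemma poly_fun_finite_zeros:
  assumes "poly_fun f" "f t0 \<noteq> 0" shows "finite {t. f t = 0}"
proof -
  obtain p where p: "\<And>t. f t = poly p t" using assms(1) unfolding poly_fun_def by blast
  then have "p \<noteq> 0" using assms(2) by auto
  then show ?thesis using p poly_roots_finite by simp
qed

lemma poly_fun_const_zero:
  fixes f :: "'k::field_char_0 \<Rightarrow> 'k"
  assumes "poly_fun f" "finite {t. f t \<noteq> 0}" shows "f t = 0"
proof (rule ccontr)
  assume "f t \<noteq> 0"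
  then have "finite ({t. f t = 0} \<union> {t. f t \<noteq> 0})" using poly_fun_finite_zeros[OF assms(1)] assms(2) by blast
  moreover have "{t. f t = 0} \<union> {t. f t \<noteq> 0} = UNIV" by blast
  ultimately show False using infinite_UNIV_char_0 by metis
qed

text \<open>One step of Gaussian elimination without division. The pivot \<open>a t\<close> is a
  nonzero polynomial in \<open>t\<close>, and the reduced rows \<open>w t r\<close> stay polynomial.
  Outside the zeros of the pivot, independence of the reduced family gives that of the whole
  one.\<close>

lemma indep_family_generic:
  fixes v :: "'k::field_char_0 \<Rightarrow> 'r \<Rightarrow> 'i \<Rightarrow> 'k"
  assumes "finite R" "\<And>r i. r \<in> R \<Longrightarrow> poly_fun (\<lambda>t. v t r i)" "indep_family R (v t0)"
  shows "finite {t. \<not> indep_family R (v t)}"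
  using assms
proof (induction R arbitrary: v)
  case empty
  then show ?case by (simp add: indep_family_def)
next
  case (insert r0 R)
  have "\<exists>i. v t0 r0 i \<noteq> 0"
  proof (rule ccontr)
    assume "\<not> ?thesis"
    then have "(\<Sum>r\<in>insert r0 R. (if r = r0 then 1 else 0) * v t0 r i) = 0" for i
      by (intro sum.neutral) auto
    from indep_familyD[OF insert.prems(2) this, of r0] show False by simp
  qed
  then obtain i0 where i0: "v t0 r0 i0 \<noteq> 0" by blast
  define a where "a t = v t r0 i0" for t
  define w where "w t r i = a t * v t r i - v t r i0 * v t r0 i" for t r i
  \<comment> \<open>A relation among the reduced rows is a relation among the original ones with
    coefficients multiplied by the pivot, the coefficient of \<open>r0\<close> collecting what was
    subtracted.\<close>
  have key: "(\<Sum>r\<in>insert r0 R. (if r = r0 then - (\<Sum>r\<in>R. c r * v t r i0) else c r * a t) * v t r i)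
      = (\<Sum>r\<in>R. c r * w t r i)" for c t i
  proof -
    have "(\<Sum>r\<in>R. (if r = r0 then - (\<Sum>r\<in>R. c r * v t r i0) else c r * a t) * v t r i)
      = (\<Sum>r\<in>R. c r * a t * v t r i)"
      by (rule sum.cong) (use insert in auto)
    then show ?thesis using insert.hyps
      by (simp add: w_def algebra_simps sum_subtractf sum_distrib_left sum_distrib_right)
  qed
  have "indep_family R (w t0)"
  proof (rule indep_familyI)
    fix c r assume c: "\<And>i. (\<Sum>r\<in>R. c r * w t0 r i) = 0" and r: "r \<in> R"
    have "(if r = r0 then - (\<Sum>r\<in>R. c r * v t0 r i0) else c r * a t0) = 0"
      by (rule indep_familyD[OF insert.prems(2)]) (use key c r in auto)
    then show "c r = 0" using r insert.hyps i0 by (auto simp: a_def split: if_splits)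
  qed
  moreover have "poly_fun (\<lambda>t. w t r i)" if "r \<in> R" for r i
    unfolding w_def a_def using that insert.prems(1)[of r] insert.prems(1)[of r0] 
    by (intro poly_fun_diff poly_fun_mult) auto
  ultimately have "finite {t. \<not> indep_family R (w t)}" using insert.IH[of w] by blast
  moreover have "finite {t. a t = 0}"
    using poly_fun_finite_zeros[of "\<lambda>t. v t r0 i0" t0] insert.prems(1)[of r0 i0] i0 by (simp add: a_def)
  moreover have "indep_family (insert r0 R) (v t)" if t: "a t \<noteq> 0" "indep_family R (w t)" for t
  proof (rule indep_familyI)
    fix b r assume b: "\<And>i. (\<Sum>r\<in>insert r0 R. b r * v t r i) = 0" and r: "r \<in> insert r0 R"
    have b': "b r0 * v t r0 i = - (\<Sum>r\<in>R. b r * v t r i)" for i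
      using b[of i] insert.hyps by (simp add: add_eq_0_iff)
    have "(\<Sum>r\<in>R. b r * w t r i) = 0" for i
    proof -
      have "(\<Sum>r\<in>R. b r * w t r i) = a t * (\<Sum>r\<in>R. b r * v t r i) - (\<Sum>r\<in>R. b r * v t r i0) * v t r0 i"
        by (simp add: w_def algebra_simps sum_subtractf sum_distrib_left sum_distrib_right)
      also have "\<dots> = - a t * (b r0 * v t r0 i) + (b r0 * v t r0 i0) * v t r0 i"
        unfolding b' by simp
      also have "\<dots> = 0" by (simp add: a_def)
      finally show ?thesis .
    qed
    then have bR: "b r = 0" if "r \<in> R" for r using indep_familyD[OF t(2)] that by blast
    then have "b r0 * a t = 0" using b'[of i0] by (simp add: a_def)
    then show "b r = 0" using bR r t by auto
  qed
  then have "{t. \<not> indep_family (insert r0 R) (v t)} \<subseteq> {t. a t = 0} \<union> {t. \<not> indep_family R (w t)}" by blast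
  ultimately show ?case using finite_subset by blast
qed

section \<open>Configurations of points along lines, and open conditions\<close>

definition seg :: "('h \<Rightarrow> 'q \<Rightarrow> 'k::field) \<Rightarrow> ('h \<Rightarrow> 'q \<Rightarrow> 'k) \<Rightarrow> 'k \<Rightarrow> 'h \<Rightarrow> 'q \<Rightarrow> 'k" where
  "seg P Q t = (\<lambda>h q. P h q + t * (Q h q - P h q))"

lemma seg_0 [simp]: "seg P Q 0 = P" and seg_1 [simp]: "seg P Q 1 = Q"
  by (simp_all add: seg_def)

lemma seg_flip: "seg P Q t = seg Q P (1 - t)"
  by (auto simp: seg_def fun_eq_iff algebra_simps)

text \<open>Substitute for a Zariski open condition on configurations. It may hold nowhere, so a
  configuration that satisfies it is always exhibited separately.\<close>

definition open_cond :: "(('h \<Rightarrow> 'q \<Rightarrow> 'k::field) \<Rightarrow> bool) \<Rightarrow> bool" where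
  "open_cond G \<longleftrightarrow> (\<forall>P Q. G P \<longrightarrow> finite {t. \<not> G (seg P Q t)})"

lemma open_condD: "open_cond G \<Longrightarrow> G P \<Longrightarrow> finite {t. \<not> G (seg P Q t)}"
  unfolding open_cond_def by blast

lemma open_condD2: 
  assumes "open_cond G" "G Q" shows "finite {t. \<not> G (seg P Q t)}"
proof -
  have "t \<in> (\<lambda>t. 1 - t) ` {t. \<not> G (seg Q P t)}" if "\<not> G (seg P Q t)" for t
    using that seg_flip[of P Q t] by (intro image_eqI[of _ _ "1 - t"]) simp_all
  then have "{t. \<not> G (seg P Q t)} \<subseteq> (\<lambda>t. 1 - t) ` {t. \<not> G (seg Q P t)}" by blast
  then show ?thesis using finite_subset open_condD[OF assms, of P] by blast
qed

lemma open_cond_conj: "open_cond G \<Longrightarrow> open_cond H \<Longrightarrow> open_cond (\<lambda>P. G P \<and> H P)"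
  unfolding open_cond_def de_Morgan_conj Collect_disj_eq finite_Un by blast

lemma open_cond_ball: "finite S \<Longrightarrow> (\<And>s. s \<in> S \<Longrightarrow> open_cond (G s)) \<Longrightarrow> open_cond (\<lambda>P. \<forall>s\<in>S. G s P)"
proof (induction S rule: finite_induct)
  case empty
  then show ?case by (simp add: open_cond_def)
next
  case (insert x F)
  then have "open_cond (\<lambda>P. G x P \<and> (\<forall>s\<in>F. G s P))" by (intro open_cond_conj) auto
  then show ?case by simp
qed

text \<open>On the line that joins \<open>P\<close> to \<open>Q\<close> both conditions fail
  finitely often, and the field is infinite.\<close>

lemma open_cond_inter:
  fixes G H :: "('h \<Rightarrow> 'q \<Rightarrow> 'k::field_char_0) \<Rightarrow> bool"
  assumes "open_cond G" "open_cond H" "G P" "H Q"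
  obtains R where "G R" "H R"
proof -
  have "finite ({t. \<not> G (seg P Q t)} \<union> {t. \<not> H (seg P Q t)})"
    using open_condD[OF assms(1,3)] open_condD2[OF assms(2,4)] by blast
  then obtain t where "t \<notin> {t. \<not> G (seg P Q t)} \<union> {t. \<not> H (seg P Q t)}"
    using infinite_UNIV_char_0 by (metis ex_new_if_finite)
  then show ?thesis using that by blast
qed

lemma open_cond_inter_finite:
  fixes G :: "'s \<Rightarrow> ('h \<Rightarrow> 'q \<Rightarrow> 'k::field_char_0) \<Rightarrow> bool"
  assumes "finite S" "\<And>s. s \<in> S \<Longrightarrow> open_cond (G s)" "\<And>s. s \<in> S \<Longrightarrow> \<exists>P. G s P"
  shows "\<exists>P. \<forall>s\<in>S. G s P"
  using assms
proof (induction S rule: finite_induct)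
  case empty
  then show ?case by simp
next
  case (insert x F)
  have "\<exists>P. \<forall>s\<in>F. G s P" by (rule insert.IH) (use insert.prems in simp_all)
  then obtain P where "\<forall>s\<in>F. G s P" ..
  moreover obtain Q where "G x Q" using insert.prems(2)[of x] by blast
  moreover have "open_cond (\<lambda>P. \<forall>s\<in>F. G s P)" using insert by (intro open_cond_ball) auto
  ultimately obtain R where "\<forall>s\<in>F. G s R" "G x R"
    using open_cond_inter[of "\<lambda>P. \<forall>s\<in>F. G s P" "G x" P Q] insert.prems(1)[of x] by blast
  then show ?case by auto
qed

text \<open>Rank drops only at special parameters: a subfamily that is independent at
  \<open>P\<close> stays independent for almost all \<open>t\<close>.\<close>

lemma open_cond_dim:
  fixes v :: "('h \<Rightarrow> 'q \<Rightarrow> 'k::field_char_0) \<Rightarrow> 'r \<Rightarrow> 'i \<Rightarrow> 'k"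
  assumes I: "finite I" and v: "\<And>P r. r \<in> R \<Longrightarrow> v P r \<in> coord_vecs I" and R: "finite R"
    and poly: "\<And>P Q r i. r \<in> R \<Longrightarrow> poly_fun (\<lambda>t. v (seg P Q t) r i)"
  shows "open_cond (\<lambda>P. d \<le> fvs.dim (v P ` R))"
  unfolding open_cond_def
proof (intro allI impI)
  fix P Q :: "'h \<Rightarrow> 'q \<Rightarrow> 'k" assume d: "d \<le> fvs.dim (v P ` R)"
  obtain R' where R': "R' \<subseteq> R" "indep_family R' (v P)" "card R' = fvs.dim (v P ` R)"
    by (rule indep_subfamily_dim[of I R "v P", OF I v R])
  have f: "finite R'" using R R' finite_subset by blast
  have fin: "finite {t. \<not> indep_family R' (v (seg P Q t))}"
    by (rule indep_family_generic[of R' "\<lambda>t. v (seg P Q t)" 0]) (use R' poly f in auto)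
  have "{t. \<not> d \<le> fvs.dim (v (seg P Q t) ` R)} \<subseteq> {t. \<not> indep_family R' (v (seg P Q t))}"
  proof (rule Collect_mono, rule impI, erule contrapos_nn)
    fix t assume "indep_family R' (v (seg P Q t))"
    then have "card R' \<le> fvs.dim (v (seg P Q t) ` R)"
      using dim_ge_indep_family[of I R "v (seg P Q t)" R'] I v R R'(1) by blast
    then show "d \<le> fvs.dim (v (seg P Q t) ` R)" using d R' by simp
  qed
  then show "finite {t. \<not> d \<le> fvs.dim (v (seg P Q t) ` R)}" using fin finite_subset by blast
qed

section \<open>Monomials\<close>

text \<open>Induction on the variables: with the others fixed, the sum is a polynomial in one
  variable that vanishes everywhere, so each of its coefficients is a relation in fewer variables.
  Exponents are total functions, hence the hypothesis that \<open>J\<close> tells those in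
  \<open>B\<close> apart.\<close>

lemma monomials_independent:
  fixes c :: "('q \<Rightarrow> nat) \<Rightarrow> 'k::field_char_0"
  assumes "finite J" "finite B" "\<And>\<beta> \<gamma>. \<beta> \<in> B \<Longrightarrow> \<gamma> \<in> B \<Longrightarrow> (\<And>q. q \<in> J \<Longrightarrow> \<beta> q = \<gamma> q) \<Longrightarrow> \<beta> = \<gamma>"
    and "\<And>x. (\<Sum>\<beta>\<in>B. c \<beta> * monomial J \<beta> x) = 0" "\<beta> \<in> B"
  shows "c \<beta> = 0"
  using assms
proof (induction J arbitrary: B \<beta> rule: finite_induct)
  case empty
  then have "B = {\<beta>}" by auto
  then show ?case using empty.prems(3) by (auto simp: monomial_def)
next
  case (insert q J)
  define Bn where "Bn n = {\<gamma>\<in>B. \<gamma> q = n}" for n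
  have fB: "finite (Bn n)" for n using insert.prems by (simp add: Bn_def)
  have z: "(\<Sum>\<gamma>\<in>Bn n. c \<gamma> * monomial J \<gamma> x) = 0" for n x
  proof -
    define p where "p = (\<Sum>\<gamma>\<in>B. monom (c \<gamma> * monomial J \<gamma> x) (\<gamma> q))"
    have "poly p t = 0" for t
    proof -
      have "poly p t = (\<Sum>\<gamma>\<in>B. c \<gamma> * monomial (insert q J) \<gamma> (x(q := t)))"
        unfolding p_def poly_sum
      proof (rule sum.cong)
        fix \<gamma> assume "\<gamma> \<in> B"
        have "monomial J \<gamma> (x(q := t)) = monomial J \<gamma> x"
          unfolding monomial_def by (rule prod.cong) (use insert.hyps in auto)
        then show "poly (monom (c \<gamma> * monomial J \<gamma> x) (\<gamma> q)) t = c \<gamma> * monomial (insert q J) \<gamma> (x(q := t))"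
          using insert.hyps by (simp add: monomial_def poly_monom)
      qed simp
      then show ?thesis using insert.prems(3) by simp
    qed
    then have "p = 0" using poly_all_0_iff_0 by blast
    then have "coeff p n = 0" by simp
    moreover have "coeff p n = (\<Sum>\<gamma>\<in>B. if \<gamma> q = n then c \<gamma> * monomial J \<gamma> x else 0)"
      unfolding p_def coeff_sum by (rule sum.cong) auto
    moreover have "\<dots> = (\<Sum>\<gamma>\<in>Bn n. c \<gamma> * monomial J \<gamma> x)"
      unfolding Bn_def by (rule sum.inter_filter[symmetric]) (use insert.prems in auto)
    ultimately show ?thesis by simp
  qed
  show ?case
  proof (rule insert.IH[of "Bn (\<beta> q)"])
    fix \<beta>' \<gamma>' assume bg: "\<beta>' \<in> Bn (\<beta> q)" "\<gamma>' \<in> Bn (\<beta> q)" "\<And>p. p \<in> J \<Longrightarrow> \<beta>' p = \<gamma>' p"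
    show "\<beta>' = \<gamma>'" by (rule insert.prems(2)) (use bg in \<open>auto simp: Bn_def\<close>)
  qed (use fB z insert.prems in \<open>auto simp: Bn_def\<close>)
qed

text \<open>The derivative of the monomial at \<open>x\<close> in direction \<open>z\<close>. The
  truncated difference is harmless, since the coefficient is zero when
  \<open>\<beta> q = 0\<close>.\<close>

definition dmonomial :: "'q set \<Rightarrow> ('q \<Rightarrow> nat) \<Rightarrow> ('q \<Rightarrow> 'k::field) \<Rightarrow> ('q \<Rightarrow> 'k) \<Rightarrow> 'k" where
  "dmonomial J \<beta> x z =
     (\<Sum>q\<in>J. of_nat (\<beta> q) * x q ^ (\<beta> q - 1) * z q * (\<Prod>p\<in>J - {q}. x p ^ \<beta> p))"

text \<open>The monomial on the line \<open>x + t z\<close>, as a polynomial in \<open>t\<close>.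
  Its linear coefficient is the derivative, so identities between monomials become identities
  between derivatives by comparing coefficients.\<close>

definition line_poly :: "'q set \<Rightarrow> ('q \<Rightarrow> nat) \<Rightarrow> ('q \<Rightarrow> 'k::field) \<Rightarrow> ('q \<Rightarrow> 'k) \<Rightarrow> 'k poly" where
  "line_poly J \<beta> x z = (\<Prod>q\<in>J. [:x q, z q:] ^ \<beta> q)"

lemma poly_line_poly: "poly (line_poly J \<beta> x z) t = monomial J \<beta> (\<lambda>q. x q + t * z q)"
  by (simp add: line_poly_def monomial_def poly_prod poly_power)

lemma coeff_line_poly_0: "coeff (line_poly J \<beta> x z) 0 = monomial J \<beta> x"
  unfolding poly_0_coeff_0[symmetric] poly_line_poly by simp

lemma coeff_line_poly_1:
  fixes x :: "'q \<Rightarrow> 'k::field_char_0"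
  shows "coeff (line_poly J \<beta> x z) (Suc 0) = dmonomial J \<beta> x z"
proof -
  have p: "pderiv [:a, b:] = [:b:]" for a b :: 'k by (simp add: pderiv_pCons)
  have pw: "pderiv (P ^ n) = smult (of_nat n) (P ^ (n - 1) * pderiv P)" for P :: "'k poly" and n
    by (cases n) (simp_all add: pderiv_power_Suc del: power_Suc)
  have "coeff (line_poly J \<beta> x z) (Suc 0) = poly (pderiv (line_poly J \<beta> x z)) 0"
    by (simp add: poly_0_coeff_0 coeff_pderiv)
  also have "\<dots> = dmonomial J \<beta> x z"
    unfolding line_poly_def dmonomial_def pderiv_prod poly_sum
  proof (rule sum.cong)
    fix q assume "q \<in> J"
    have "pderiv ([:x q, z q:] ^ \<beta> q) = smult (of_nat (\<beta> q)) ([:x q, z q:] ^ (\<beta> q - 1) * [:z q:])"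
      unfolding pw p ..
    then show "poly ((\<Prod>p\<in>J - {q}. [:x p, z p:] ^ \<beta> p) * pderiv ([:x q, z q:] ^ \<beta> q)) 0 =
        of_nat (\<beta> q) * x q ^ (\<beta> q - 1) * z q * (\<Prod>p\<in>J - {q}. x p ^ \<beta> p)"
      by (simp add: poly_prod poly_power algebra_simps)
  qed simp
  finally show ?thesis .
qed

lemma dmonomial_linear:
  "dmonomial J \<beta> x (\<lambda>q. \<Sum>b\<in>A. y b * z b q) = (\<Sum>b\<in>A. y b * dmonomial J \<beta> x (z b))"
proof -
  have "dmonomial J \<beta> x (\<lambda>q. \<Sum>b\<in>A. y b * z b q) = 
    (\<Sum>q\<in>J. \<Sum>b\<in>A. y b * (of_nat (\<beta> q) * x q ^ (\<beta> q - 1) * z b q * (\<Prod>p\<in>J - {q}. x p ^ \<beta> p)))"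
    unfolding dmonomial_def by (intro sum.cong refl) (simp add: sum_distrib_left sum_distrib_right algebra_simps)
  also have "\<dots> = (\<Sum>b\<in>A. y b * dmonomial J \<beta> x (z b))"
    unfolding dmonomial_def by (subst sum.swap) (simp add: sum_distrib_left)
  finally show ?thesis .
qed

lemma dmonomial_scale: "dmonomial J \<beta> x (\<lambda>q. c * z q) = c * dmonomial J \<beta> x z"
  using dmonomial_linear[of J \<beta> x "\<lambda>_. c" "\<lambda>_. z" "{()}"] by simp

lemma dmonomial_add: "dmonomial J \<beta> x (\<lambda>q. z q + w q) = dmonomial J \<beta> x z + dmonomial J \<beta> x w"
  by (simp add: dmonomial_def algebra_simps sum.distrib)

lemma dmonomial_unit:
  assumes "finite J" "q \<in> J"
  shows "dmonomial J \<beta> x (unit_vec q) = of_nat (\<beta> q) * x q ^ (\<beta> q - 1) * (\<Prod>p\<in>J - {q}. x p ^ \<beta> p)"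
proof -
  have "dmonomial J \<beta> x (unit_vec q) = (\<Sum>p\<in>J. if p = q then of_nat (\<beta> q) * x q ^ (\<beta> q - 1) * (\<Prod>p\<in>J - {q}. x p ^ \<beta> p) else 0)"
    unfolding dmonomial_def by (rule sum.cong) (auto simp: unit_vec_def)
  then show ?thesis using assms by simp
qed

text \<open>Transports linear relations between tangent vectors along substitutions that need not be
  invertible.\<close>

lemma dmonomial_substitution:
  fixes C :: "'a \<Rightarrow> 'k::field_char_0"
  assumes "\<And>x. monomial J \<beta> (g x) = (\<Sum>\<alpha>\<in>I. C \<alpha> * monomial J' (ex \<alpha>) x)"
    and "\<And>x z t. g (\<lambda>q. x q + t * z q) = (\<lambda>q. g x q + t * g z q)"
  shows "dmonomial J \<beta> (g x) (g z) = (\<Sum>\<alpha>\<in>I. C \<alpha> * dmonomial J' (ex \<alpha>) x z)"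
proof -
  have "line_poly J \<beta> (g x) (g z) = (\<Sum>\<alpha>\<in>I. smult (C \<alpha>) (line_poly J' (ex \<alpha>) x z))"
    unfolding poly_eq_poly_eq_iff[symmetric]
    by (rule ext) (simp add: poly_line_poly poly_sum assms(1) flip: assms(2))
  then have "coeff (line_poly J \<beta> (g x) (g z)) (Suc 0) = coeff (\<Sum>\<alpha>\<in>I. smult (C \<alpha>) (line_poly J' (ex \<alpha>) x z)) (Suc 0)"
    by simp
  then show ?thesis by (simp only: coeff_line_poly_1 coeff_sum coeff_smult)
qed

definition poly_space :: "'q set \<Rightarrow> ('q \<Rightarrow> nat) set \<Rightarrow> (('q \<Rightarrow> 'k::field) \<Rightarrow> 'k) set" where
  "poly_space J B = fvs.span ((\<lambda>\<beta>. monomial J \<beta>) ` B)"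

lemma poly_space_mult:
  assumes "f \<in> poly_space J B" "g \<in> poly_space J C"
    and "\<And>\<beta> \<gamma>. \<beta> \<in> B \<Longrightarrow> \<gamma> \<in> C \<Longrightarrow> (\<lambda>q. \<beta> q + \<gamma> q) \<in> D"
  shows "(\<lambda>x. f x * g x) \<in> poly_space J D"
proof -
  have 1: "(\<lambda>x. monomial J \<beta> x * g x) \<in> poly_space J D" if b: "\<beta> \<in> B" for \<beta>
    using assms(2) unfolding poly_space_def
  proof (induction rule: fvs.span_induct_alt)
    case base
    show ?case using fvs.span_zero by (simp add: zero_fun_def)
  next
    case (step c m h)
    then obtain \<gamma> where \<gamma>: "\<gamma> \<in> C" "m = monomial J \<gamma>" by blast
    have eq: "(\<lambda>x. monomial J \<beta> x * (fscale c m + h) x) =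
      fscale c (monomial J (\<lambda>q. \<beta> q + \<gamma> q)) + (\<lambda>x. monomial J \<beta> x * h x)"
      by (auto simp: fun_eq_iff fscale_def \<gamma>(2) monomial_def power_add prod.distrib algebra_simps)
    have "monomial J (\<lambda>q. \<beta> q + \<gamma> q) \<in> fvs.span (monomial J ` D)"
      using assms(3)[OF b \<gamma>(1)] by (intro fvs.span_base imageI)
    then show ?case unfolding eq by (intro fvs.span_add[OF fvs.span_scale step(2)])
  qed
  show ?thesis
    using assms(1) unfolding poly_space_def[of J B]
  proof (induction rule: fvs.span_induct_alt)
    case base
    show ?case using fvs.span_zero by (simp add: poly_space_def zero_fun_def)
  next
    case (step c m h)
    then obtain \<beta> where \<beta>: "\<beta> \<in> B" "m = monomial J \<beta>" by blast
    have "(\<lambda>x. (fscale c m + h) x * g x) = fscale c (\<lambda>x. monomial J \<beta> x * g x) + (\<lambda>x. h x * g x)"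
      by (auto simp: fun_eq_iff fscale_def \<beta>(2) algebra_simps)
    then show ?case using step(2) 1[OF \<beta>(1)] unfolding poly_space_def 
      by (auto intro!: fvs.span_add fvs.span_scale)
  qed
qed

lemma poly_space_monomial: "\<beta> \<in> B \<Longrightarrow> monomial J \<beta> \<in> poly_space J B"
  unfolding poly_space_def by (intro fvs.span_base) blast

lemma poly_space_sum:
  assumes "\<And>i. i \<in> A \<Longrightarrow> f i \<in> poly_space J B"
  shows "(\<lambda>x. \<Sum>i\<in>A. c i * f i x) \<in> poly_space J B"
proof -
  have "(\<lambda>x. \<Sum>i\<in>A. c i * f i x) = (\<Sum>i\<in>A. fscale (c i) (f i))"
    by (simp add: fun_eq_iff sum_apply fscale_def)
  then show ?thesis using assms unfolding poly_space_def by (auto intro!: fvs.span_sum fvs.span_scale)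
qed

lemma poly_space_explicit:
  assumes "f \<in> poly_space J B" "finite B"
  obtains c where "\<And>x. f x = (\<Sum>\<beta>\<in>B. c \<beta> * monomial J \<beta> x)"
proof -
  have "f \<in> fvs.span ((\<lambda>\<beta>. monomial J \<beta>) ` B)" using assms unfolding poly_space_def by blast
  then have "\<exists>c. \<forall>x. f x = (\<Sum>\<beta>\<in>B. c \<beta> * monomial J \<beta> x)"
  proof (induction rule: fvs.span_induct_alt)
    case base
    show ?case by (rule exI[of _ "\<lambda>_. 0"]) simp
  next
    case (step a m h)
    then obtain \<gamma> c where \<gamma>: "\<gamma> \<in> B" "m = monomial J \<gamma>" "\<And>x. h x = (\<Sum>\<beta>\<in>B. c \<beta> * monomial J \<beta> x)"
      by blast
    have "(fscale a m + h) x = (\<Sum>\<beta>\<in>B. (c \<beta> + (if \<beta> = \<gamma> then a else 0)) * monomial J \<beta> x)" for x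
    proof -
      have "(\<Sum>\<beta>\<in>B. (if \<beta> = \<gamma> then a else 0) * monomial J \<beta> x) = (\<Sum>\<beta>\<in>B. if \<beta> = \<gamma> then a * monomial J \<gamma> x else 0)"
        by (rule sum.cong) auto
      then show ?thesis using \<gamma> assms(2) by (simp add: fscale_def algebra_simps sum.distrib)
    qed
    then show ?case by (intro exI[of _ "\<lambda>\<beta>. c \<beta> + (if \<beta> = \<gamma> then a else 0)"]) auto
  qed
  then show ?thesis using that by blast
qed

section \<open>Graded spaces of polynomial functions\<close>

text \<open>Covers three notions of degree at once: total degree, a bound on the total degree, and
  multidegree, where the degrees are functions.\<close>

locale grading =
  fixes G :: "'g::comm_monoid_add \<Rightarrow> ('q \<Rightarrow> nat) set"
  assumes zero: "(\<lambda>_. 0) \<in> G 0"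
    and add: "\<And>a b \<beta> \<gamma>. \<beta> \<in> G a \<Longrightarrow> \<gamma> \<in> G b \<Longrightarrow> (\<lambda>q. \<beta> q + \<gamma> q) \<in> G (a + b)"
begin

lemma prod_mem:
  assumes "\<And>a. a \<in> A \<Longrightarrow> f a \<in> poly_space J (G (g a))"
  shows "(\<lambda>x. \<Prod>a\<in>A. f a x) \<in> (poly_space J (G (\<Sum>a\<in>A. g a)) :: (('q \<Rightarrow> 'k::field) \<Rightarrow> 'k) set)"
proof -
  have one: "(\<lambda>x. 1) \<in> (poly_space J (G 0) :: (('q \<Rightarrow> 'k) \<Rightarrow> 'k) set)"
    using poly_space_monomial[OF zero, of J] by (simp add: monomial_def[abs_def])
  show ?thesis using assms
  proof (induction A rule: infinite_finite_induct)
    case (insert a A)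
    have "(\<lambda>x. f a x * (\<Prod>a\<in>A. f a x)) \<in> poly_space J (G (g a + (\<Sum>a\<in>A. g a)))"
      by (rule poly_space_mult[of _ J "G (g a)" _ "G (\<Sum>a\<in>A. g a)"]) (use insert add in auto)
    then show ?case using insert.hyps by simp
  qed (use one in auto)
qed

lemma power_mem:
  fixes f :: "('q \<Rightarrow> 'k::field) \<Rightarrow> 'k"
  assumes "f \<in> poly_space J (G a)"
  shows "(\<lambda>x. f x ^ n) \<in> poly_space J (G (\<Sum>_<n. a))"
  using prod_mem[of "{..<n}" "\<lambda>_. f" J "\<lambda>_. a"] assms by simp

lemma monomial_comp_mem:
  fixes \<Psi> :: "('q \<Rightarrow> 'k::field) \<Rightarrow> 'i \<Rightarrow> 'k"
  assumes "\<And>i. i \<in> I \<Longrightarrow> (\<lambda>y. \<Psi> y i) \<in> poly_space J (G (g i))"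
  shows "(\<lambda>y. monomial I \<alpha> (\<Psi> y)) \<in> poly_space J (G (\<Sum>i\<in>I. \<Sum>_<\<alpha> i. g i))"
  unfolding monomial_def by (intro prod_mem power_mem assms)

end

interpretation exponents: grading "exponents I" for I
  by unfold_locales (auto simp: exponents_def sum.distrib)

definition exponents_le :: "'i set \<Rightarrow> nat \<Rightarrow> ('i \<Rightarrow> nat) set" where
  "exponents_le I d = {\<alpha>. (\<forall>i. i \<notin> I \<longrightarrow> \<alpha> i = 0) \<and> (\<Sum>i\<in>I. \<alpha> i) \<le> d}"

interpretation exponents_le: grading "exponents_le I" for I
  by unfold_locales (auto simp: exponents_le_def sum.distrib)

lemma exponents_le_card:
  assumes "finite I" shows "finite (exponents_le I d)" "card (exponents_le I d) \<le> (d + 1) ^ card I"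
proof -
  let ?h = "\<lambda>\<alpha>. restrict \<alpha> I :: 'a \<Rightarrow> nat"
  have inj: "inj_on ?h (exponents_le I d)"
  proof (rule inj_onI)
    fix \<alpha> \<beta> assume a: "\<alpha> \<in> exponents_le I d" "\<beta> \<in> exponents_le I d" "?h \<alpha> = ?h \<beta>"
    show "\<alpha> = \<beta>"
    proof
      fix i show "\<alpha> i = \<beta> i"
        using a(1,2) fun_cong[OF a(3), of i] unfolding exponents_le_def by (cases "i \<in> I") simp_all
    qed
  qed
  have sub: "?h ` exponents_le I d \<subseteq> (\<Pi>\<^sub>E i\<in>I. {..d})"
  proof (clarsimp simp: exponents_le_def)
    fix \<alpha> :: "'a \<Rightarrow> nat" and i assume s: "sum \<alpha> I \<le> d" "i \<in> I"
    then show "\<alpha> i \<le> d" using member_le_sum[of i I \<alpha>] assms by (meson le_trans zero_le)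
  qed
  have fin: "finite (\<Pi>\<^sub>E i\<in>I. {..d})" using assms by (intro finite_PiE) auto
  show "finite (exponents_le I d)" using inj sub fin by (meson finite_imageD finite_subset)
  have "card (exponents_le I d) = card (?h ` exponents_le I d)" using inj by (simp add: card_image)
  also have "\<dots> \<le> card (\<Pi>\<^sub>E i\<in>I. {..d})" by (rule card_mono[OF fin sub])
  also have "\<dots> = (d + 1) ^ card I" using assms by (simp add: card_PiE)
  finally show "card (exponents_le I d) \<le> (d + 1) ^ card I" .
qed

lemma form_in_poly_space: "form I d c \<in> poly_space I (exponents I d)"
  unfolding form_def[abs_def]
  by (rule poly_space_sum) (rule poly_space_monomial)

lemma poly_space_is_form:
  assumes "finite I" "F \<in> poly_space I (exponents I d)"
  obtains c where "F = form I d c"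
proof -
  obtain c where "\<And>x. F x = (\<Sum>\<beta>\<in>exponents I d. c \<beta> * monomial I \<beta> x)"
    using poly_space_explicit[OF assms(2) finite_exponents[OF assms(1)]] by metis
  then have "F = form I d c" by (auto simp: form_def)
  then show ?thesis using that by blast
qed

lemma poly_space_forms: "finite I \<Longrightarrow> F \<in> poly_space I (exponents I d) \<Longrightarrow> F \<in> forms I"
  by (erule (1) poly_space_is_form) (auto simp: forms_def)

lemma linear_form_mem:
  fixes \<xi> :: "'a \<Rightarrow> 'b::field"
  assumes "finite I"
  shows "(\<lambda>v. \<Sum>i\<in>I. \<xi> i * v i) \<in> poly_space I (exponents I 1)"
proof (rule poly_space_sum)
  fix i assume i: "i \<in> I"
  let ?u = "\<lambda>j. if j = i then 1 else (0::nat)"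
  have "monomial I ?u v = v i" for v :: "'a \<Rightarrow> 'b"
    unfolding monomial_def using assms i by (subst prod.remove[of _ i]) auto
  then have e: "monomial I ?u = (\<lambda>v :: 'a \<Rightarrow> 'b. v i)" by (rule ext)
  have "?u \<in> exponents I 1" using assms i by (auto simp: exponents_def)
  then show "(\<lambda>v :: 'a \<Rightarrow> 'b. v i) \<in> poly_space I (exponents I 1)"
    unfolding e[symmetric] by (rule poly_space_monomial)
qed

lemma form_poly_fun:
  assumes "F \<in> forms I" "\<And>i. i \<in> I \<Longrightarrow> poly_fun (\<lambda>t. \<Psi> t i)"
  shows "poly_fun (\<lambda>t. F (\<Psi> t))"
proof -
  obtain d c where "F = form I d c" using assms(1) by (auto simp: forms_def)
  then show ?thesis unfolding form_def monomial_def using assms(2)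
    by (auto intro!: poly_fun_sum poly_fun_mult poly_fun_prod poly_fun_power)
qed

lemma mem_proj_pt: "v \<in> proj_pt v"
  unfolding proj_pt_def fscale_def by (auto intro!: exI[of _ 1])

lemma proj_pt_in_zero_locus:
  assumes "v \<in> coord_vecs I" "v \<noteq> 0" "S \<subseteq> forms I"
  shows "proj_pt v \<in> zero_locus I S \<longleftrightarrow> (\<forall>F\<in>S. F v = 0)"
proof -
  have p: "proj_pt v \<in> proj_space I" using assms by (auto simp: proj_space_def)
  have "F w = 0" if "F \<in> S" "F v = 0" "w \<in> proj_pt v" for F w
    using form_zero_on_pt[of F I "proj_pt v" v w] that p assms(3) mem_proj_pt by blast
  then show ?thesis using p mem_proj_pt[of v] by (auto simp: zero_locus_def)
qed

section \<open>A lower bound for the dimension\<close>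

text \<open>If two closed sets covered the closure and neither contained \<open>Q\<close>, each
  would have a defining form that is nonzero somewhere on \<open>Q\<close>; a point of
  \<open>Q\<close> where both forms are nonzero lies in neither set.\<close>

lemma irreducible_in_closure:
  assumes fin: "finite I" and ne: "Q \<noteq> {}" and sub: "Q \<subseteq> proj_space I"
    and Y: "zariski I closure_of Q \<subseteq> Y"
    and irr: "\<And>F F' p p'. F \<in> forms I \<Longrightarrow> F' \<in> forms I \<Longrightarrow> p \<in> Q \<Longrightarrow> p' \<in> Q \<Longrightarrow>
      p \<notin> zero_locus I {F} \<Longrightarrow> p' \<notin> zero_locus I {F'} \<Longrightarrow>
      \<exists>p\<in>Q. p \<notin> zero_locus I {F} \<and> p \<notin> zero_locus I {F'}"
  shows "irreducible_in (subtopology (zariski I) Y) (zariski I closure_of Q)"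
  unfolding irreducible_in_def
proof (intro conjI allI impI)
  let ?Z = "zariski I closure_of Q"
  have QZ: "Q \<subseteq> ?Z" using closure_of_subset sub topspace_zariski[OF fin] by metis
  then show "?Z \<noteq> {}" using ne by blast
  show "?Z \<subseteq> topspace (subtopology (zariski I) Y)"
    using Y closure_of_subset_topspace[of "zariski I" Q] by auto
  fix A B assume "closedin (subtopology (zariski I) Y) A \<and> closedin (subtopology (zariski I) Y) B \<and> ?Z \<subseteq> A \<union> B"
  then obtain S T where ST: "S \<subseteq> forms I" "A = zero_locus I S \<inter> Y" "T \<subseteq> forms I" "B = zero_locus I T \<inter> Y"
      "?Z \<subseteq> A \<union> B"
    unfolding closedin_subtopology closedin_zariski[OF fin] by blast
  have "Q \<subseteq> zero_locus I S \<or> Q \<subseteq> zero_locus I T"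
  proof (rule ccontr)
    assume "\<not> ?thesis"
    then obtain p p' where pp: "p \<in> Q" "p \<notin> zero_locus I S" "p' \<in> Q" "p' \<notin> zero_locus I T" by blast
    then obtain F F' where F: "F \<in> S" "p \<notin> zero_locus I {F}" "F' \<in> T" "p' \<notin> zero_locus I {F'}"
      using sub unfolding zero_locus_def by blast
    then obtain r where "r \<in> Q" "r \<notin> zero_locus I {F}" "r \<notin> zero_locus I {F'}"
      using irr[of F F' p p'] pp ST by blast
    then have "r \<notin> zero_locus I S \<union> zero_locus I T" using F unfolding zero_locus_def by blast
    then show False using \<open>r \<in> Q\<close> QZ ST by blast
  qed
  then have "?Z \<subseteq> zero_locus I S \<or> ?Z \<subseteq> zero_locus I T"
    using closure_of_minimal[of Q _ "zariski I"] closedin_zariski[OF fin] ST(1,3) by metis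
  then show "?Z \<subseteq> A \<or> ?Z \<subseteq> B" using ST Y by blast
qed

text \<open>Each \<open>P b\<close> is \<open>t\<close> times some \<open>R b\<close>, so a term
  carries \<open>t\<close> to the power of its total exponent. Dividing by the lowest such power and
  putting \<open>t = 0\<close> leaves the terms of least total exponent, evaluated at the linear
  coefficients \<open>y\<close>, while \<open>P0\<close> becomes 1.\<close>

lemma lowest_terms:
  fixes P0 :: "'k::field_char_0 poly" and P :: "nat \<Rightarrow> 'k poly"
  assumes E: "finite E" and c: "e \<in> E" "c e \<noteq> 0" and min: "\<And>e'. e' \<in> E \<Longrightarrow> c e' \<noteq> 0 \<Longrightarrow> (\<Sum>b\<le>j. e b) \<le> (\<Sum>b\<le>j. e' b)"
    and P0: "coeff P0 0 = 1" and P: "\<And>b. b \<le> j \<Longrightarrow> coeff (P b) 0 = 0 \<and> coeff (P b) (Suc 0) = y b"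
    and van: "\<And>t. (\<Sum>e\<in>E. c e * (poly P0 t ^ (T - (\<Sum>b\<le>j. e b)) * (\<Prod>b\<le>j. poly (P b) t ^ e b))) = 0"
  shows "(\<Sum>e'\<in>{e'\<in>E. (\<Sum>b\<le>j. e' b) = (\<Sum>b\<le>j. e b)}. c e' * monomial {..j} e' y) = 0"
proof -
  have "\<exists>r. P b = pCons 0 r" if "b \<le> j" for b
    using P[OF that] by (cases "P b") auto
  then have "\<forall>b. \<exists>r. b \<le> j \<longrightarrow> P b = pCons 0 r" by blast
  then obtain R where R1: "\<And>b. b \<le> j \<Longrightarrow> P b = pCons 0 (R b)" by metis
  have R: "P b = pCons 0 (R b)" "coeff (R b) 0 = y b" if "b \<le> j" for b
    using R1[OF that] P[OF that] by simp_all
  define m where "m = (\<Sum>b\<le>j. e b)"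
  define f where "f t = (\<Sum>e'\<in>E. c e' * (t ^ ((\<Sum>b\<le>j. e' b) - m) * poly P0 t ^ (T - (\<Sum>b\<le>j. e' b)) * (\<Prod>b\<le>j. poly (R b) t ^ e' b)))" for t
  have pf: "poly_fun (\<lambda>t. poly p t)" for p :: "'k poly" unfolding poly_fun_def by blast
  have "poly_fun f" unfolding f_def
    by (intro poly_fun_sum poly_fun_mult poly_fun_prod poly_fun_power poly_fun_const poly_fun_id pf)
  have "t ^ m * f t = 0" for t
  proof -
    have "t ^ m * f t = (\<Sum>e\<in>E. c e * (poly P0 t ^ (T - (\<Sum>b\<le>j. e b)) * (\<Prod>b\<le>j. poly (P b) t ^ e b)))"
      unfolding f_def sum_distrib_left
    proof (rule sum.cong)
      fix e' assume e': "e' \<in> E"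
      show "t ^ m * (c e' * (t ^ ((\<Sum>b\<le>j. e' b) - m) * poly P0 t ^ (T - (\<Sum>b\<le>j. e' b)) * (\<Prod>b\<le>j. poly (R b) t ^ e' b)))
        = c e' * (poly P0 t ^ (T - (\<Sum>b\<le>j. e' b)) * (\<Prod>b\<le>j. poly (P b) t ^ e' b))"
      proof (cases "c e' = 0")
        case False
        then have t1: "t ^ m * t ^ ((\<Sum>b\<le>j. e' b) - m) = t ^ (\<Sum>b\<le>j. e' b)"
          using min[OF e'] unfolding m_def by (simp flip: power_add)
        have t2: "(\<Prod>b\<le>j. poly (P b) t ^ e' b) = t ^ (\<Sum>b\<le>j. e' b) * (\<Prod>b\<le>j. poly (R b) t ^ e' b)"
          unfolding power_sum prod.distrib[symmetric]
          by (rule prod.cong) (simp_all add: R(1) power_mult_distrib)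
        show ?thesis unfolding t2 t1[symmetric] by (simp only: mult_ac)
      qed simp
    qed simp
    then show ?thesis using van by simp
  qed
  \<comment> \<open>Division by the power of \<open>t\<close> is possible only for nonzero
    \<open>t\<close>; the value at 0 follows because \<open>f\<close> is polynomial.\<close>
  then have "{t. f t \<noteq> 0} \<subseteq> {0}" by auto
  then have "f 0 = 0" using poly_fun_const_zero[OF \<open>poly_fun f\<close>] finite_subset by blast
  moreover have "f 0 = (\<Sum>e'\<in>E. if (\<Sum>b\<le>j. e' b) = m then c e' * monomial {..j} e' y else 0)"
    unfolding f_def
  proof (rule sum.cong)
    fix e' assume e': "e' \<in> E"
    have "(\<Prod>b\<le>j. poly (R b) 0 ^ e' b) = monomial {..j} e' y"
      unfolding monomial_def by (rule prod.cong) (simp_all add: poly_0_coeff_0 R)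
    then show "c e' * (0 ^ ((\<Sum>b\<le>j. e' b) - m) * poly P0 0 ^ (T - (\<Sum>b\<le>j. e' b)) * (\<Prod>b\<le>j. poly (R b) 0 ^ e' b))
        = (if (\<Sum>b\<le>j. e' b) = m then c e' * monomial {..j} e' y else 0)"
      using min[OF e'] P0 unfolding m_def[symmetric] 
      by (cases "c e' = 0") (auto simp: poly_0_coeff_0 power_0_left)
  qed simp
  ultimately show ?thesis using E by (simp add: sum.inter_filter m_def)
qed

text \<open>
  The chain consists of the closures of the images of the coordinate subspaces of dimensions
  \<open>0, \<dots>, r\<close>.  It is strict because the forms of large degree \<open>T\<close> in \<open>j + 2\<close> coordinates outnumber
  the polynomials of degree \<open>T d\<close> in \<open>j\<close> parameters, whereas \<open>j + 2\<close> coordinates with independent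
  differentials satisfy no relation.
\<close>

lemma proj_dim_ge:
  fixes \<Psi> :: "(nat \<Rightarrow> 'k::field_char_0) \<Rightarrow> 'i \<Rightarrow> 'k"
  assumes fin: "finite I" and cl: "closedin (zariski I) Y"
    and co: "\<And>y. \<Psi> y \<in> coord_vecs I"
    and deg: "\<And>j i. i \<in> I \<Longrightarrow> (\<lambda>y. \<Psi> (\<lambda>b. if b < j then y b else 0) i) \<in> poly_space {..<j} (exponents_le {..<j} d)"
    and line: "\<And>y z i. poly_fun (\<lambda>t. \<Psi> (\<lambda>b. y b + t * (z b - y b)) i)"
    and W: "\<And>b. b \<le> r \<Longrightarrow> W b \<in> coord_vecs I" "indep_family {..r} W"
    and tan: "\<And>y i. \<exists>p. (\<forall>t. \<Psi> (\<lambda>b. t * y b) i = poly p t) \<and> coeff p 0 = W 0 i \<and>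
        coeff p (Suc 0) = (\<Sum>b<r. y b * W (Suc b) i)"
    and Y: "\<And>y. \<Psi> y \<noteq> 0 \<Longrightarrow> proj_pt (\<Psi> y) \<in> Y"
  shows "enat r \<le> proj_dim I Y"
proof -
  define Q where "Q j = {proj_pt (\<Psi> y) | y. \<Psi> y \<noteq> 0 \<and> (\<forall>b\<ge>j. y b = 0)}" for j
  define Z where "Z j = zariski I closure_of Q j" for j
  have \<Psi>0: "\<Psi> (\<lambda>_. 0) = W 0"
  proof
    fix i obtain p where "\<forall>t. \<Psi> (\<lambda>b. t * (0::'k)) i = poly p t" "coeff p 0 = W 0 i"
      using tan[of "\<lambda>_. 0" i] by blast
    then show "\<Psi> (\<lambda>_. 0) i = W 0 i" by (metis mult_zero_right poly_0_coeff_0)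
  qed
  have iW: "inj_on W {..r}" "fvs.independent (W ` {..r})" using W(2) indep_family_iff[of "{..r}" W] by auto
  then have W0: "W 0 \<noteq> 0" using fvs.dependent_zero[of "W ` {..r}"] by (metis atMost_iff imageI zero_le)
  have Qsub: "Q j \<subseteq> proj_space I" for j using co by (auto simp: Q_def proj_space_def)
  have Qne: "Q j \<noteq> {}" for j using \<Psi>0 W0 by (auto simp: Q_def intro!: exI[of _ "\<lambda>_. 0"])
  have QY: "Q j \<subseteq> Y" for j using Y by (auto simp: Q_def)
  have ZY: "Z j \<subseteq> Y" for j unfolding Z_def using closure_of_minimal[OF QY cl] .
  have QZ: "Q j \<subseteq> Z j" for j unfolding Z_def using closure_of_subset Qsub topspace_zariski[OF fin] by metis
  have Zcl: "closedin (zariski I) (Z j)" for j unfolding Z_def by simp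
  have nz: "proj_pt (\<Psi> y) \<in> zero_locus I {F} \<longleftrightarrow> F (\<Psi> y) = 0" if "F \<in> forms I" "\<Psi> y \<noteq> 0" for F y
    using proj_pt_in_zero_locus[of "\<Psi> y" I "{F}"] co that by auto
  have irr: "irreducible_in (subtopology (zariski I) Y) (Z j)" for j
    unfolding Z_def
  proof (rule irreducible_in_closure[OF fin Qne Qsub])
    show "zariski I closure_of Q j \<subseteq> Y" using ZY unfolding Z_def .
    fix F F' p p' assume F: "F \<in> forms I" "F' \<in> forms I" and p: "p \<in> Q j" "p' \<in> Q j"
      and np: "p \<notin> zero_locus I {F}" "p' \<notin> zero_locus I {F'}"
    obtain y z where y: "p = proj_pt (\<Psi> y)" "\<Psi> y \<noteq> 0" "\<forall>b\<ge>j. y b = 0"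
        and z: "p' = proj_pt (\<Psi> z)" "\<Psi> z \<noteq> 0" "\<forall>b\<ge>j. z b = 0"
      using p unfolding Q_def by blast
    obtain i where i: "\<Psi> y i \<noteq> 0" using y(2) by (auto simp: fun_eq_iff)
    \<comment> \<open>Parameters form a linear space, so two points of \<open>Q j\<close> are joined
      by a line of parameters along which everything is polynomial. Coordinate \<open>i\<close>
      guards against the value 0 of \<open>\<Psi>\<close>, which is not a point.\<close>
    define l where "l t = (\<lambda>b. y b + t * (z b - y b))" for t
    have l01: "l 0 = y" "l 1 = z" by (auto simp: l_def)
    have ll: "poly_fun (\<lambda>t. \<Psi> (l t) i)" for i unfolding l_def by (rule line)
    have 1: "finite {t. \<Psi> (l t) i = 0}"
      using poly_fun_finite_zeros[OF ll[of i], of 0] i l01 by simp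
    have 2: "finite {t. F (\<Psi> (l t)) = 0}"
      using poly_fun_finite_zeros[OF form_poly_fun[OF F(1), of "\<lambda>t. \<Psi> (l t)"], of 0] ll nz[OF F(1) y(2)] np y l01 by simp
    have 3: "finite {t. F' (\<Psi> (l t)) = 0}"
      using poly_fun_finite_zeros[OF form_poly_fun[OF F(2), of "\<lambda>t. \<Psi> (l t)"], of 1] ll nz[OF F(2) z(2)] np z l01 by simp
    have "finite ({t. \<Psi> (l t) i = 0} \<union> {t. F (\<Psi> (l t)) = 0} \<union> {t. F' (\<Psi> (l t)) = 0})"
      using 1 2 3 by blast
    from ex_new_if_finite[OF infinite_UNIV_char_0 this]
    obtain t where t: "\<Psi> (l t) i \<noteq> 0" "F (\<Psi> (l t)) \<noteq> 0" "F' (\<Psi> (l t)) \<noteq> 0" by blast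
    then have n0: "\<Psi> (l t) \<noteq> 0" by (auto simp: fun_eq_iff)
    have "\<forall>b\<ge>j. l t b = 0" using y z by (simp add: l_def)
    then have "proj_pt (\<Psi> (l t)) \<in> Q j" using n0 by (auto simp: Q_def)
    then show "\<exists>p\<in>Q j. p \<notin> zero_locus I {F} \<and> p \<notin> zero_locus I {F'}"
      using t nz[OF F(1) n0] nz[OF F(2) n0] by blast
  qed
  have strict: "Z j \<subset> Z (Suc j)" if j: "j < r" for j
  proof -
    have "Q j \<subseteq> Q (Suc j)" by (force simp: Q_def)
    then have "Z j \<subseteq> Z (Suc j)" unfolding Z_def by (rule closure_of_mono)
    moreover have "Z j \<noteq> Z (Suc j)"
    proof
      assume eq: "Z j = Z (Suc j)"
      \<comment> \<open>Linear forms dual to \<open>W 0\<close>, ..., \<open>W r\<close>. In the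
        resulting coordinates \<open>X a\<close>, curves through the base point start at 1 for
        \<open>a = 0\<close> and at 0 otherwise, with prescribed slopes.\<close>
      have "\<exists>\<xi>. \<forall>b\<le>r. (\<Sum>i\<in>I. \<xi> i * W b i) = (if b = a then 1 else 0)" if a: "a \<le> r" for a
      proof -
        have sp: "W a \<notin> fvs.span (W ` ({..r} - {a}))"
        proof -
          have "W ` {..r} - {W a} = W ` ({..r} - {a})" using iW(1) a by (auto simp: inj_on_def)
          moreover have "W a \<notin> fvs.span (W ` {..r} - {W a})"
            using iW(2) a unfolding fvs.dependent_def by blast
          ultimately show ?thesis by simp
        qed
        have sub: "W ` ({..r} - {a}) \<subseteq> coord_vecs I" using W(1) by auto
        obtain \<xi> where x: "\<And>s. s \<in> fvs.span (W ` ({..r} - {a})) \<Longrightarrow> (\<Sum>i\<in>I. \<xi> i * s i) = 0" 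
            "(\<Sum>i\<in>I. \<xi> i * W a i) = 1"
          using coord_vecs_dual[OF fin sub W(1)[OF a] sp] by metis
        have "(\<Sum>i\<in>I. \<xi> i * W b i) = (if b = a then 1 else 0)" if "b \<le> r" for b
          using x that fvs.span_base[of "W b" "W ` ({..r} - {a})"] by auto
        then show ?thesis by blast
      qed
      then have "\<forall>a. \<exists>\<xi>. a \<le> r \<longrightarrow> (\<forall>b\<le>r. (\<Sum>i\<in>I. \<xi> i * W b i) = (if b = a then 1 else 0))" by blast
      then obtain \<xi> where \<xi>: "\<And>a b. a \<le> r \<Longrightarrow> b \<le> r \<Longrightarrow> (\<Sum>i\<in>I. \<xi> a i * W b i) = (if b = a then 1 else 0)"
        by metis
      define X where "X a v = (\<Sum>i\<in>I. \<xi> a i * v i)" for a and v :: "'i \<Rightarrow> 'k"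
      \<comment> \<open>\<open>T\<close> bounds the sums of the exponents in \<open>E\<close>, so a
        power of \<open>X 0\<close> fills every monomial up to degree \<open>T\<close>. Pulled back,
        it has degree at most \<open>T * d\<close>, and \<open>T * d + 1 \<le> C * (q + 1)\<close>.
        With \<open>q = C ^ j\<close> the polynomials span dimension at most
        \<open>q * (q + 1) ^ j\<close>, less than \<open>card E\<close>.\<close>
      define C where "C = (j + 1) * d + 1"
      define q where "q = C ^ j"
      define T where "T = (j + 1) * q"
      define E where "E = ({..j} \<rightarrow>\<^sub>E {..q})"
      have E: "finite E" "card E = (q + 1) ^ (j + 1)" by (auto simp: E_def card_PiE intro!: finite_PiE)
      have q1: "q \<ge> 1" by (simp add: q_def C_def)
      have sumE: "(\<Sum>b\<le>j. e b) \<le> T" if "e \<in> E" for e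
        using sum_bounded_above[of "{..j}" e q] that by (auto simp: E_def T_def PiE_def Pi_def)
      define F where "F e v = X 0 v ^ (T - (\<Sum>b\<le>j. e b)) * (\<Prod>b\<le>j. X (Suc b) v ^ e b)" for e :: "nat \<Rightarrow> nat" and v
      have Xm: "X a \<in> poly_space I (exponents I 1)" for a
        unfolding X_def[abs_def] by (rule linear_form_mem[OF fin])
      have Fm: "F e \<in> poly_space I (exponents I T)" if e: "e \<in> E" for e
      proof -
        have "(\<lambda>v. X 0 v ^ (T - (\<Sum>b\<le>j. e b))) \<in> poly_space I (exponents I (T - (\<Sum>b\<le>j. e b)))"
          using exponents.power_mem[OF Xm[of 0], of "T - (\<Sum>b\<le>j. e b)"] by simp
        moreover have "(\<lambda>v. \<Prod>b\<le>j. X (Suc b) v ^ e b) \<in> poly_space I (exponents I (\<Sum>b\<le>j. e b))"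
        proof (rule exponents.prod_mem)
          show "(\<lambda>v. X (Suc b) v ^ e b) \<in> poly_space I (exponents I (e b))" for b
            using exponents.power_mem[OF Xm[of "Suc b"], of "e b"] by simp
        qed
        ultimately have "(\<lambda>v. X 0 v ^ (T - (\<Sum>b\<le>j. e b)) * (\<Prod>b\<le>j. X (Suc b) v ^ e b)) \<in>
          poly_space I (exponents I ((T - (\<Sum>b\<le>j. e b)) + (\<Sum>b\<le>j. e b)))"
          by (rule poly_space_mult) (rule exponents.add)
        then show ?thesis using sumE[OF e] unfolding F_def[abs_def] by simp
      qed
      let ?tr = "\<lambda>y b. if b < j then y b else (0::'k)"
      have pull: "(\<lambda>y. H (\<Psi> (?tr y))) \<in> poly_space {..<j} (exponents_le {..<j} (T * d))"
        if H: "H \<in> poly_space I (exponents I T)" for H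
      proof -
        obtain c where c: "H = form I T c" using poly_space_is_form[OF fin H] by metis
        show ?thesis unfolding c form_def
        proof (rule poly_space_sum)
          fix \<alpha> assume \<alpha>: "\<alpha> \<in> exponents I T"
          have "(\<Sum>i\<in>I. \<Sum>_<\<alpha> i. d) = T * d" using \<alpha> by (simp add: exponents_def flip: sum_distrib_right)
          then show "(\<lambda>y. monomial I \<alpha> (\<Psi> (?tr y))) \<in> poly_space {..<j} (exponents_le {..<j} (T * d))"
            using exponents_le.monomial_comp_mem[of I "\<lambda>y. \<Psi> (?tr y)" "{..<j}" "{..<j}" "\<lambda>_. d" \<alpha>] deg by simp
        qed
      qed
      let ?B = "(\<lambda>\<beta>. monomial {..<j} \<beta> :: (nat \<Rightarrow> 'k) \<Rightarrow> 'k) ` exponents_le {..<j} (T * d)"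
      have "card ?B \<le> card (exponents_le {..<j} (T * d))"
        by (rule card_image_le[OF exponents_le_card(1)]) simp
      also have "\<dots> \<le> (T * d + 1) ^ j"
        using exponents_le_card(2)[of "{..<j}" "T * d"] by simp
      also have "\<dots> \<le> (C * (q + 1)) ^ j"
        by (rule power_mono) (auto simp: C_def T_def algebra_simps)
      also have "\<dots> = q * (q + 1) ^ j" by (simp only: power_mult_distrib flip: q_def)
      also have "\<dots> < (q + 1) ^ (j + 1)" by simp
      finally have cB: "card ?B < card E" using E by simp
      have fB: "finite ?B" by (intro finite_imageI exponents_le_card(1)) simp
      have mB: "(\<lambda>y. F e (\<Psi> (?tr y))) \<in> fvs.span ?B" if "e \<in> E" for e
        using pull[OF Fm[OF that]] unfolding poly_space_def .
      obtain e c where ce: "e \<in> E" "c e \<noteq> 0" "\<And>y. (\<Sum>e\<in>E. c e * F e (\<Psi> (?tr y))) = 0"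
        by (rule dependent_family_card[of ?B E "\<lambda>e y. F e (\<Psi> (?tr y))", OF fB E(1) cB mB]) blast+
      define G where "G v = (\<Sum>e\<in>E. c e * F e v)" for v
      have Gm: "G \<in> poly_space I (exponents I T)" unfolding G_def[abs_def] by (rule poly_space_sum) (rule Fm)
      then have Gf: "G \<in> forms I" by (rule poly_space_forms[OF fin])
      have "Q j \<subseteq> zero_locus I {G}"
      proof
        fix p assume "p \<in> Q j"
        then obtain y where y: "p = proj_pt (\<Psi> y)" "\<Psi> y \<noteq> 0" "\<forall>b\<ge>j. y b = 0" by (auto simp: Q_def)
        then have "?tr y = y" by auto
        then have "G (\<Psi> y) = 0" using ce(3)[of y] by (simp add: G_def)
        then show "p \<in> zero_locus I {G}" using nz[OF Gf y(2)] y(1) by simp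
      qed
      then have "Z j \<subseteq> zero_locus I {G}"
        unfolding Z_def by (rule closure_of_minimal) (use Gf closedin_zariski[OF fin] in blast)
      then have QG: "Q (Suc j) \<subseteq> zero_locus I {G}" using eq QZ by blast
      have G0: "G (\<Psi> y) = 0" if "\<forall>b\<ge>Suc j. y b = 0" for y
      proof (cases "\<Psi> y = 0")
        case True
        \<comment> \<open>The zero vector defines no point, but a form of positive degree vanishes
          there; \<open>q \<ge> 1\<close> makes \<open>T\<close> positive.\<close>
        obtain c' where "G = form I T c'" using poly_space_is_form[OF fin Gm] by metis
        then have "G (fscale 0 0) = 0 ^ T * G 0" by (simp only: form_fscale)
        moreover have "(0::'k) ^ T = 0" using q1 by (simp add: T_def power_0_left)
        ultimately show ?thesis using True by simp
      next
        case False
        then show ?thesis using nz[OF Gf False] QG that by (auto simp: Q_def)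
      qed
      obtain e1 where e1: "e1 \<in> E" "c e1 \<noteq> 0" "\<And>e'. e' \<in> E \<Longrightarrow> c e' \<noteq> 0 \<Longrightarrow> (\<Sum>b\<le>j. e1 b) \<le> (\<Sum>b\<le>j. e' b)"
      proof -
        have "finite {e\<in>E. c e \<noteq> 0}" "{e\<in>E. c e \<noteq> 0} \<noteq> {}" using E ce by auto
        from ex_min_if_finite[OF finite_imageI[OF this(1), of "\<lambda>e. \<Sum>b\<le>j. e b"]] this(2)
        obtain m where "m \<in> (\<lambda>e. \<Sum>b\<le>j. e b) ` {e\<in>E. c e \<noteq> 0}"
          "\<not> (\<exists>m'\<in>(\<lambda>e. \<Sum>b\<le>j. e b) ` {e\<in>E. c e \<noteq> 0}. m' < m)" by blast
        then show ?thesis using that by (auto simp: not_less)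
      qed
      let ?E0 = "{e'\<in>E. (\<Sum>b\<le>j. e' b) = (\<Sum>b\<le>j. e1 b)}"
      have mon0: "(\<Sum>e'\<in>?E0. c e' * monomial {..j} e' y) = 0" for y :: "nat \<Rightarrow> 'k"
      proof -
        \<comment> \<open>\<open>G\<close> is known to vanish only on parameters supported in the
          first \<open>j + 1\<close> places; monomials over \<open>{..j}\<close> do not see the
          truncation.\<close>
        define y' where "y' b = (if b \<le> j then y b else 0)" for b
        have "\<forall>i. \<exists>p. (\<forall>t. \<Psi> (\<lambda>b. t * y' b) i = poly p t) \<and> coeff p 0 = W 0 i \<and>
          coeff p (Suc 0) = (\<Sum>b<r. y' b * W (Suc b) i)" using tan by blast
        then obtain p where p: "\<And>i t. \<Psi> (\<lambda>b. t * y' b) i = poly (p i) t" "\<And>i. coeff (p i) 0 = W 0 i"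
          "\<And>i. coeff (p i) (Suc 0) = (\<Sum>b<r. y' b * W (Suc b) i)" by metis
        define P where "P a = (\<Sum>i\<in>I. smult (\<xi> a i) (p i))" for a
        have XP: "X a (\<Psi> (\<lambda>b. t * y' b)) = poly (P a) t" for a t
          by (simp add: X_def P_def poly_sum p(1))
        have P0: "coeff (P a) 0 = (if a = 0 then 1 else 0)" if "a \<le> r" for a
          using \<xi>[OF that, of 0] by (simp add: P_def coeff_sum p(2))
        have P1: "coeff (P (Suc a)) (Suc 0) = y' a" if "a < r" for a
        proof -
          have "coeff (P (Suc a)) (Suc 0) = (\<Sum>b<r. y' b * (\<Sum>i\<in>I. \<xi> (Suc a) i * W (Suc b) i))"
            unfolding P_def coeff_sum coeff_smult p(3) sum_distrib_left
            by (subst sum.swap) (simp add: algebra_simps)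
          also have "\<dots> = (\<Sum>b<r. if b = a then y' b else 0)"
            by (rule sum.cong) (use \<xi> that in auto)
          also have "\<dots> = y' a" using that by simp
          finally show ?thesis .
        qed
        have "(\<Sum>e'\<in>?E0. c e' * monomial {..j} e' y') = 0"
        proof (rule lowest_terms[of E e1 c j "P 0" "\<lambda>b. P (Suc b)" y' T])
          fix t
          have "G (\<Psi> (\<lambda>b. t * y' b)) = 0" by (rule G0) (auto simp: y'_def)
          then show "(\<Sum>e\<in>E. c e * (poly (P 0) t ^ (T - (\<Sum>b\<le>j. e b)) * (\<Prod>b\<le>j. poly (P (Suc b)) t ^ e b))) = 0"
            by (simp add: G_def F_def XP)
        qed (use P0 P1 j e1 E(1) in auto)
        moreover have "monomial {..j} e' y' = monomial {..j} e' y" for e'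
          unfolding monomial_def by (rule prod.cong) (auto simp: y'_def)
        ultimately show ?thesis by simp
      qed
      have "c e1 = 0"
      proof (rule monomials_independent[of "{..j}" ?E0 c e1])
        fix \<beta> \<gamma> assume bg: "\<beta> \<in> ?E0" "\<gamma> \<in> ?E0" "\<And>q. q \<in> {..j} \<Longrightarrow> \<beta> q = \<gamma> q"
        show "\<beta> = \<gamma>" by (rule PiE_ext[of _ "{..j}" "\<lambda>_. {..q}"]) (use bg in \<open>auto simp: E_def\<close>)
      qed (use mon0 E e1 in auto)
      then show False using e1 by simp
    qed
    ultimately show ?thesis by blast
  qed
  have "closedin (subtopology (zariski I) Y) (Z j)" for j
    unfolding closedin_subtopology using Zcl[of j] ZY[of j] by blast
  then have "\<exists>Z. (\<forall>i\<le>r. closedin (subtopology (zariski I) Y) (Z i) \<and> irreducible_in (subtopology (zariski I) Y) (Z i)) \<and>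
        (\<forall>i<r. Z i \<subset> Z (Suc i))" using irr strict by blast
  then show ?thesis unfolding proj_dim_def krull_dim_def by (intro Sup_upper) blast
qed

section \<open>An upper bound for the dimension\<close>

abbreviation vanishes :: "(('i \<Rightarrow> 'k::field) \<Rightarrow> 'k) \<Rightarrow> ('i \<Rightarrow> 'k) set set \<Rightarrow> bool" where
  "vanishes F Z \<equiv> \<forall>p\<in>Z. \<forall>v\<in>p. F v = 0"

lemma irreducible_vanishes_mult:
  assumes fin: "finite I" and irr: "irreducible_in (subtopology (zariski I) X) Z"
    and F: "F \<in> forms I" "F' \<in> forms I" and van: "vanishes (\<lambda>v. F v * F' v) Z"
  shows "vanishes F Z \<or> vanishes F' Z"
proof -
  have Z: "Z \<subseteq> X" "Z \<subseteq> proj_space I"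
    using irr topspace_zariski[OF fin] unfolding irreducible_in_def by auto
  have cl: "closedin (subtopology (zariski I) X) (zero_locus I {F} \<inter> X)" if "F \<in> forms I" for F
  proof -
    have "closedin (zariski I) (zero_locus I {F})"
      unfolding closedin_zariski[OF fin] using that by (intro exI[of _ "{F}"]) simp
    then show ?thesis unfolding closedin_subtopology by (intro exI[of _ "zero_locus I {F}"]) simp
  qed
  have "Z \<subseteq> zero_locus I {F} \<inter> X \<union> zero_locus I {F'} \<inter> X"
  proof
    fix p assume p: "p \<in> Z"
    show "p \<in> zero_locus I {F} \<inter> X \<union> zero_locus I {F'} \<inter> X"
    proof (cases "p \<in> zero_locus I {F}")
      case False
      then obtain v where v: "v \<in> p" "F v \<noteq> 0" using p Z by (auto simp: zero_locus_def)
      then have "F' v = 0" using van p by auto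
      then have "F' w = 0" if "w \<in> p" for w using form_zero_on_pt[OF F(2)] p Z v that by blast
      then show ?thesis using p Z by (auto simp: zero_locus_def)
    qed (use p Z in auto)
  qed
  then have "Z \<subseteq> zero_locus I {F} \<inter> X \<or> Z \<subseteq> zero_locus I {F'} \<inter> X"
    using irr cl F unfolding irreducible_in_def by blast
  then show ?thesis by (auto simp: zero_locus_def)
qed

text \<open>
  Along a chain \<open>Z 0 \<subset> \<dots> \<subset> Z n\<close> take forms of equal degree such that the \<open>i\<close>-th one vanishes on
  \<open>Z i\<close> but not on \<open>Z (i + 1)\<close>.  Their monomials are independent on \<open>Z n\<close>, so the Hilbert function
  of \<open>X\<close> grows at least like \<open>T ^ n\<close>.
\<close>

lemma proj_dim_le:
  fixes \<Phi> :: "'p \<Rightarrow> 'i \<Rightarrow> 'k::field_char_0"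
  assumes fin: "finite I" and X: "X \<subseteq> range (\<lambda>x. proj_pt (\<Phi> x))" "X \<subseteq> proj_space I"
    and hilb: "\<And>T. \<exists>B. finite B \<and> card B \<le> (C * (T + 1)) ^ D \<and>
        (\<forall>F\<in>poly_space I (exponents I T). (\<lambda>x. F (\<Phi> x)) \<in> fvs.span B)"
  shows "proj_dim I X \<le> enat D"
  unfolding proj_dim_def krull_dim_def
proof (rule Sup_least, clarify)
  let ?T = "subtopology (zariski I) X"
  fix n and Z :: "nat \<Rightarrow> ('i \<Rightarrow> 'k) set set"
  assume Z: "\<forall>i\<le>n. closedin ?T (Z i) \<and> irreducible_in ?T (Z i)" and mono: "\<forall>i<n. Z i \<subset> Z (Suc i)"
  have ZX: "Z i \<subseteq> X" if "i \<le> n" for i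
    using Z that topspace_zariski[OF fin] X unfolding irreducible_in_def by auto
  have ne: "Z i \<noteq> {}" if "i \<le> n" for i using Z that unfolding irreducible_in_def by blast
  have pne: "\<exists>v. v \<in> p" if "p \<in> X" for p using X(1) mem_proj_pt that by fastforce
  define sep where "sep i F d \<longleftrightarrow>
    0 < d \<and> F \<in> poly_space I (exponents I d) \<and> vanishes F (Z i) \<and> \<not> vanishes F (Z (Suc i))" for i F d
  have "\<exists>F d. sep i F d" if i: "i < n" for i
  proof -
    have "closedin ?T (Z i)" using Z i by simp
    then obtain S where S: "S \<subseteq> forms I" "Z i = zero_locus I S \<inter> X"
      unfolding closedin_subtopology closedin_zariski[OF fin] by blast
    obtain p where p: "p \<in> Z (Suc i)" "p \<notin> Z i" using mono i by blast
    then have "p \<in> X" using ZX[of "Suc i"] i by auto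
    then obtain F v where F: "F \<in> S" "v \<in> p" "F v \<noteq> 0"
      using p S X(2) by (auto simp: zero_locus_def)
    then obtain d c where c: "F = form I d c" using S by (auto simp: forms_def)
    have vZ: "vanishes F (Z i)" using F S by (auto simp: zero_locus_def)
    \<comment> \<open>A form of degree 0 is constant; as it vanishes on the nonempty
      \<open>Z i\<close>, it could not be nonzero at \<open>v\<close>.\<close>
    have "d \<noteq> 0"
    proof
      assume d0: "d = 0"
      have const: "F w = F (fscale 0 w)" for w by (simp only: c form_fscale) (simp add: d0)
      obtain p' v' where "p' \<in> Z i" "v' \<in> p'" using ne[of i] ZX[of i] pne i by fastforce
      then have "F v' = 0" using vZ by blast
      then have "F v = 0" using const[of v] const[of v'] by (simp add: fscale_def)
      then show False using F by simp
    qed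
    then have "sep i F d" using form_in_poly_space[of I d c] c vZ p F unfolding sep_def by blast
    then show ?thesis by blast
  qed
  then have "\<forall>i. \<exists>F d. i < n \<longrightarrow> sep i F d" by blast
  then obtain F d where "\<And>i. i < n \<Longrightarrow> sep i (F i) (d i)" by metis
  then have F: "\<And>i. i < n \<Longrightarrow> 0 < d i" "\<And>i. i < n \<Longrightarrow> F i \<in> poly_space I (exponents I (d i))"
      "\<And>i. i < n \<Longrightarrow> vanishes (F i) (Z i)" "\<And>i. i < n \<Longrightarrow> \<not> vanishes (F i) (Z (Suc i))"
    unfolding sep_def by blast+
  \<comment> \<open>A common degree for the separating forms, reached by passing to powers; this
    does not change where they vanish.\<close>
  define f where "f = (\<Prod>i<n. d i)"
  have f0: "f > 0" unfolding f_def using F(1) by (intro prod_pos) auto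
  define A where "A i v = F i v ^ (f div d i)" for i v
  have Am: "A i \<in> poly_space I (exponents I f)" if i: "i < n" for i
  proof -
    have "d i dvd f" unfolding f_def using i by (intro dvd_prodI) auto
    then have "(\<Sum>_<f div d i. d i) = f" by simp
    then show ?thesis using exponents.power_mem[OF F(2)[OF i], of "f div d i"] unfolding A_def[abs_def] by simp
  qed
  have fd: "f div d i > 0" if i: "i < n" for i
  proof -
    have "d i dvd f" unfolding f_def using i by (intro dvd_prodI) auto
    then show ?thesis using F(1)[OF i] f0 by (simp add: dvd_imp_le div_greater_zero_iff)
  qed
  have AZ: "vanishes (A i) (Z i)" if "i < n" for i
    using F(3)[OF that] fd[OF that] unfolding A_def by simp
  have AZ': "\<not> vanishes (A i) (Z (Suc i))" if "i < n" for i
    using F(4)[OF that] unfolding A_def by auto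
  obtain p0 v0 where p0: "p0 \<in> Z 0" "v0 \<in> p0" using ne[of 0] ZX[of 0] pne by fastforce
  have "p0 \<in> proj_space I" using p0 ZX[of 0] X by auto
  then have "v0 \<in> coord_vecs I" "v0 \<noteq> 0"
    using p0(2) by (auto simp: proj_space_def proj_pt_def coord_vecs_def fscale_def fun_eq_iff)
  then obtain i0 where i0: "i0 \<in> I" "v0 i0 \<noteq> 0" by (auto simp: coord_vecs_def fun_eq_iff)
  \<comment> \<open>A coordinate that is nonzero at a point of \<open>Z 0\<close>. Its power
    \<open>A0\<close> fills monomials up to a common degree and settles the start of the induction,
    where only a power of \<open>A0\<close> is left.\<close>
  define L where "L v = (\<Sum>i\<in>I. unit_vec i0 i * v i)" for v :: "'i \<Rightarrow> 'k"
  define A0 where "A0 v = L v ^ f" for v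
  have "L v0 = (\<Sum>i\<in>I. if i = i0 then v0 i else 0)" unfolding L_def by (rule sum.cong) (auto simp: unit_vec_def)
  then have A0v: "A0 v0 \<noteq> 0" using i0 fin by (simp add: A0_def)
  have Lm: "L \<in> poly_space I (exponents I 1)" unfolding L_def[abs_def] by (rule linear_form_mem[OF fin])
  have A0m: "A0 \<in> poly_space I (exponents I f)"
    using exponents.power_mem[OF Lm, of f] unfolding A0_def[abs_def] by simp
  define mon where "mon j e T v = A0 v ^ (T - (\<Sum>i<j. e i)) * (\<Prod>i<j. A i v ^ e i)"
    for j T :: nat and e :: "nat \<Rightarrow> nat" and v
  have tm: "mon j e T \<in> poly_space I (exponents I (f * T))" if "j \<le> n" "(\<Sum>i<j. e i) \<le> T" for j e T
  proof -
    have pw: "(\<lambda>v. H v ^ m) \<in> poly_space I (exponents I (f * m))" if "H \<in> poly_space I (exponents I f)" for H m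
      using exponents.power_mem[OF that, of m] by (simp add: mult.commute)
    have "(\<lambda>v. \<Prod>i<j. A i v ^ e i) \<in> poly_space I (exponents I (\<Sum>i<j. f * e i))"
      by (rule exponents.prod_mem, rule pw, rule Am) (use that in auto)
    then have "(\<lambda>v. A0 v ^ (T - (\<Sum>i<j. e i)) * (\<Prod>i<j. A i v ^ e i)) \<in>
        poly_space I (exponents I (f * (T - (\<Sum>i<j. e i)) + (\<Sum>i<j. f * e i)))"
      by (rule poly_space_mult[OF pw[OF A0m] _ exponents.add])
    moreover have "f * (T - (\<Sum>i<j. e i)) + (\<Sum>i<j. f * e i) = f * T"
      using that(2) by (simp add: sum_distrib_left[symmetric] distrib_left[symmetric])
    ultimately show ?thesis unfolding mon_def[abs_def] by simp
  qed
  \<comment> \<open>Let \<open>b\<close> be the least exponent of \<open>A j\<close> in a nonzero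
    term. As \<open>Z (Suc j)\<close> is irreducible and \<open>A j\<close> does not vanish on it,
    \<open>A j ^ b\<close> can be cancelled. On \<open>Z j\<close> the form \<open>A j\<close> is
    zero, so only the terms with exponent exactly \<open>b\<close> remain, a relation with one
    factor less.\<close>
  have claim: "c e = 0"
    if "j \<le> n" "j * q \<le> T" "vanishes (\<lambda>v. \<Sum>e\<in>{..<j} \<rightarrow>\<^sub>E {..q}. c e * mon j e T v) (Z j)"
      "e \<in> {..<j} \<rightarrow>\<^sub>E {..q}" for j q T c and e :: "nat \<Rightarrow> nat"
    using that
  proof (induction j arbitrary: c T e)
    case 0
    have "(\<Sum>e\<in>{..<0} \<rightarrow>\<^sub>E {..q}. c e * mon 0 e T v0) = 0" using 0(3) p0 by blast
    then show ?case using 0(4) A0v by (simp add: mon_def)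
  next
    case (Suc j)
    let ?E = "{..<Suc j} \<rightarrow>\<^sub>E {..q}"
    have fE: "finite ?E" by (intro finite_PiE) auto
    show ?case
    proof (rule ccontr)
      assume ce: "c e \<noteq> 0"
      let ?E2 = "{e\<in>?E. c e \<noteq> 0}"
      define b where "b = Min ((\<lambda>e. e j) ` ?E2)"
      have fin2: "finite ((\<lambda>e. e j) ` ?E2)" using fE by auto
      have "b \<in> (\<lambda>e. e j) ` ?E2" unfolding b_def using fin2 ce Suc.prems(4) by (intro Min_in) auto
      then obtain e1 where e1: "e1 \<in> ?E" "c e1 \<noteq> 0" "e1 j = b" by auto
      have bmin: "b \<le> e j" if "e \<in> ?E2" for e unfolding b_def using fin2 that by (intro Min_le) auto
      have eq: "e j \<le> q" if "e \<in> ?E" for e using that by (auto simp: PiE_def Pi_def)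
      have es: "(\<Sum>i<j. e i) \<le> j * q" if "e \<in> ?E" for e
        using sum_bounded_above[of "{..<j}" e q] that by (auto simp: PiE_def Pi_def)
      define G where "G v = (\<Sum>e\<in>?E2. c e * (A j v ^ (e j - b) * mon j e (T - e j) v))" for v
      have jn: "j < n" using Suc.prems by simp
      have Gm: "G \<in> poly_space I (exponents I (f * (T - b)))"
        unfolding G_def[abs_def]
      proof (rule poly_space_sum)
        fix e assume e: "e \<in> ?E2"
        have sT: "(\<Sum>i<j. e i) \<le> T - e j" using es[of e] eq[of e] e Suc.prems(2) by auto
        have "(\<lambda>v. A j v ^ (e j - b) * mon j e (T - e j) v) \<in> 
          poly_space I (exponents I ((\<Sum>_<e j - b. f) + f * (T - e j)))"
          by (rule poly_space_mult[OF exponents.power_mem[OF Am[OF jn]] tm exponents.add])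
             (use jn sT in auto)
        moreover have "(\<Sum>_<e j - b. f) + f * (T - e j) = f * (T - b)"
        proof -
          have "b \<le> e j" "e j \<le> T" using bmin[OF e] eq[of e] e Suc.prems(2) by auto
          then have "T - b = (e j - b) + (T - e j)" by simp
          then show ?thesis by (simp add: algebra_simps)
        qed
        ultimately show "(\<lambda>v. A j v ^ (e j - b) * mon j e (T - e j) v) \<in> poly_space I (exponents I (f * (T - b)))"
          by simp
      qed
      have fac: "(\<Sum>e\<in>?E. c e * mon (Suc j) e T v) = A j v ^ b * G v" for v
      proof -
        have "(\<Sum>e\<in>?E. c e * mon (Suc j) e T v) = (\<Sum>e\<in>?E2. c e * mon (Suc j) e T v)"
          by (rule sum.mono_neutral_right) (use fE in auto)
        also have "\<dots> = A j v ^ b * G v"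
          unfolding G_def sum_distrib_left
        proof (rule sum.cong)
          fix e assume e: "e \<in> ?E2"
          have pw: "A j v ^ e j = A j v ^ b * A j v ^ (e j - b)" using bmin[OF e] by (simp flip: power_add)
          have t: "T - (\<Sum>i<Suc j. e i) = T - e j - (\<Sum>i<j. e i)" by simp
          have "mon (Suc j) e T v = A j v ^ b * (A j v ^ (e j - b) * mon j e (T - e j) v)"
            unfolding mon_def t prod.lessThan_Suc pw by (simp only: mult_ac)
          then show "c e * mon (Suc j) e T v = A j v ^ b * (c e * (A j v ^ (e j - b) * mon j e (T - e j) v))"
            by (simp only: mult_ac)
        qed simp
        finally show ?thesis .
      qed
      have AF: "(\<lambda>v. A j v ^ b) \<in> forms I"
        by (rule poly_space_forms[OF fin exponents.power_mem[OF Am[OF jn]]])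
      have irrZ: "irreducible_in ?T (Z (Suc j))" using Z Suc.prems(1) by simp
      have "vanishes (\<lambda>v. A j v ^ b) (Z (Suc j)) \<or> vanishes G (Z (Suc j))"
        by (rule irreducible_vanishes_mult[OF fin irrZ AF poly_space_forms[OF fin Gm]])
           (use Suc.prems(3) fac in simp)
      moreover have "\<not> vanishes (\<lambda>v. A j v ^ b) (Z (Suc j))" using AZ'[OF jn] by fastforce
      ultimately have "vanishes G (Z (Suc j))" by blast
      then have GZ: "vanishes G (Z j)" using mono jn by blast
      let ?c = "\<lambda>e. c (e(j := b))"
      have bq: "b \<le> q" using e1 eq by auto
      have bij: "bij_betw (\<lambda>e. e(j := b)) ({..<j} \<rightarrow>\<^sub>E {..q}) {e\<in>?E. e j = b}"
      proof (rule bij_betw_byWitness[where f' = "\<lambda>e. restrict e {..<j}"])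
        show "\<forall>e\<in>{..<j} \<rightarrow>\<^sub>E {..q}. restrict (e(j := b)) {..<j} = e"
          by (auto simp: fun_eq_iff PiE_def extensional_def)
        show "\<forall>e\<in>{e\<in>?E. e j = b}. (restrict e {..<j})(j := b) = e"
          by (auto simp: fun_eq_iff PiE_def extensional_def)
        show "(\<lambda>e. e(j := b)) ` ({..<j} \<rightarrow>\<^sub>E {..q}) \<subseteq> {e\<in>?E. e j = b}"
          using bq by (auto simp: PiE_def extensional_def Pi_def)
        show "(\<lambda>e. restrict e {..<j}) ` {e\<in>?E. e j = b} \<subseteq> {..<j} \<rightarrow>\<^sub>E {..q}"
          by (auto simp: PiE_def Pi_def)
      qed
      have GT: "G v = (\<Sum>e\<in>{..<j} \<rightarrow>\<^sub>E {..q}. ?c e * mon j e (T - b) v)" if "A j v = 0" for v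
      proof -
        have "G v = (\<Sum>e\<in>?E2. if e j = b then c e * mon j e (T - b) v else 0)"
          unfolding G_def
        proof (rule sum.cong)
          fix e assume e: "e \<in> ?E2"
          show "c e * (A j v ^ (e j - b) * mon j e (T - e j) v) = (if e j = b then c e * mon j e (T - b) v else 0)"
            using bmin[OF e] that by (auto simp: power_0_left)
        qed simp
        also have "\<dots> = (\<Sum>e\<in>?E. if e j = b then c e * mon j e (T - b) v else 0)"
          by (rule sum.mono_neutral_left) (use fE in auto)
        also have "\<dots> = (\<Sum>e\<in>{e\<in>?E. e j = b}. c e * mon j e (T - b) v)"
          by (rule sum.inter_filter[symmetric, OF fE])
        also have "\<dots> = (\<Sum>e\<in>{..<j} \<rightarrow>\<^sub>E {..q}. c (e(j := b)) * mon j (e(j := b)) (T - b) v)"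
          by (rule sum.reindex_bij_betw[OF bij, symmetric])
        also have "\<dots> = (\<Sum>e\<in>{..<j} \<rightarrow>\<^sub>E {..q}. ?c e * mon j e (T - b) v)"
          by (simp add: mon_def)
        finally show ?thesis .
      qed
      have "?c (restrict e1 {..<j}) = 0"
      proof (rule Suc.IH[of "T - b" ?c "restrict e1 {..<j}"])
        show "vanishes (\<lambda>v. \<Sum>e\<in>{..<j} \<rightarrow>\<^sub>E {..q}. ?c e * mon j e (T - b) v) (Z j)"
          using GZ GT AZ[OF jn] by simp
        show "restrict e1 {..<j} \<in> {..<j} \<rightarrow>\<^sub>E {..q}" using e1 by (auto simp: PiE_def Pi_def)
      qed (use Suc.prems bq in auto)
      moreover have "(restrict e1 {..<j})(j := b) = e1"
        using e1 by (auto simp: fun_eq_iff PiE_def extensional_def)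
      ultimately show False using e1 by simp
    qed
  qed
  have "n \<le> D"
  proof (rule ccontr)
    assume "\<not> n \<le> D"
    then have nD: "D + 1 \<le> n" by simp
    \<comment> \<open>For \<open>n > D\<close> this \<open>q\<close> makes the
      \<open>(q + 1) ^ n\<close> monomials of degree \<open>f * T\<close> outnumber the bound
      \<open>(C * (f * T + 1)) ^ D\<close> for the pulled back forms.\<close>
    define K where "K = C * (n * f + 1)"
    define q where "q = K ^ D"
    define T where "T = n * q"
    let ?E = "{..<n} \<rightarrow>\<^sub>E {..q}"
    have fE: "finite ?E" by (intro finite_PiE) auto
    obtain B where B: "finite B" "card B \<le> (C * (f * T + 1)) ^ D"
        "\<And>F. F \<in> poly_space I (exponents I (f * T)) \<Longrightarrow> (\<lambda>x. F (\<Phi> x)) \<in> fvs.span B"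
      using hilb[of "f * T"] by blast
    have "card B \<le> (K * (q + 1)) ^ D"
      by (rule le_trans[OF B(2)], rule power_mono) (auto simp: K_def T_def algebra_simps)
    also have "\<dots> = q * (q + 1) ^ D" by (simp only: power_mult_distrib flip: q_def)
    also have "\<dots> < (q + 1) ^ (D + 1)" by simp
    also have "\<dots> \<le> (q + 1) ^ n" by (rule power_increasing[OF nD]) simp
    also have "\<dots> = card ?E" by (simp add: card_PiE)
    finally have cB: "card B < card ?E" .
    have sE: "(\<Sum>i<n. e i) \<le> T" if "e \<in> ?E" for e
      using sum_bounded_above[of "{..<n}" e q] that by (auto simp: T_def PiE_def Pi_def)
    have mB: "(\<lambda>x. mon n e T (\<Phi> x)) \<in> fvs.span B" if "e \<in> ?E" for e
      by (rule B(3)[OF tm[OF order_refl sE[OF that]]])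
    obtain e c where ce: "e \<in> ?E" "c e \<noteq> 0" "\<And>x. (\<Sum>e\<in>?E. c e * mon n e T (\<Phi> x)) = 0"
      by (rule dependent_family_card[of B ?E "\<lambda>e x. mon n e T (\<Phi> x)", OF B(1) fE cB mB]) blast+
    define S where "S v = (\<Sum>e\<in>?E. c e * mon n e T v)" for v
    have "S \<in> poly_space I (exponents I (f * T))"
      unfolding S_def[abs_def] by (rule poly_space_sum) (use tm sE in auto)
    then have SF: "S \<in> forms I" by (rule poly_space_forms[OF fin])
    have "vanishes S (Z n)"
    proof (intro ballI)
      fix p v assume p: "p \<in> Z n" "v \<in> p"
      then have pX: "p \<in> X" using ZX[of n] by auto
      then obtain x where x: "p = proj_pt (\<Phi> x)" using X(1) by auto
      have "S (\<Phi> x) = 0" using ce(3) unfolding S_def by simp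
      then show "S v = 0" using form_zero_on_pt[OF SF, of p "\<Phi> x" v] pX X(2) p x mem_proj_pt by blast
    qed
    then have "c e = 0" using claim[of n q T c e] ce(1) unfolding S_def T_def by simp
    then show False using ce by simp
  qed
  then show "enat n \<le> enat D" by simp
qed

section \<open>Tangent vectors of Segre-Veronese varieties\<close>

definition sv_vars :: "nat list \<Rightarrow> (nat \<times> nat) set" where
  "sv_vars a = (SIGMA i:{..<length a}. {..a ! i})"

text \<open>The same map as \<open>sv_map\<close>, with the coordinates of all factors collected in one vector.\<close>

definition sv_vec :: "nat list \<Rightarrow> nat list \<Rightarrow> (nat \<times> nat \<Rightarrow> 'k::field) \<Rightarrow> (nat \<Rightarrow> nat \<Rightarrow> nat) \<Rightarrow> 'k" where
  "sv_vec a e x = (\<lambda>\<alpha>. if \<alpha> \<in> sv_index a e then monomial (sv_vars a) (case_prod \<alpha>) x else 0)"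

definition sv_tangent ::
  "nat list \<Rightarrow> nat list \<Rightarrow> (nat \<times> nat \<Rightarrow> 'k::field) \<Rightarrow> (nat \<times> nat \<Rightarrow> 'k) \<Rightarrow> (nat \<Rightarrow> nat \<Rightarrow> nat) \<Rightarrow> 'k" where
  "sv_tangent a e x z = (\<lambda>\<alpha>. if \<alpha> \<in> sv_index a e then dmonomial (sv_vars a) (case_prod \<alpha>) x z else 0)"

text \<open>These span the image of the differential of \<open>sv_vec a e\<close> at
  \<open>x\<close>; where no block of \<open>x\<close> vanishes, this is the tangent space to the
  affine cone.\<close>

definition tangent_gens ::
  "nat list \<Rightarrow> nat list \<Rightarrow> (nat \<times> nat \<Rightarrow> 'k::field) \<Rightarrow> ((nat \<Rightarrow> nat \<Rightarrow> nat) \<Rightarrow> 'k) set" where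
  "tangent_gens a e x = (\<lambda>q. sv_tangent a e x (unit_vec q)) ` sv_vars a"

definition multidegree :: "nat list \<Rightarrow> (nat \<Rightarrow> nat) \<Rightarrow> (nat \<times> nat \<Rightarrow> nat) set" where
  "multidegree a D = {\<beta>. (\<forall>q. q \<notin> sv_vars a \<longrightarrow> \<beta> q = 0) \<and> (\<forall>i<length a. (\<Sum>l\<le>a ! i. \<beta> (i, l)) = D i)}"

interpretation multidegree: grading "multidegree a" for a
  by unfold_locales (auto simp: multidegree_def sum.distrib)

definition block :: "nat \<Rightarrow> (nat \<times> nat \<Rightarrow> 'k::zero) \<Rightarrow> nat \<times> nat \<Rightarrow> 'k" where
  "block i x = (\<lambda>q. if fst q = i then x q else 0)"

lemma finite_sv_vars [simp]: "finite (sv_vars a)"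
  by (simp add: sv_vars_def)

lemma card_sv_vars: "card (sv_vars a) = sum_list a + length a"
proof -
  have "card (sv_vars a) = (\<Sum>i<length a. a ! i + 1)" unfolding sv_vars_def by simp
  also have "\<dots> = (\<Sum>i<length a. a ! i) + length a" by (subst sum.distrib) simp
  also have "\<dots> = sum_list a + length a" by (simp add: sum_list_sum_nth atLeast0LessThan)
  finally show ?thesis .
qed

lemma finite_sv_index [simp]: "finite (sv_index a e)"
  unfolding sv_index_def by (intro finite_PiE finite_exponents) auto

lemma sv_indexD:
  assumes "\<alpha> \<in> sv_index a e" "i < length a"
  shows "(\<Sum>l\<le>a ! i. \<alpha> i l) = e ! i" "a ! i < l \<Longrightarrow> \<alpha> i l = 0"
  using assms by (auto simp: sv_index_def exponents_def PiE_def Pi_def)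

lemma sv_index_eqI:
  assumes "\<alpha> \<in> sv_index a e" "\<beta> \<in> sv_index a e" "\<And>i l. (i, l) \<in> sv_vars a \<Longrightarrow> \<alpha> i l = \<beta> i l"
  shows "\<alpha> = \<beta>"
proof (rule PiE_ext[OF assms(1,2)[unfolded sv_index_def]])
  fix i assume i: "i \<in> {..<length a}"
  show "\<alpha> i = \<beta> i"
  proof
    fix l show "\<alpha> i l = \<beta> i l"
      using assms i sv_indexD(2)[OF assms(1), of i l] sv_indexD(2)[OF assms(2), of i l]
      by (cases "l \<le> a ! i") (auto simp: sv_vars_def)
  qed
qed

lemma sv_vec_in [simp]: "sv_vec a e x \<in> coord_vecs (sv_index a e)"
  and sv_tangent_in [simp]: "sv_tangent a e x z \<in> coord_vecs (sv_index a e)"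
  by (auto simp: sv_vec_def sv_tangent_def coord_vecs_def)

lemma sv_map_eq_sv_vec: "sv_map a e (\<lambda>i l. x (i, l)) = sv_vec a e x"
proof -
  have "(\<Prod>i<length a. \<Prod>l\<le>a ! i. x (i, l) ^ \<alpha> i l) = (\<Prod>q\<in>sv_vars a. x q ^ case_prod \<alpha> q)" for \<alpha>
    unfolding sv_vars_def by (subst prod.Sigma) (auto intro!: prod.cong)
  then show ?thesis unfolding sv_map_def sv_vec_def monomial_def by (intro ext) (simp only:)
qed

lemma sv_tangent_sum: "sv_tangent a e x (\<lambda>q. \<Sum>b\<in>A. y b * z b q) = (\<Sum>b\<in>A. fscale (y b) (sv_tangent a e x (z b)))"
  by (auto simp: fun_eq_iff sv_tangent_def sum_apply fscale_def dmonomial_linear)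

lemma sv_tangent_scale: "sv_tangent a e x (\<lambda>q. c * z q) = fscale c (sv_tangent a e x z)"
  by (auto simp: fun_eq_iff sv_tangent_def fscale_def dmonomial_scale)

lemma sv_tangent_add: "sv_tangent a e x (\<lambda>q. z q + w q) = sv_tangent a e x z + sv_tangent a e x w"
  by (auto simp: fun_eq_iff sv_tangent_def dmonomial_add)

lemma dmonomial_cong: "(\<And>q. q \<in> J \<Longrightarrow> \<beta> q = \<beta>' q) \<Longrightarrow> (\<And>q. q \<in> J \<Longrightarrow> x q = x' q) \<Longrightarrow> (\<And>q. q \<in> J \<Longrightarrow> z q = z' q) \<Longrightarrow>
  dmonomial J \<beta> x z = dmonomial J \<beta>' x' z'"
  unfolding dmonomial_def by (intro sum.cong prod.cong arg_cong2[where f = "(*)"]) auto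

lemma monomial_cong: "(\<And>q. q \<in> J \<Longrightarrow> \<beta> q = \<beta>' q) \<Longrightarrow> (\<And>q. q \<in> J \<Longrightarrow> x q = x' q) \<Longrightarrow>
  monomial J \<beta> x = monomial J \<beta>' x'"
  unfolding monomial_def by (intro prod.cong) auto

lemma sv_tangent_expand:
  "sv_tangent a e x z = (\<Sum>q\<in>sv_vars a. fscale (z q) (sv_tangent a e x (unit_vec q)))"
proof -
  have "(\<Sum>p\<in>sv_vars a. z p * unit_vec p q) = z q" if "q \<in> sv_vars a" for q
  proof -
    have "(\<Sum>p\<in>sv_vars a. z p * unit_vec p q) = (\<Sum>p\<in>sv_vars a. if p = q then z p else 0)"
      by (rule sum.cong) (auto simp: unit_vec_def)
    then show ?thesis using that by simp
  qed
  then have "sv_tangent a e x z = sv_tangent a e x (\<lambda>q. \<Sum>p\<in>sv_vars a. z p * unit_vec p q)"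
    unfolding sv_tangent_def by (auto simp: fun_eq_iff intro!: dmonomial_cong)
  then show ?thesis unfolding sv_tangent_sum .
qed

lemma sv_tangent_in_span: "sv_tangent a e x z \<in> fvs.span (tangent_gens a e x)"
  unfolding tangent_gens_def
  by (subst sv_tangent_expand) (intro fvs.span_sum fvs.span_scale fvs.span_base imageI)

lemma tangent_gens_sub: "tangent_gens a e x \<subseteq> coord_vecs (sv_index a e)"
  by (auto simp: tangent_gens_def)

lemma span_tangent_gensD:
  fixes P :: "'h \<Rightarrow> nat \<times> nat \<Rightarrow> 'k::field"
  assumes "finite A" "v \<in> fvs.span (\<Union>h\<in>A. tangent_gens a e (P h))"
  obtains Z where "v = (\<Sum>h\<in>A. sv_tangent a e (P h) (Z h))"
proof -
  let ?S = "{\<Sum>h\<in>A. sv_tangent a e (P h) (Z h) | Z. True}"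
  have "fvs.subspace ?S"
    unfolding fvs.subspace_def
  proof (intro conjI allI ballI)
    have "sv_tangent a e x (\<lambda>_. 0) = 0" for x :: "nat \<times> nat \<Rightarrow> 'k"
      by (auto simp: fun_eq_iff sv_tangent_def dmonomial_def)
    then show "0 \<in> ?S" by (intro CollectI exI[of _ "\<lambda>h _. 0"]) auto
  next
    fix v w assume "v \<in> ?S" "w \<in> ?S"
    then obtain Z Z' where "v = (\<Sum>h\<in>A. sv_tangent a e (P h) (Z h))" "w = (\<Sum>h\<in>A. sv_tangent a e (P h) (Z' h))" by blast
    then have "v + w = (\<Sum>h\<in>A. sv_tangent a e (P h) (\<lambda>q. Z h q + Z' h q))"
      by (simp add: sv_tangent_add sum.distrib)
    then show "v + w \<in> ?S" by (intro CollectI exI[of _ "\<lambda>h q. Z h q + Z' h q"]) simp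
  next
    fix c v assume "v \<in> ?S"
    then obtain Z where "v = (\<Sum>h\<in>A. sv_tangent a e (P h) (Z h))" by blast
    then have "fscale c v = (\<Sum>h\<in>A. sv_tangent a e (P h) (\<lambda>q. c * Z h q))"
      by (simp add: sv_tangent_scale fvs.scale_sum_right)
    then show "fscale c v \<in> ?S" by (intro CollectI exI[of _ "\<lambda>h q. c * Z h q"]) simp
  qed
  moreover have "(\<Union>h\<in>A. tangent_gens a e (P h)) \<subseteq> ?S"
  proof
    fix v assume "v \<in> (\<Union>h\<in>A. tangent_gens a e (P h))"
    then obtain h q where h: "h \<in> A" "v = sv_tangent a e (P h) (unit_vec q)" by (auto simp: tangent_gens_def)
    have "sv_tangent a e x (\<lambda>_. 0) = 0" for x :: "nat \<times> nat \<Rightarrow> 'k"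
      by (auto simp: fun_eq_iff sv_tangent_def dmonomial_def)
    then have "(\<Sum>g\<in>A. sv_tangent a e (P g) (if g = h then unit_vec q else (\<lambda>_. 0))) = (\<Sum>g\<in>A. if g = h then v else 0)"
      using h by (intro sum.cong) auto
    then have "v = (\<Sum>g\<in>A. sv_tangent a e (P g) (if g = h then unit_vec q else (\<lambda>_. 0)))"
      using h assms(1) by simp
    then show "v \<in> ?S"
      by (intro CollectI exI[of _ "\<lambda>g. if g = h then unit_vec q else (\<lambda>_. 0)"]) simp
  qed
  ultimately have "v \<in> ?S" using assms(2) fvs.span_minimal by blast
  then show ?thesis using that by blast
qed

text \<open>Euler's relation, one for each factor.\<close>

lemma sv_tangent_block:
  assumes "i < length a"
  shows "sv_tangent a e x (block i x) = fscale (of_nat (e ! i)) (sv_vec a e x)"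
proof
  fix \<alpha> show "sv_tangent a e x (block i x) \<alpha> = fscale (of_nat (e ! i)) (sv_vec a e x) \<alpha>"
  proof (cases "\<alpha> \<in> sv_index a e")
    case True
    let ?J = "sv_vars a" and ?f = "\<lambda>q. case_prod \<alpha> q"
    have t: "of_nat (?f q) * x q ^ (?f q - 1) * block i x q * (\<Prod>p\<in>?J - {q}. x p ^ ?f p) =
        (if fst q = i then of_nat (?f q) * monomial ?J ?f x else 0)" if "q \<in> ?J" for q
    proof (cases "?f q = 0")
      case False
      then have "x q ^ (?f q - 1) * x q = x q ^ ?f q" by (intro power_minus_mult) simp
      then have "x q ^ (?f q - 1) * x q * (\<Prod>p\<in>?J - {q}. x p ^ ?f p) = monomial ?J ?f x"
        unfolding monomial_def using prod.remove[OF finite_sv_vars that, of "\<lambda>p. x p ^ ?f p"] by simp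
      then show ?thesis by (simp add: block_def mult.assoc)
    qed simp
    have "dmonomial ?J ?f x (block i x) = (\<Sum>q\<in>?J. if fst q = i then of_nat (?f q) * monomial ?J ?f x else 0)"
      unfolding dmonomial_def by (rule sum.cong) (use t in auto)
    also have "\<dots> = (\<Sum>i'<length a. \<Sum>l\<le>a ! i'. if i' = i then of_nat (\<alpha> i' l) * monomial ?J ?f x else 0)"
      unfolding sv_vars_def by (subst sum.Sigma) (auto intro!: sum.cong)
    also have "\<dots> = (\<Sum>i'<length a. if i' = i then (\<Sum>l\<le>a ! i. of_nat (\<alpha> i l) * monomial ?J ?f x) else 0)"
      by (rule sum.cong) auto
    also have "\<dots> = of_nat (\<Sum>l\<le>a ! i. \<alpha> i l) * monomial ?J ?f x" 
      using assms by (simp add: sum_distrib_right)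
    finally show ?thesis using True sv_indexD(1)[OF True assms] by (simp add: sv_tangent_def sv_vec_def fscale_def)
  qed (simp add: sv_tangent_def sv_vec_def fscale_def)
qed

text \<open>In degree at least 2 each term of the derivative keeps a factor from the vanishing
  block. Degenerate points thus contribute nothing, and configurations can range over all coordinate
  vectors.\<close>

lemma sv_tangent_zero_block:
  assumes i: "i < length a" and e: "e ! i \<ge> 2" and x: "\<And>l. l \<le> a ! i \<Longrightarrow> x (i, l) = 0"
  shows "sv_tangent a e x z = 0"
proof
  fix \<alpha> show "sv_tangent a e x z \<alpha> = 0 \<alpha>"
  proof (cases "\<alpha> \<in> sv_index a e")
    case True
    let ?J = "sv_vars a" and ?f = "\<lambda>q. case_prod \<alpha> q"
    have "of_nat (?f q) * x q ^ (?f q - 1) * z q * (\<Prod>p\<in>?J - {q}. x p ^ ?f p) = 0" if q: "q \<in> ?J" for q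
    proof (cases "\<exists>l\<le>a ! i. (i, l) \<noteq> q \<and> \<alpha> i l \<noteq> 0")
      case True
      then obtain l where l: "l \<le> a ! i" "(i, l) \<noteq> q" "\<alpha> i l \<noteq> 0" by blast
      then have "(i, l) \<in> ?J - {q}" using i by (simp add: sv_vars_def)
      moreover have "x (i, l) ^ ?f (i, l) = 0" using l x by simp
      ultimately have "(\<Prod>p\<in>?J - {q}. x p ^ ?f p) = 0" by (intro prod_zero) auto
      then show ?thesis by simp
    next
      case False
      obtain l where l: "l \<le> a ! i" "\<alpha> i l \<noteq> 0"
        using sv_indexD(1)[OF True i] e by (metis atMost_iff not_numeral_le_zero sum.neutral)
      then have q: "q = (i, l)" using False by blast
      have "(\<Sum>l'\<le>a ! i. \<alpha> i l') = \<alpha> i l"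
        using False q l by (subst sum.remove[of _ l]) (auto intro!: sum.neutral)
      then have "?f q - 1 > 0" using sv_indexD(1)[OF True i] e q by simp
      then show ?thesis using x l q by simp
    qed
    then have "dmonomial ?J ?f x z = 0" unfolding dmonomial_def by (intro sum.neutral) auto
    then show ?thesis by (simp add: sv_tangent_def)
  qed (simp add: sv_tangent_def)
qed

lemma sv_vec_in_tangent:
  fixes x :: "nat \<times> nat \<Rightarrow> 'k::field_char_0"
  assumes "a \<noteq> []" "e ! 0 \<ge> 1"
  shows "sv_vec a e x \<in> fvs.span (tangent_gens a e x)"
proof -
  have "fscale (of_nat (e ! 0)) (sv_vec a e x) \<in> fvs.span (tangent_gens a e x)"
    using sv_tangent_block[of 0 a e x] assms sv_tangent_in_span[of a e x "block 0 x"] by simp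
  then have "fscale (inverse (of_nat (e ! 0))) (fscale (of_nat (e ! 0)) (sv_vec a e x)) \<in> fvs.span (tangent_gens a e x)"
    by (rule fvs.span_scale)
  then show ?thesis using assms by (simp add: fvs.scale_scale)
qed

text \<open>For each factor, Euler's relation expresses a direction with nonzero coordinate through
  the other directions of this factor and \<open>sv_vec a e x\<close>, which is common to all
  factors. This leaves \<open>sum_list a\<close> directions and one vector.\<close>

lemma dim_tangent_le:
  fixes x :: "nat \<times> nat \<Rightarrow> 'k::field_char_0"
  assumes e: "\<And>i. i < length a \<Longrightarrow> e ! i \<ge> 2"
  shows "fvs.dim (tangent_gens a e x) \<le> sum_list a + 1"
proof (cases "\<exists>i<length a. \<forall>l\<le>a ! i. x (i, l) = 0")
  case True
  then obtain i where i: "i < length a" "\<And>l. l \<le> a ! i \<Longrightarrow> x (i, l) = 0" by blast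
  have "sv_tangent a e x z = 0" for z using sv_tangent_zero_block[of i a e x z] i e by blast
  then have "tangent_gens a e x \<subseteq> {0}" by (auto simp: tangent_gens_def)
  then have "tangent_gens a e x \<subseteq> fvs.span {}" by simp
  then show ?thesis using fvs.dim_le_card[of "tangent_gens a e x" "{}"] by simp
next
  case False
  then have "\<forall>i. \<exists>l. i < length a \<longrightarrow> l \<le> a ! i \<and> x (i, l) \<noteq> 0" by blast
  then obtain l where l: "\<And>i. i < length a \<Longrightarrow> l i \<le> a ! i \<and> x (i, l i) \<noteq> 0" by metis
  define R where "R = sv_vars a - (\<lambda>i. (i, l i)) ` {..<length a}"
  define B where "B = insert (sv_vec a e x) ((\<lambda>q. sv_tangent a e x (unit_vec q)) ` R)"
  have sub: "(\<lambda>i. (i, l i)) ` {..<length a} \<subseteq> sv_vars a" using l by (auto simp: sv_vars_def)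
  have "card R = card (sv_vars a) - card ((\<lambda>i. (i, l i)) ` {..<length a})"
    unfolding R_def by (rule card_Diff_subset) (use sub in auto)
  also have "card ((\<lambda>i. (i, l i)) ` {..<length a}) = length a"
    by (subst card_image) (auto simp: inj_on_def)
  finally have cR: "card R = sum_list a" by (simp add: card_sv_vars)
  have fR: "finite R" by (simp add: R_def)
  have cB: "card B \<le> sum_list a + 1" unfolding B_def
    using card_insert_le_m1[of "sum_list a + 1"] card_image_le[OF fR, of "\<lambda>q. sv_tangent a e x (unit_vec q)"] cR by simp
  have "tangent_gens a e x \<subseteq> fvs.span B"
  proof
    fix v assume "v \<in> tangent_gens a e x"
    then obtain q where q: "q \<in> sv_vars a" "v = sv_tangent a e x (unit_vec q)" by (auto simp: tangent_gens_def)
    show "v \<in> fvs.span B"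
    proof (cases "q \<in> R")
      case True
      then show ?thesis using q by (auto simp: B_def intro!: fvs.span_base)
    next
      case False
      then obtain i where i: "i < length a" "q = (i, l i)" using q by (auto simp: R_def)
      have "fscale (of_nat (e ! i)) (sv_vec a e x) = (\<Sum>p\<in>sv_vars a. fscale (block i x p) (sv_tangent a e x (unit_vec p)))"
        unfolding sv_tangent_block[OF i(1), symmetric] by (rule sv_tangent_expand)
      also have "\<dots> = fscale (x q) v + (\<Sum>p\<in>sv_vars a - {q}. fscale (block i x p) (sv_tangent a e x (unit_vec p)))"
        using q i by (subst sum.remove[of _ q]) (auto simp: block_def)
      finally have eq: "fscale (x q) v = fscale (of_nat (e ! i)) (sv_vec a e x)
          - (\<Sum>p\<in>sv_vars a - {q}. fscale (block i x p) (sv_tangent a e x (unit_vec p)))" by simp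
      have "fscale (block i x p) (sv_tangent a e x (unit_vec p)) \<in> fvs.span B" if "p \<in> sv_vars a - {q}" for p
      proof (cases "fst p = i")
        case True
        then have "p \<in> R" using that i by (auto simp: R_def)
        then show ?thesis by (intro fvs.span_scale fvs.span_base) (auto simp: B_def)
      next
        case False
        then show ?thesis by (simp add: block_def fvs.span_zero)
      qed
      moreover have "fscale (of_nat (e ! i)) (sv_vec a e x) \<in> fvs.span B"
        by (intro fvs.span_scale fvs.span_base) (simp add: B_def)
      ultimately have "fscale (x q) v \<in> fvs.span B" unfolding eq by (intro fvs.span_diff fvs.span_sum)
      then have "fscale (inverse (x q)) (fscale (x q) v) \<in> fvs.span B" by (rule fvs.span_scale)
      then show ?thesis using l[OF i(1)] i(2) by (simp add: fvs.scale_scale)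
    qed
  qed
  then have "fvs.dim (tangent_gens a e x) \<le> card B" by (rule fvs.dim_le_card) (simp add: B_def fR)
  then show ?thesis using cB by simp
qed

text \<open>At the point with all blocks equal to the first coordinate vector, direction
  \<open>(i, l)\<close> with \<open>l > 0\<close> is seen by the monomial in which one variable of
  factor \<open>i\<close> is exchanged, and \<open>(0, 0)\<close> by the product of pure powers.
  With \<open>A q\<close> the exponent of this monomial, the matrix is diagonal.\<close>

lemma dim_tangent_base:
  assumes ne: "a \<noteq> []" and e: "\<And>i. i < length a \<Longrightarrow> e ! i \<ge> 1"
  shows "sum_list a + 1 \<le> fvs.dim (tangent_gens a e (\<lambda>(i, l). if l = 0 then 1 else 0 :: 'k::field_char_0))"
proof -
  let ?x = "\<lambda>(i, l). if l = 0 then 1 else 0 :: 'k"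
  let ?J = "sv_vars a"
  let ?v = "\<lambda>q. sv_tangent a e ?x (unit_vec q)"
  define R where "R = insert (0, 0) (SIGMA i:{..<length a}. {1..a ! i})"
  have R: "R \<subseteq> ?J" using ne by (auto simp: R_def sv_vars_def)
  have "card (SIGMA i:{..<length a}. {1..a ! i}) = (\<Sum>i<length a. a ! i)" by simp
  then have cR: "card R = sum_list a + 1"
    unfolding R_def by (subst card_insert_disjoint) (auto simp: sum_list_sum_nth atLeast0LessThan)
  define A :: "nat \<times> nat \<Rightarrow> nat \<Rightarrow> nat \<Rightarrow> nat" where "A q = (\<lambda>i\<in>{..<length a}. \<lambda>l. if snd q \<noteq> 0 \<and> i = fst q then (if l = 0 then e ! i - 1 else if l = snd q then 1 else 0)
      else if l = 0 then e ! i else 0)" for q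
  have AI: "A q \<in> sv_index a e" if q: "q \<in> R" for q
  proof -
    have "A q i \<in> exponents {..a ! i} (e ! i)" if i: "i < length a" for i
    proof (cases "snd q \<noteq> 0 \<and> i = fst q")
      case True
      then have sq: "0 < snd q" "snd q \<le> a ! i" using q by (auto simp: R_def)
      have "(\<Sum>l\<le>a ! i. A q i l) = (\<Sum>l\<le>a ! i. (if l = 0 then e ! i - 1 else 0) + (if l = snd q then 1 else 0))"
        by (rule sum.cong) (use True i in \<open>auto simp: A_def\<close>)
      also have "\<dots> = e ! i" using sq e[OF i] by (simp add: sum.distrib)
      finally show ?thesis using True i sq by (auto simp: exponents_def A_def)
    next
      case False
      then have "(\<Sum>l\<le>a ! i. A q i l) = (\<Sum>l\<le>a ! i. if l = 0 then e ! i else 0)"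
        by (intro sum.cong) (use i in \<open>auto simp: A_def\<close>)
      then show ?thesis using False i by (auto simp: exponents_def A_def)
    qed
    then show ?thesis by (auto simp: sv_index_def A_def)
  qed
  have val: "?v p (A q) = of_nat (A q (fst p) (snd p)) * ?x p ^ (A q (fst p) (snd p) - 1) * (\<Prod>r\<in>?J - {p}. ?x r ^ (case_prod (A q) r))"
    if "q \<in> R" "p \<in> R" for p q
    using AI[OF that(1)] R that dmonomial_unit[OF finite_sv_vars, of p a "case_prod (A q)" ?x]
    by (auto simp: sv_tangent_def case_prod_beta)
  have off: "?v p (A q) = 0" if pq: "q \<in> R" "p \<in> R" "p \<noteq> q" for p q
  proof (cases "snd p = 0")
    case False
    then have "A q (fst p) (snd p) = 0" using pq by (auto simp: A_def R_def prod_eq_iff)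
    then show ?thesis using val[OF pq(1,2)] by simp
  next
    case True
    then have p: "p = (0, 0)" using pq(2) by (auto simp: R_def)
    then have q: "snd q \<noteq> 0" "q \<in> ?J - {p}" using pq R by (auto simp: R_def)
    have "A q (fst q) (snd q) = 1" using q by (auto simp: A_def sv_vars_def)
    then have "?x q ^ (case_prod (A q) q) = 0" using q by (simp add: case_prod_beta)
    then have "(\<Prod>r\<in>?J - {p}. ?x r ^ (case_prod (A q) r)) = 0" using q(2) by (intro prod_zero) auto
    then show ?thesis using val[OF pq(1,2)] by simp
  qed
  have diag: "?v q (A q) \<noteq> 0" if q: "q \<in> R" for q
  proof -
    have "?x r ^ (case_prod (A q) r) = 1" if "r \<in> ?J - {q}" for r
      using that by (cases r; cases q) (auto simp: A_def sv_vars_def)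
    then have "(\<Prod>r\<in>?J - {q}. ?x r ^ (case_prod (A q) r)) = 1" by (intro prod.neutral) auto
    moreover have "of_nat (A q (fst q) (snd q)) * ?x q ^ (A q (fst q) (snd q) - 1) \<noteq> 0"
    proof (cases "snd q = 0")
      case True
      then have "q = (0, 0)" using q by (auto simp: R_def)
      then show ?thesis using ne e[of 0] by (auto simp: A_def)
    next
      case False
      then have "A q (fst q) (snd q) = 1" using q by (auto simp: A_def R_def)
      then show ?thesis by simp
    qed
    ultimately show ?thesis using val[OF q q] by simp
  qed
  have fR: "finite R" by (simp add: R_def)
  have "indep_family R ?v"
  proof (rule indep_familyI)
    fix c q assume c: "\<And>i. (\<Sum>r\<in>R. c r * ?v r i) = 0" and q: "q \<in> R"
    have "(\<Sum>r\<in>R. c r * ?v r (A q)) = (\<Sum>r\<in>R. if r = q then c q * ?v q (A q) else 0)"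
      by (rule sum.cong) (use off q in auto)
    also have "\<dots> = c q * ?v q (A q)" using q fR by simp
    finally show "c q = 0" using c[of "A q"] diag[OF q] by simp
  qed
  then have "card R \<le> fvs.dim (?v ` ?J)"
    by (intro dim_ge_indep_family[OF finite_sv_index[of a e] _ finite_sv_vars R]) auto
  then show ?thesis using cR by (simp add: tangent_gens_def)
qed

text \<open>\<open>F\<close> is a linear form on the ambient space: no hyperplane contains the
  Segre-Veronese variety.\<close>

lemma sv_monomials_independent:
  fixes F :: "(nat \<Rightarrow> nat \<Rightarrow> nat) \<Rightarrow> 'k::field_char_0"
  assumes "\<And>p. (\<Sum>\<alpha>\<in>sv_index a e. F \<alpha> * sv_vec a e p \<alpha>) = 0" "\<alpha> \<in> sv_index a e"
  shows "F \<alpha> = 0"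
proof -
  let ?I = "sv_index a e"
  have inj: "inj_on case_prod ?I" by (rule inj_onI) (metis curry_case_prod)
  have "F (curry (case_prod \<alpha>)) = 0"
  proof (rule monomials_independent[of "sv_vars a" "case_prod ` ?I" "\<lambda>\<beta>. F (curry \<beta>)"])
    fix \<beta> \<gamma> assume "\<beta> \<in> case_prod ` ?I" "\<gamma> \<in> case_prod ` ?I" and eq: "\<And>q. q \<in> sv_vars a \<Longrightarrow> \<beta> q = \<gamma> q"
    then obtain \<alpha> \<alpha>' where *: "\<alpha> \<in> ?I" "\<beta> = case_prod \<alpha>" "\<alpha>' \<in> ?I" "\<gamma> = case_prod \<alpha>'" by blast
    have "\<alpha> = \<alpha>'" by (rule sv_index_eqI[OF *(1,3)]) (use eq * in auto)
    then show "\<beta> = \<gamma>" using * by simp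
  next
    fix x
    have "(\<Sum>\<beta>\<in>case_prod ` ?I. F (curry \<beta>) * monomial (sv_vars a) \<beta> x) = (\<Sum>\<alpha>\<in>?I. F \<alpha> * sv_vec a e x \<alpha>)"
      using inj by (subst sum.reindex) (auto simp: sv_vec_def intro!: sum.cong)
    then show "(\<Sum>\<beta>\<in>case_prod ` ?I. F (curry \<beta>) * monomial (sv_vars a) \<beta> x) = 0" using assms(1) by simp
  qed (use assms(2) in auto)
  then show ?thesis by simp
qed

text \<open>One square matrix per factor, possibly singular, since substitutions of rank one are
  wanted.\<close>

definition block_linear :: "nat list \<Rightarrow> (nat \<Rightarrow> nat \<Rightarrow> nat \<Rightarrow> 'k::field) \<Rightarrow> (nat \<times> nat \<Rightarrow> 'k) \<Rightarrow> nat \<times> nat \<Rightarrow> 'k" where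
  "block_linear a c x = (\<lambda>(i, l). \<Sum>m\<le>a ! i. c i l m * x (i, m))"

lemma finite_multidegree: "finite (multidegree a D)"
proof -
  have "multidegree a D \<subseteq> exponents (sv_vars a) (\<Sum>i<length a. D i)"
  proof
    fix \<beta> assume b: "\<beta> \<in> multidegree a D"
    have "(\<Sum>q\<in>sv_vars a. \<beta> q) = (\<Sum>i<length a. \<Sum>l\<le>a ! i. \<beta> (i, l))"
      unfolding sv_vars_def by (subst sum.Sigma) auto
    then show "\<beta> \<in> exponents (sv_vars a) (\<Sum>i<length a. D i)" using b by (auto simp: multidegree_def exponents_def)
  qed
  then show ?thesis using finite_exponents[OF finite_sv_vars] finite_subset by blast
qed

lemma coordinate_multidegree:
  assumes "i < length a" "l \<le> a ! i"
  shows "(\<lambda>x. x (i, l) :: 'k::field) \<in> poly_space (sv_vars a) (multidegree a (\<lambda>j. if j = i then 1 else 0))"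
proof -
  let ?u = "\<lambda>q. if q = (i, l) then 1 else (0::nat)"
  have q: "(i, l) \<in> sv_vars a" using assms by (simp add: sv_vars_def)
  have "monomial (sv_vars a) ?u x = x (i, l)" for x :: "nat \<times> nat \<Rightarrow> 'k"
    unfolding monomial_def using q by (subst prod.remove[of _ "(i, l)"]) auto
  then have e: "monomial (sv_vars a) ?u = (\<lambda>x :: nat \<times> nat \<Rightarrow> 'k. x (i, l))" by (rule ext)
  have "?u \<in> multidegree a (\<lambda>j. if j = i then 1 else 0)"
    using assms q by (auto simp: multidegree_def)
  then show ?thesis unfolding e[symmetric] by (rule poly_space_monomial)
qed

lemma sv_monomial_comp_multidegree:
  fixes g :: "(nat \<times> nat \<Rightarrow> 'k::field) \<Rightarrow> nat \<times> nat \<Rightarrow> 'k"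
  assumes \<alpha>: "\<alpha> \<in> sv_index a e"
    and g: "\<And>i l. (i, l) \<in> sv_vars a \<Longrightarrow> (\<lambda>x. g x (i, l)) \<in> poly_space (sv_vars a) (multidegree a (\<lambda>j. if j = i then 1 else 0))"
  shows "(\<lambda>x. monomial (sv_vars a) (case_prod \<alpha>) (g x)) \<in> poly_space (sv_vars a) (multidegree a (\<lambda>i. e ! i))"
proof -
  let ?d = "\<lambda>q j. if j = fst q then 1 else (0::nat)"
  let ?s = "\<Sum>q\<in>sv_vars a. \<Sum>_<case_prod \<alpha> q. ?d q"
  have "(\<lambda>x. monomial (sv_vars a) (case_prod \<alpha>) (g x)) \<in> poly_space (sv_vars a) (multidegree a ?s)"
    by (rule multidegree.monomial_comp_mem) (use g in auto)
  moreover have "?s j = e ! j" if j: "j < length a" for j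
  proof -
    have "?s j = (\<Sum>q\<in>sv_vars a. if j = fst q then case_prod \<alpha> q else 0)"
      unfolding sum_apply by (rule sum.cong) auto
    also have "\<dots> = (\<Sum>i<length a. \<Sum>l\<le>a ! i. if j = i then \<alpha> i l else 0)"
      unfolding sv_vars_def by (subst sum.Sigma) (auto intro!: sum.cong)
    also have "\<dots> = (\<Sum>i<length a. if j = i then (\<Sum>l\<le>a ! i. \<alpha> i l) else 0)"
      by (rule sum.cong) auto
    also have "\<dots> = e ! j" using j sv_indexD(1)[OF \<alpha> j] by simp
    finally show ?thesis .
  qed
  then have "multidegree a ?s = multidegree a (\<lambda>i. e ! i)" by (auto simp: multidegree_def)
  ultimately show ?thesis by simp
qed

text \<open>Substitution of \<open>g\<close> expresses monomials linearly through monomials of the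
  same multidegree, with coefficients \<open>C\<close> independent of the point. Derivatives
  transform with the same \<open>C\<close>, so linear relations between them survive.\<close>

lemma sv_tangent_substitution:
  fixes c :: "nat \<Rightarrow> nat \<Rightarrow> nat \<Rightarrow> 'k::field_char_0"
  assumes rel: "sv_tangent a e x z = (\<Sum>h\<in>A. sv_tangent a e (P h) (Z h))"
  defines "g \<equiv> block_linear a c"
  shows "sv_tangent a e (g x) (g z) = (\<Sum>h\<in>A. sv_tangent a e (g (P h)) (g (Z h)))"
proof
  let ?J = "sv_vars a"
  fix \<alpha>
  show "sv_tangent a e (g x) (g z) \<alpha> = (\<Sum>h\<in>A. sv_tangent a e (g (P h)) (g (Z h))) \<alpha>"
  proof (cases "\<alpha> \<in> sv_index a e")
    case \<alpha>: True
    have "(\<lambda>x. g x (i, l)) \<in> poly_space ?J (multidegree a (\<lambda>j. if j = i then 1 else 0))" if "(i, l) \<in> ?J" for i l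
    proof -
      have "(\<lambda>x. \<Sum>m\<le>a ! i. c i l m * x (i, m)) \<in> poly_space ?J (multidegree a (\<lambda>j. if j = i then 1 else 0))"
        by (rule poly_space_sum, rule coordinate_multidegree) (use that in \<open>auto simp: sv_vars_def\<close>)
      then show ?thesis unfolding g_def block_linear_def by simp
    qed
    from sv_monomial_comp_multidegree[OF \<alpha> this]
    obtain C where C: "\<And>x. monomial ?J (case_prod \<alpha>) (g x) = (\<Sum>\<beta>\<in>multidegree a (\<lambda>i. e ! i). C \<beta> * monomial ?J \<beta> x)"
      using poly_space_explicit finite_multidegree by metis
    have D: "dmonomial ?J (case_prod \<alpha>) (g x) (g z) = (\<Sum>\<beta>\<in>multidegree a (\<lambda>i. e ! i). C \<beta> * dmonomial ?J \<beta> x z)" for x z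
    proof (rule dmonomial_substitution[of ?J "case_prod \<alpha>" g C ?J "\<lambda>\<beta>. \<beta>" "multidegree a (\<lambda>i. e ! i)"])
      show "g (\<lambda>q. x q + t * z q) = (\<lambda>q. g x q + t * g z q)" for x z t
        by (auto simp: g_def block_linear_def fun_eq_iff algebra_simps sum.distrib sum_distrib_left)
    qed (rule C)
    \<comment> \<open>Turns an exponent on pairs back into an index of an ambient
      coordinate.\<close>
    define conv where "conv \<beta> = (\<lambda>i\<in>{..<length a}. \<lambda>l. \<beta> (i, l))" for \<beta> :: "nat \<times> nat \<Rightarrow> nat"
    have T: "dmonomial ?J \<beta> x z = sv_tangent a e x z (conv \<beta>)" if b: "\<beta> \<in> multidegree a (\<lambda>i. e ! i)" for \<beta> x and z :: "nat \<times> nat \<Rightarrow> 'k"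
    proof -
      have "conv \<beta> \<in> sv_index a e"
        using b by (auto simp: conv_def sv_index_def exponents_def multidegree_def sv_vars_def)
      moreover have "dmonomial ?J \<beta> x z = dmonomial ?J (case_prod (conv \<beta>)) x z"
        by (rule dmonomial_cong) (auto simp: conv_def sv_vars_def)
      ultimately show ?thesis by (simp add: sv_tangent_def)
    qed
    have "dmonomial ?J \<beta> x z = (\<Sum>h\<in>A. dmonomial ?J \<beta> (P h) (Z h))" if b: "\<beta> \<in> multidegree a (\<lambda>i. e ! i)" for \<beta>
      unfolding T[OF b] rel by (simp add: sum_apply)
    then have "dmonomial ?J (case_prod \<alpha>) (g x) (g z) = (\<Sum>\<beta>\<in>multidegree a (\<lambda>i. e ! i). \<Sum>h\<in>A. C \<beta> * dmonomial ?J \<beta> (P h) (Z h))"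
      unfolding D by (simp add: sum_distrib_left)
    also have "\<dots> = (\<Sum>h\<in>A. dmonomial ?J (case_prod \<alpha>) (g (P h)) (g (Z h)))"
      unfolding D by (rule sum.swap)
    finally show ?thesis using \<alpha> by (simp add: sv_tangent_def sum_apply)
  qed (simp add: sv_tangent_def sum_apply)
qed

lemma poly_fun_sv_tangent:
  assumes "\<And>q. poly_fun (\<lambda>t. x t q)" "\<And>q. poly_fun (\<lambda>t. z t q)"
  shows "poly_fun (\<lambda>t. sv_tangent a e (x t) (z t) \<alpha>)"
  unfolding sv_tangent_def dmonomial_def using assms
  by (cases "\<alpha> \<in> sv_index a e") (auto intro!: poly_fun_sum poly_fun_mult poly_fun_prod poly_fun_power)

lemma poly_fun_sv_vec:
  assumes "\<And>q. poly_fun (\<lambda>t. x t q)"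
  shows "poly_fun (\<lambda>t. sv_vec a e (x t) \<alpha>)"
  unfolding sv_vec_def monomial_def using assms
  by (cases "\<alpha> \<in> sv_index a e") (auto intro!: poly_fun_sum poly_fun_mult poly_fun_prod poly_fun_power)

section \<open>Nondefectivity up to a quadratic error\<close>

text \<open>\<open>K\<close> carries the scalar type, since the ranks below are maxima over
  configurations with coordinates in it. Degrees of at least 2 make the bound on tangent spaces
  available at every point.\<close>

locale sv_tangents =
  fixes a e :: "nat list" and K :: "'k::field_char_0 itself"
  assumes ne: "a \<noteq> []" and e2: "\<And>i. i < length a \<Longrightarrow> e ! i \<ge> 2"
begin

definition W :: "(nat \<Rightarrow> nat \<times> nat \<Rightarrow> 'k) \<Rightarrow> nat set \<Rightarrow> ((nat \<Rightarrow> nat \<Rightarrow> nat) \<Rightarrow> 'k) set" where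
  "W P A = (\<Union>h\<in>A. tangent_gens a e (P h))"

text \<open>The maximum is the value at general configurations, because large rank is an open
  condition.\<close>

definition r :: "nat \<Rightarrow> nat" where
  "r j = Max (range (\<lambda>P. fvs.dim (W P {..<j})))"

abbreviation I where "I \<equiv> sv_index a e"
abbreviation N where "N \<equiv> card (sv_index a e)"

definition units :: "((nat \<Rightarrow> nat \<Rightarrow> nat) \<Rightarrow> 'k) set" where "units = unit_vec ` I"

lemma finite_units: "finite units" by (simp add: units_def)

lemma W_sub: "W P A \<subseteq> coord_vecs I"
  unfolding W_def using tangent_gens_sub by blast

lemma coord_units: "coord_vecs I \<subseteq> fvs.span units"
  unfolding units_def by (rule coord_vecs_subset_span) simp

lemma W_units: "W P A \<subseteq> fvs.span units"
  using W_sub coord_units by blast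

lemma T_units: "tangent_gens a e (x :: nat \<times> nat \<Rightarrow> 'k) \<subseteq> fvs.span units"
  using tangent_gens_sub coord_units by blast

lemma dim_W_le: "fvs.dim (W P A) \<le> N"
proof -
  have "W P A \<subseteq> fvs.span (coord_vecs I)" using W_sub fvs.span_superset by blast
  from fvs.dim_mono_finite[OF finite_units coord_units this] show ?thesis by (simp add: dim_coord_vecs)
qed

lemma finite_range_dim: "finite (range (\<lambda>P. fvs.dim (W P A)))"
  by (rule finite_subset[of _ "{..N}"]) (use dim_W_le in auto)

lemma W_reindex: "W P (f ` A) = W (P \<circ> f) A"
  by (auto simp: W_def)

lemma dim_W_le_r:
  assumes "finite A" shows "fvs.dim (W P A) \<le> r (card A)"
proof -
  obtain f where "bij_betw f {..<card A} A"
    using ex_bij_betw_nat_finite[OF assms] atLeast0LessThan by metis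
  then have "W P A = W (P \<circ> f) {..<card A}" by (metis W_reindex bij_betw_imp_surj_on)
  then show ?thesis unfolding r_def using finite_range_dim by (auto intro: Max_ge)
qed

lemma ex_dim_W_eq_r:
  assumes "finite A" shows "\<exists>P. fvs.dim (W P A) = r (card A)"
proof -
  obtain f where f: "bij_betw f A {..<card A}"
    using ex_bij_betw_finite_nat[OF assms] atLeast0LessThan by metis
  have "r (card A) \<in> range (\<lambda>P. fvs.dim (W P {..<card A}))"
    unfolding r_def by (rule Max_in[OF finite_range_dim]) simp
  then obtain P where "r (card A) = fvs.dim (W P {..<card A})" by blast
  moreover have "W P {..<card A} = W (P \<circ> f) A" using f by (metis W_reindex bij_betw_imp_surj_on)
  ultimately show ?thesis by metis
qed

lemma open_cond_dim_W:
  assumes "finite A" shows "open_cond (\<lambda>P. d \<le> fvs.dim (W P A))"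
proof -
  let ?v = "\<lambda>P (h, q). sv_tangent a e (P h) (unit_vec q) :: _ \<Rightarrow> 'k"
  have "W P A = ?v P ` (A \<times> sv_vars a)" for P by (auto simp: W_def tangent_gens_def)
  moreover have "open_cond (\<lambda>P. d \<le> fvs.dim (?v P ` (A \<times> sv_vars a)))"
  proof (rule open_cond_dim[of I])
    fix P Q :: "nat \<Rightarrow> nat \<times> nat \<Rightarrow> 'k" and hq :: "nat \<times> nat \<times> nat" and i
    obtain h q where hq: "hq = (h, q)" by (cases hq)
    have "poly_fun (\<lambda>t. seg P Q t h q)" for q
      unfolding seg_def by (intro poly_fun_add poly_fun_mult poly_fun_const poly_fun_id)
    then have "poly_fun (\<lambda>t. sv_tangent a e (seg P Q t h) (unit_vec q) i)"
      by (rule poly_fun_sv_tangent) (rule poly_fun_const)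
    then show "poly_fun (\<lambda>t. ?v (seg P Q t) hq i)" by (simp add: hq)
  qed (use assms in auto)
  ultimately show ?thesis by simp
qed

text \<open>Genericity of all subsets of the first \<open>k\<close> points together. Only the lower
  bounds are required, which makes the condition open; equality is \<open>good_dim\<close>.\<close>

definition good :: "nat \<Rightarrow> (nat \<Rightarrow> nat \<times> nat \<Rightarrow> 'k) \<Rightarrow> bool" where
  "good k P \<longleftrightarrow> (\<forall>A\<in>Pow {..<k}. r (card A) \<le> fvs.dim (W P A))"

lemma good_dim: "good k P \<Longrightarrow> A \<subseteq> {..<k} \<Longrightarrow> fvs.dim (W P A) = r (card A)"
  using dim_W_le_r[of A P] finite_subset[of A "{..<k}"] by (fastforce simp: good_def intro: antisym)

lemma open_cond_good: "open_cond (good k)"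
  unfolding good_def[abs_def]
  by (rule open_cond_ball) (auto intro!: open_cond_dim_W intro: finite_subset)

lemma ex_good: "\<exists>P. good k P"
  unfolding good_def
proof (rule open_cond_inter_finite)
  fix A assume "A \<in> Pow {..<k}"
  then have f: "finite A" using finite_subset by auto
  then show "open_cond (\<lambda>P. r (card A) \<le> fvs.dim (W P A))" by (rule open_cond_dim_W)
  show "\<exists>P. r (card A) \<le> fvs.dim (W P A)" using ex_dim_W_eq_r[OF f] by (metis order_refl)
qed simp

lemma W_insert: "W P (insert h A) = W P A \<union> tangent_gens a e (P h)"
  by (auto simp: W_def)

lemma W_mono: "A \<subseteq> B \<Longrightarrow> fvs.span (W P A) \<subseteq> fvs.span (W P B)"
  by (rule fvs.span_mono) (auto simp: W_def)

lemma W_subset_span: "A \<subseteq> B \<Longrightarrow> W P A \<subseteq> fvs.span (W P B)"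
  using W_mono[of A B P] fvs.span_superset by blast

section \<open>Growth of the rank of general tangent spaces\<close>

lemma r_0: "r 0 = 0"
proof -
  have "fvs.dim (W P {}) = 0" for P
    using fvs.dim_eq_card_independent[OF fvs.independent_empty] by (simp add: W_def)
  then show ?thesis by (simp add: r_def)
qed

lemma r_1: "r 1 = sum_list a + 1"
proof (rule antisym)
  have W1: "W P {..<1} = tangent_gens a e (P 0)" for P by (auto simp: W_def)
  have "r 1 \<in> range (\<lambda>P. fvs.dim (W P {..<1}))"
    unfolding r_def by (rule Max_in[OF finite_range_dim]) simp
  then obtain P where "r 1 = fvs.dim (W P {..<1})" by blast
  then show "r 1 \<le> sum_list a + 1" using dim_tangent_le[of a e "P 0"] e2 by (simp only: W1)
  let ?P = "\<lambda>_ (i, l). if l = 0 then 1 else 0 :: 'k"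
  have "sum_list a + 1 \<le> fvs.dim (W ?P {..<1})"
    unfolding W1 by (rule dim_tangent_base[OF ne]) (use e2 in force)
  also have "\<dots> \<le> r 1" using dim_W_le_r[of "{..<1}" ?P] by simp
  finally show "sum_list a + 1 \<le> r 1" .
qed

lemma r_le: "r j \<le> N"
  unfolding r_def using finite_range_dim dim_W_le by (subst Max_le_iff) auto

lemma r_mono: "r j \<le> r (Suc j)"
proof -
  obtain P where "fvs.dim (W P {..<j}) = r j" using ex_dim_W_eq_r[of "{..<j}"] by auto
  moreover have "fvs.dim (W P {..<j}) \<le> fvs.dim (W P {..<Suc j})"
    by (rule fvs.dim_mono_finite[OF finite_units W_units W_subset_span]) auto
  ultimately show ?thesis using dim_W_le_r[of "{..<Suc j}" P] by simp
qed

text \<open>Submodularity for the spans of \<open>m\<close> and of \<open>m + 1\<close> tangent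
  spaces and one further tangent space: by genericity, adding the latter to the smaller span also
  gives rank \<open>r (m + 1)\<close>.\<close>

lemma r_concave: "r (m + 2) + r m \<le> r (m + 1) + r (m + 1)"
proof -
  obtain P where P: "good (m + 2) P" using ex_good by blast
  have "fvs.dim (W P {..<m + 1} \<union> tangent_gens a e (P (m + 1))) + fvs.dim (W P {..<m}) \<le>
     fvs.dim (W P {..<m} \<union> tangent_gens a e (P (m + 1))) + fvs.dim (W P {..<m + 1})"
    by (rule fvs.dim_submodular(1)[OF finite_units W_units T_units W_subset_span]) auto
  moreover have "W P {..<m + 1} \<union> tangent_gens a e (P (m + 1)) = W P {..<m + 2}"
    unfolding W_insert[symmetric] by (rule arg_cong[where f = "W P"]) auto
  moreover have "W P {..<m} \<union> tangent_gens a e (P (m + 1)) = W P (insert (m + 1) {..<m})"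
    unfolding W_insert ..
  ultimately show ?thesis
    using good_dim[OF P, of "{..<m + 2}"] good_dim[OF P, of "{..<m}"] good_dim[OF P, of "{..<m + 1}"]
      good_dim[OF P, of "insert (m + 1) {..<m}"] by simp
qed

text \<open>Equal increments are the equality case of submodularity for \<open>W P B\<close> inside
  \<open>W P (insert i A)\<close>. So whatever the tangent space at \<open>P y\<close> shares with
  the larger span lies in the smaller one, for every choice of \<open>m\<close> points
  \<open>B\<close> among the \<open>m + 1\<close>.\<close>

lemma exchange:
  assumes P: "good k P" and eq: "r (m + 2) + r m = r (m + 1) + r (m + 1)"
    and A: "A \<subseteq> {..<k}" "B \<subseteq> {..<k}" "card A = m" "card B = m" "i < k" "y < k" "i \<notin> A" "B \<subseteq> insert i A"
      "y \<notin> insert i A"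
    and v: "v \<in> fvs.span (tangent_gens a e (P y))" "v \<in> fvs.span (W P A)"
  shows "v \<in> fvs.span (W P B)"
proof -
  have fin: "finite A" "finite B" using A finite_subset by blast+
  have sub: "W P B \<subseteq> fvs.span (W P (insert i A))"
    by (rule W_subset_span[OF A(8)])
  have "fvs.dim (W P B \<union> tangent_gens a e (P y)) + fvs.dim (W P (insert i A)) \<le>
    fvs.dim (W P (insert i A) \<union> tangent_gens a e (P y)) + fvs.dim (W P B)"
    unfolding W_insert[symmetric]
  proof -
    have "card (insert y (insert i A)) = m + 2" "card (insert y B) = m + 1" "card (insert i A) = m + 1"
      using A fin by (auto simp: card_insert_if)
    then have "fvs.dim (W P (insert y B)) = r (m + 1)" "fvs.dim (W P (insert i A)) = r (m + 1)"
      "fvs.dim (W P (insert y (insert i A))) = r (m + 2)" "fvs.dim (W P B) = r m"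
      using good_dim[OF P, of "insert y B"] good_dim[OF P, of "insert i A"]
        good_dim[OF P, of "insert y (insert i A)"] good_dim[OF P, of B] A by auto
    then show "fvs.dim (W P (insert y B)) + fvs.dim (W P (insert i A)) \<le>
      fvs.dim (W P (insert y (insert i A))) + fvs.dim (W P B)" using eq by simp
  qed
  from fvs.dim_submodular(2)[OF finite_units W_units T_units sub this]
  have "fvs.span (tangent_gens a e (P y)) \<inter> fvs.span (W P (insert i A)) \<subseteq> fvs.span (W P B)" .
  moreover have "v \<in> fvs.span (W P (insert i A))" using v(2) W_mono[of A "insert i A" P] by blast
  ultimately show ?thesis using v(1) by blast
qed

text \<open>The window \<open>{l..<m + l}\<close> slides by one point at a time, and each move is an
  \<open>exchange\<close>.\<close>

lemma exchange_all:
  assumes P: "good (2 * m + 1) P" and eq: "r (m + 2) + r m = r (m + 1) + r (m + 1)"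
    and v: "v \<in> fvs.span (tangent_gens a e (P (2 * m)))"
  shows "v \<in> fvs.span (W P {..<m}) \<longleftrightarrow> v \<in> fvs.span (W P {m..<2 * m})"
proof -
  have "v \<in> fvs.span (W P {l..<m + l}) \<longleftrightarrow> v \<in> fvs.span (W P {Suc l..<m + Suc l})" if l: "l < m" for l
  proof
    assume "v \<in> fvs.span (W P {l..<m + l})"
    then show "v \<in> fvs.span (W P {Suc l..<m + Suc l})"
      by (rule exchange[OF P eq, where i = "m + l" and y = "2 * m", rotated -1]) (use l v in auto)
  next
    assume "v \<in> fvs.span (W P {Suc l..<m + Suc l})"
    then show "v \<in> fvs.span (W P {l..<m + l})"
      by (rule exchange[OF P eq, where i = l and y = "2 * m", rotated -1]) (use l v in auto)
  qed
  then have "l \<le> m \<Longrightarrow> v \<in> fvs.span (W P {0..<m}) \<longleftrightarrow> v \<in> fvs.span (W P {l..<m + l})" for l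
    by (induction l) auto
  from this[of m] show ?thesis by (simp add: atLeast0LessThan mult_2)
qed

section \<open>Substitutions of rank one in every factor\<close>

definition pairing :: "(nat \<times> nat \<Rightarrow> 'k) \<Rightarrow> (nat \<times> nat \<Rightarrow> 'k) \<Rightarrow> nat \<Rightarrow> 'k" where
  "pairing \<phi> x i = (\<Sum>l\<le>a ! i. \<phi> (i, l) * x (i, l))"

text \<open>The sum is the derivative at \<open>y\<close>, in direction \<open>z\<close>, of the
  product of the \<open>e ! i\<close>-th powers of the linear forms in \<open>\<phi>\<close>. If it
  is zero for all \<open>\<phi>\<close>, every block of \<open>z\<close> is a multiple of that of
  \<open>y\<close>, and by Euler's relations the tangent vector is \<open>sv_vec a e y\<close> times
  zero. Conversely, a nonzero tangent vector is detected by some \<open>\<phi>\<close>.\<close>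

lemma tangent_eq_0:
  fixes y z :: "nat \<times> nat \<Rightarrow> 'k"
  assumes H: "\<And>\<phi>. (\<And>i. i < length a \<Longrightarrow> pairing \<phi> y i = 1) \<Longrightarrow> (\<Sum>i<length a. of_nat (e ! i) * pairing \<phi> z i) = 0"
  shows "sv_tangent a e y z = 0"
proof (cases "\<exists>i<length a. \<forall>l\<le>a ! i. y (i, l) = 0")
  case True
  then show ?thesis using sv_tangent_zero_block e2 by blast
next
  case False
  then have "\<forall>i. \<exists>l. i < length a \<longrightarrow> l \<le> a ! i \<and> y (i, l) \<noteq> 0" by blast
  then obtain l where l: "\<And>i. i < length a \<Longrightarrow> l i \<le> a ! i \<and> y (i, l i) \<noteq> 0" by metis
  define \<phi> where "\<phi> = (\<lambda>(i, j). if j = l i then 1 / y (i, l i) else 0)"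
  have p\<phi>: "pairing \<phi> x i = x (i, l i) / y (i, l i)" if "i < length a" for x i
  proof -
    have "pairing \<phi> x i = (\<Sum>j\<le>a ! i. if j = l i then x (i, l i) / y (i, l i) else 0)"
      unfolding pairing_def by (rule sum.cong) (auto simp: \<phi>_def)
    then show ?thesis using l[OF that] by simp
  qed
  have \<phi>1: "pairing \<phi> y i = 1" if "i < length a" for i using p\<phi>[OF that] l[OF that] by simp
  have sum0: "(\<Sum>i<length a. of_nat (e ! i) * pairing \<phi> z i) = 0" by (rule H) (rule \<phi>1)
  have zprop: "z (i, m) = (z (i, l i) / y (i, l i)) * y (i, m)" if i: "i < length a" "m \<le> a ! i" for i m
  proof (cases "m = l i")
    case False
    \<comment> \<open>\<open>\<psi>\<close> adds to block \<open>i\<close> of \<open>\<phi>\<close>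
      a form that vanishes at \<open>y\<close>. The difference of the two instances of
      \<open>H\<close> isolates a 2 by 2 minor of the blocks of \<open>y\<close> and
      \<open>z\<close>.\<close>
    define \<psi> where "\<psi> = (\<lambda>(j, n). \<phi> (j, n) + (if j = i then (if n = m then y (i, l i) else if n = l i then - y (i, m) else 0) else 0))"
    have p\<psi>: "pairing \<psi> x j = pairing \<phi> x j + (if j = i then y (i, l i) * x (i, m) - y (i, m) * x (i, l i) else 0)" 
      if j: "j < length a" for x j
    proof (cases "j = i")
      case True
      have "pairing \<psi> x j = (\<Sum>n\<le>a ! i. \<phi> (i, n) * x (i, n) + ((if n = m then y (i, l i) * x (i, m) else 0) + (if n = l i then - y (i, m) * x (i, l i) else 0)))"
        unfolding pairing_def True by (rule sum.cong) (use False in \<open>auto simp: \<psi>_def algebra_simps\<close>)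
      also have "\<dots> = pairing \<phi> x i + (y (i, l i) * x (i, m) - y (i, m) * x (i, l i))"
        unfolding sum.distrib using i l[OF i(1)] by (simp add: pairing_def)
      finally show ?thesis using True by simp
    qed (simp add: pairing_def \<psi>_def)
    have "(\<Sum>j<length a. of_nat (e ! j) * pairing \<psi> z j) = 0"
      by (rule H) (use p\<psi> \<phi>1 in \<open>auto simp: mult.commute\<close>)
    moreover have "(\<Sum>j<length a. of_nat (e ! j) * pairing \<psi> z j) = (\<Sum>j<length a. of_nat (e ! j) * pairing \<phi> z j
       + (if j = i then of_nat (e ! i) * (y (i, l i) * z (i, m) - y (i, m) * z (i, l i)) else 0))"
      by (rule sum.cong) (use p\<psi> in \<open>auto simp: algebra_simps\<close>)
    ultimately have "of_nat (e ! i) * (y (i, l i) * z (i, m) - y (i, m) * z (i, l i)) = 0"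
      using sum0 i(1) by (simp add: sum.distrib)
    moreover have "of_nat (e ! i) \<noteq> (0 :: 'k)" using e2[OF i(1)] by simp
    ultimately show ?thesis using l[OF i(1)] by (simp add: field_simps)
  qed (use l[OF i(1)] in simp)
  have "sv_tangent a e y z = sv_tangent a e y (\<lambda>q. \<Sum>i<length a. pairing \<phi> z i * block i y q)"
  proof -
    have "z q = (\<Sum>i<length a. pairing \<phi> z i * block i y q)" if q: "q \<in> sv_vars a" for q
    proof -
      obtain i m where im: "q = (i, m)" "i < length a" "m \<le> a ! i" using q by (auto simp: sv_vars_def)
      have "(\<Sum>j<length a. pairing \<phi> z j * block j y q) = (\<Sum>j<length a. if j = i then pairing \<phi> z i * y q else 0)"
        by (rule sum.cong) (auto simp: block_def im)
      then show ?thesis using im zprop[OF im(2,3)] p\<phi>[OF im(2)] by simp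
    qed
    then show ?thesis unfolding sv_tangent_def by (auto simp: fun_eq_iff intro!: dmonomial_cong)
  qed
  also have "\<dots> = (\<Sum>i<length a. fscale (pairing \<phi> z i * of_nat (e ! i)) (sv_vec a e y))"
    unfolding sv_tangent_sum by (rule sum.cong) (simp_all add: sv_tangent_block)
  also have "\<dots> = fscale (\<Sum>i<length a. pairing \<phi> z i * of_nat (e ! i)) (sv_vec a e y)"
    by (rule fvs.scale_sum_left[symmetric])
  also have "\<dots> = 0" using sum0 by (simp add: mult.commute)
  finally show ?thesis .
qed

text \<open>The rank one map takes \<open>y\<close> to \<open>p\<close> and the direction
  \<open>z\<close> to a combination of the blocks of \<open>p\<close>, where Euler's relations
  apply.\<close>

lemma rank_one_substitution:
  fixes y z p \<phi> :: "nat \<times> nat \<Rightarrow> 'k"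
  assumes "\<And>i. i < length a \<Longrightarrow> pairing \<phi> y i = 1"
  shows "sv_tangent a e (\<lambda>(i, l). pairing \<phi> y i * p (i, l)) (\<lambda>(i, l). pairing \<phi> z i * p (i, l)) =
    fscale (\<Sum>i<length a. of_nat (e ! i) * pairing \<phi> z i) (sv_vec a e p)"
proof -
  have "sv_tangent a e (\<lambda>(i, l). pairing \<phi> y i * p (i, l)) (\<lambda>(i, l). pairing \<phi> z i * p (i, l)) =
    sv_tangent a e p (\<lambda>q. \<Sum>i<length a. pairing \<phi> z i * block i p q)"
  proof -
    have "pairing \<phi> z i * p (i, m) = (\<Sum>j<length a. pairing \<phi> z j * block j p (i, m))" if "i < length a" for i m
    proof -
      have "(\<Sum>j<length a. pairing \<phi> z j * block j p (i, m)) = (\<Sum>j<length a. if j = i then pairing \<phi> z i * p (i, m) else 0)"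
        by (rule sum.cong) (auto simp: block_def)
      then show ?thesis using that by simp
    qed
    then show ?thesis using assms unfolding sv_tangent_def 
      by (auto simp: fun_eq_iff sv_vars_def intro!: dmonomial_cong)
  qed
  also have "\<dots> = (\<Sum>i<length a. fscale (of_nat (e ! i) * pairing \<phi> z i) (sv_vec a e p))"
    unfolding sv_tangent_sum by (rule sum.cong) (simp_all add: sv_tangent_block mult.commute)
  also have "\<dots> = fscale (\<Sum>i<length a. of_nat (e ! i) * pairing \<phi> z i) (sv_vec a e p)"
    by (rule fvs.scale_sum_left[symmetric])
  finally show ?thesis .
qed

text \<open>
  If the ranks grow equally in two consecutive steps, the intersection of a general tangent space
  with the span of \<open>m\<close> general ones does not depend on the latter, so this span contains the
  orbit of any vector of the intersection under \<open>g = (1 - t) id + t p \<otimes> \<phi>\<close>, and hence all of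
  the Segre-Veronese variety.
\<close>

lemma full_rank_if_equal_steps:
  assumes eq: "r (m + 2) + r m = r (m + 1) + r (m + 1)" and lt: "r (m + 1) < r m + r 1"
  shows "r m = N"
proof -
  obtain P where P: "good (2 * m + 1) P" using ex_good by blast
  define y where "y = P (2 * m)"
  let ?T = "\<lambda>x. tangent_gens a e x :: ((nat \<Rightarrow> nat \<Rightarrow> nat) \<Rightarrow> 'k) set"
  have d1: "fvs.dim (W P {..<m}) = r m" using good_dim[OF P, of "{..<m}"] by simp
  have d2: "fvs.dim (?T y) = r 1" using good_dim[OF P, of "{2 * m}"] by (simp add: W_def y_def)
  have d3: "fvs.dim (W P {..<m} \<union> ?T y) = r (m + 1)"
    using good_dim[OF P, of "insert (2 * m) {..<m}"] by (simp add: W_insert y_def card_insert_if subset_iff)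
  have "\<not> fvs.span (W P {..<m}) \<inter> fvs.span (?T y) \<subseteq> {0}"
    using fvs.dim_Un_disjoint[OF finite_units W_units T_units, of P "{..<m}" y] d1 d2 d3 lt by auto
  then obtain \<kappa> where \<kappa>: "\<kappa> \<in> fvs.span (W P {..<m})" "\<kappa> \<in> fvs.span (?T y)" "\<kappa> \<noteq> 0" by blast
  obtain \<zeta> where \<zeta>: "\<kappa> = sv_tangent a e y \<zeta>"
    using span_tangent_gensD[of "{0::nat}" \<kappa> a e "\<lambda>_. y"] \<kappa>(2) by auto
  obtain Z where Z: "\<kappa> = (\<Sum>h<m. sv_tangent a e (P h) (Z h))"
    using span_tangent_gensD[of "{..<m}" \<kappa> a e P] \<kappa>(1) unfolding W_def by auto
  have "coord_vecs I \<subseteq> fvs.span (W P {..<m})"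
  proof (rule ccontr)
    assume "\<not> ?thesis"
    then obtain v where v: "v \<in> coord_vecs I" "v \<notin> fvs.span (W P {..<m})" by blast
    \<comment> \<open>A hyperplane through the span of the \<open>m\<close> tangent spaces; the aim
      is to show that it contains every point of the variety, which is impossible.\<close>
    obtain F where F: "\<And>s. s \<in> fvs.span (W P {..<m}) \<Longrightarrow> (\<Sum>i\<in>I. F i * s i) = 0" "(\<Sum>i\<in>I. F i * v i) = 1"
      by (rule coord_vecs_dual[OF finite_sv_index W_sub v]) blast
    obtain \<phi> where \<phi>: "\<And>i. i < length a \<Longrightarrow> pairing \<phi> y i = 1" "(\<Sum>i<length a. of_nat (e ! i) * pairing \<phi> \<zeta> i) \<noteq> 0"
      using tangent_eq_0[of y \<zeta>] \<kappa>(3) \<zeta> by blast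
    have "(\<Sum>i\<in>I. F i * sv_vec a e p i) = 0" for p :: "nat \<times> nat \<Rightarrow> 'k"
    proof -
      define c where "c t i l m = (1 - t) * (if m = l then 1 else 0) + t * (p (i, l) * \<phi> (i, m))" for t i l m
      define g where "g t = block_linear a (c t)" for t
      have g: "g t x (i, l) = (1 - t) * x (i, l) + t * (pairing \<phi> x i * p (i, l))" if "l \<le> a ! i" for t x i l
      proof -
        have "g t x (i, l) = (\<Sum>m\<le>a ! i. (if m = l then (1 - t) * x (i, l) else 0) + t * (p (i, l) * (\<phi> (i, m) * x (i, m))))"
          unfolding g_def block_linear_def c_def prod.case by (rule sum.cong) (auto simp: algebra_simps)
        then show ?thesis using that by (simp add: sum.distrib pairing_def sum_distrib_left sum_distrib_right mult_ac)
      qed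
      \<comment> \<open>Agrees with \<open>g t\<close> on the coordinates in
        \<open>sv_vars a\<close>, but is affine in \<open>t\<close> at every index, so that it is
        exactly a point on a \<open>seg\<close>.\<close>
      define gs where "gs t x = (\<lambda>(i, l). (1 - t) * x (i, l) + t * (pairing \<phi> x i * p (i, l)))" for t x
      have gs: "sv_tangent a e (g t x) (g t z) = sv_tangent a e (gs t x) (gs t z)" for t x z
        unfolding sv_tangent_def 
        by (auto simp: fun_eq_iff sv_vars_def gs_def g intro!: dmonomial_cong)
      \<comment> \<open>Along \<open>Q\<close> the first \<open>m\<close> points and
        \<open>y\<close> move, along \<open>Q'\<close> only \<open>y\<close>. At equal parameters
        both configurations have the same \<open>y\<close> and the same points
        \<open>m..<2 * m\<close>, so two applications of \<open>exchange_all\<close> carry the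
        vector from the span at the moved points to the span at the fixed ones.\<close>
      define Q where "Q h = (if h < m \<or> h = 2 * m then gs 1 (P h) else P h)" for h
      define Q' where "Q' h = (if h = 2 * m then gs 1 (P h) else P h)" for h
      have gseg: "P h q + t * (gs 1 (P h) q - P h q) = gs t (P h) q" for h q t
        by (cases q) (auto simp: gs_def algebra_simps)
      have segQ: "seg P Q t h = (if h < m \<or> h = 2 * m then gs t (P h) else P h)" for t h
        by (auto simp: seg_def Q_def gseg)
      have segQ': "seg P Q' t h = (if h = 2 * m then gs t (P h) else P h)" for t h
        by (auto simp: seg_def Q'_def gseg)
      define f where "f t = (\<Sum>i\<in>I. F i * sv_tangent a e (gs t y) (gs t \<zeta>) i)" for t
      have "poly_fun (\<lambda>t. gs t x q)" for x q
        unfolding gs_def by (cases q) (auto intro!: poly_fun_add poly_fun_mult poly_fun_diff)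
      then have "poly_fun f" unfolding f_def
        by (intro poly_fun_sum poly_fun_mult poly_fun_const poly_fun_sv_tangent)
      have "f t = 0" if t: "good (2 * m + 1) (seg P Q t)" "good (2 * m + 1) (seg P Q' t)" for t
      proof -
        define v where "v = sv_tangent a e (gs t y) (gs t \<zeta>)"
        have vT: "v \<in> fvs.span (?T (seg P Q t (2 * m)))" "v \<in> fvs.span (?T (seg P Q' t (2 * m)))"
          unfolding v_def y_def segQ segQ' by (simp_all add: sv_tangent_in_span)
        have "sv_tangent a e y \<zeta> = (\<Sum>h<m. sv_tangent a e (P h) (Z h))" using \<zeta> Z by simp
        from sv_tangent_substitution[OF this, of "c t"]
        have "v = (\<Sum>h<m. sv_tangent a e (gs t (P h)) (gs t (Z h)))"
          unfolding v_def gs[symmetric] g_def .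
        also have "\<dots> \<in> fvs.span (W (seg P Q t) {..<m})"
        proof (rule fvs.span_sum)
          fix h assume h: "h \<in> {..<m}"
          have "sv_tangent a e (gs t (P h)) (gs t (Z h)) \<in> fvs.span (?T (seg P Q t h))"
            using h by (simp add: segQ sv_tangent_in_span)
          moreover have "?T (seg P Q t h) \<subseteq> W (seg P Q t) {..<m}" using h by (auto simp: W_def)
          ultimately show "sv_tangent a e (gs t (P h)) (gs t (Z h)) \<in> fvs.span (W (seg P Q t) {..<m})"
            using fvs.span_mono by blast
        qed
        finally have "v \<in> fvs.span (W (seg P Q t) {m..<2 * m})"
          using exchange_all[OF t(1) eq vT(1)] by blast
        moreover have "W (seg P Q t) {m..<2 * m} = W (seg P Q' t) {m..<2 * m}"
          unfolding W_def by (rule SUP_cong) (auto simp: segQ segQ')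
        ultimately have "v \<in> fvs.span (W (seg P Q' t) {..<m})"
          using exchange_all[OF t(2) eq vT(2)] by simp
        moreover have "W (seg P Q' t) {..<m} = W P {..<m}"
          unfolding W_def by (rule SUP_cong) (auto simp: segQ')
        ultimately show ?thesis using F(1) unfolding f_def v_def by simp
      qed
      then have "{t. f t \<noteq> 0} \<subseteq> {t. \<not> good (2 * m + 1) (seg P Q t)} \<union> {t. \<not> good (2 * m + 1) (seg P Q' t)}" by blast
      moreover have "finite ({t. \<not> good (2 * m + 1) (seg P Q t)} \<union> {t. \<not> good (2 * m + 1) (seg P Q' t)})"
        using open_condD[OF open_cond_good P] by blast
      ultimately have "finite {t. f t \<noteq> 0}" using finite_subset by blast
      \<comment> \<open>At \<open>t = 1\<close> the substitution has rank one and the configuration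
        need not be good; this value is reached because \<open>f\<close> is polynomial.\<close>
      then have "f 1 = 0" by (rule poly_fun_const_zero[OF \<open>poly_fun f\<close>])
      moreover have "f 1 = (\<Sum>i<length a. of_nat (e ! i) * pairing \<phi> \<zeta> i) * (\<Sum>i\<in>I. F i * sv_vec a e p i)"
      proof -
        define b where "b = (\<Sum>i<length a. of_nat (e ! i) * pairing \<phi> \<zeta> i)"
        have "sv_tangent a e (gs 1 y) (gs 1 \<zeta>) = fscale b (sv_vec a e p)"
          using rank_one_substitution[OF \<phi>(1), of p \<zeta>] by (simp add: gs_def b_def)
        then show ?thesis unfolding f_def b_def[symmetric] by (simp add: fscale_def sum_distrib_left mult_ac)
      qed
      ultimately show ?thesis using \<phi>(2) by simp
    qed
    then have "F i = 0" if "i \<in> I" for i using sv_monomials_independent[of F a e] that by blast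
    then show False using F(2) by simp
  qed
  then have "fvs.dim (coord_vecs I :: (_ \<Rightarrow> 'k) set) \<le> fvs.dim (W P {..<m})"
    by (rule fvs.dim_mono_finite[OF finite_units W_units])
  then show ?thesis using d1 r_le[of m] by (simp add: dim_coord_vecs)
qed

lemma span_sv_vec: "coord_vecs I \<subseteq> fvs.span (range (\<lambda>x :: nat \<times> nat \<Rightarrow> 'k. sv_vec a e x))"
proof (rule ccontr)
  assume "\<not> ?thesis"
  then obtain v :: "_ \<Rightarrow> 'k" where v: "v \<in> coord_vecs I" "v \<notin> fvs.span (range (sv_vec a e))" by blast
  have sub: "range (sv_vec a e :: _ \<Rightarrow> _ \<Rightarrow> 'k) \<subseteq> coord_vecs I" by auto
  obtain F where F: "\<And>s. s \<in> fvs.span (range (sv_vec a e)) \<Longrightarrow> (\<Sum>i\<in>I. F i * s i) = (0 :: 'k)" "(\<Sum>i\<in>I. F i * v i) = 1"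
    by (rule coord_vecs_dual[OF finite_sv_index sub v]) blast
  have "(\<Sum>i\<in>I. F i * sv_vec a e p i) = 0" for p by (rule F(1)) (auto intro: fvs.span_base)
  then have "F i = 0" if "i \<in> I" for i using sv_monomials_independent[of F a e] that by blast
  then show False using F(2) by simp
qed

text \<open>Finitely many points of the variety span the ambient space, and each lies in its own
  tangent space by Euler's relation.\<close>

lemma ex_r_full: "\<exists>M. r M = N"
proof -
  let ?S = "range (\<lambda>x :: nat \<times> nat \<Rightarrow> 'k. sv_vec a e x)"
  have "?S \<subseteq> fvs.span units" using coord_units sv_vec_in by blast
  from fvs.finite_basis[OF finite_units this]
  obtain B where B: "B \<subseteq> ?S" "finite B" "?S \<subseteq> fvs.span B" by metis
  obtain f where f: "f ` {..<card B} = B"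
    using ex_bij_betw_nat_finite[OF B(2)] atLeast0LessThan bij_betw_imp_surj_on by metis
  have "\<forall>h. \<exists>x. h < card B \<longrightarrow> f h = sv_vec a e (x :: nat \<times> nat \<Rightarrow> 'k)" using B(1) f by blast
  then obtain P where P: "\<And>h. h < card B \<Longrightarrow> f h = sv_vec a e (P h :: nat \<times> nat \<Rightarrow> 'k)" by metis
  have "B \<subseteq> fvs.span (W P {..<card B})"
  proof
    fix b assume "b \<in> B"
    then obtain h where h: "h < card B" "b = sv_vec a e (P h)" using f P by (metis imageE lessThan_iff)
    have "sv_vec a e (P h) \<in> fvs.span (tangent_gens a e (P h))"
      by (rule sv_vec_in_tangent[OF ne]) (use e2[of 0] ne in simp)
    moreover have "tangent_gens a e (P h) \<subseteq> W P {..<card B}" using h by (auto simp: W_def)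
    ultimately show "b \<in> fvs.span (W P {..<card B})" using h fvs.span_mono by blast
  qed
  then have "coord_vecs I \<subseteq> fvs.span (W P {..<card B})"
    using span_sv_vec B(3) by (meson fvs.span_minimal fvs.subspace_span subset_trans)
  then have "fvs.dim (coord_vecs I :: (_ \<Rightarrow> 'k) set) \<le> fvs.dim (W P {..<card B})"
    by (rule fvs.dim_mono_finite[OF finite_units W_units])
  then have "N \<le> r (card B)" using dim_W_le_r[of "{..<card B}" P] by (simp add: dim_coord_vecs)
  then show ?thesis using r_le antisym by blast
qed

text \<open>The increments of \<open>r\<close> strictly decrease once they are smaller than \<open>r 1\<close>.\<close>

lemma r_eq:
  assumes s: "2 * (s - 1) * r 1 + r 1 * (r 1 - 1) < 2 * N"
  shows "r s = s * r 1"
proof (rule ccontr)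
  assume neq: "r s \<noteq> s * r 1"
  let ?D = "r 1"
  have step: "r (Suc j) \<le> r j + ?D" for j
  proof (induction j)
    case (Suc j)
    then show ?case using r_concave[of j] by simp
  qed (simp add: r_0)
  have le: "r j \<le> j * ?D" for j
  proof (induction j)
    case (Suc j)
    then show ?case using step[of j] by simp
  qed (simp add: r_0)
  \<comment> \<open>\<open>Suc m\<close> is the first number of points with a defect.\<close>
  define m where "m = (LEAST j. r (Suc j) \<noteq> Suc j * ?D)"
  have s0: "s \<noteq> 0" using neq r_0 by (cases s) auto
  then have ex: "r (Suc (s - 1)) \<noteq> Suc (s - 1) * ?D" using neq by simp
  have m: "r (Suc m) \<noteq> Suc m * ?D" unfolding m_def by (rule LeastI[of "\<lambda>j. r (Suc j) \<noteq> Suc j * ?D", OF ex])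
  have ms: "m \<le> s - 1" unfolding m_def by (rule Least_le) (rule ex)
  have rm: "r m = m * ?D"
  proof (cases m)
    case (Suc j)
    then show ?thesis using not_less_Least[of j "\<lambda>j. r (Suc j) \<noteq> Suc j * ?D"] unfolding m_def by auto
  qed (simp add: r_0)
  have D: "?D \<ge> 1" using r_1 by simp
  \<comment> \<open>From the first defect on, the bound for the increments drops by 1 at each step:
    either the space is full, or the increments decrease strictly. Truncated subtraction makes the
    bound 0 from \<open>j = ?D - 1\<close> on.\<close>
  have inc: "r (Suc (m + j)) \<le> r (m + j) + (?D - 1 - j)" for j
  proof (induction j)
    case 0
    then show ?case using m le[of "Suc m"] rm by simp
  next
    case (Suc j)
    show ?case
    proof (cases "r (m + j) = N")
      case True
      then have "r (Suc (m + j)) = N" "r (Suc (Suc (m + j))) = N"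
        using r_mono[of "m + j"] r_mono[of "Suc (m + j)"] r_le by (metis antisym)+
      then show ?thesis by simp
    next
      case False
      have "r (m + j + 1) < r (m + j) + r 1" using Suc.IH D by simp
      then have "r (m + j + 2) + r (m + j) \<noteq> r (m + j + 1) + r (m + j + 1)"
        using full_rank_if_equal_steps[of "m + j"] False by blast
      then have "r (m + j + 2) + r (m + j) < r (m + j + 1) + r (m + j + 1)"
        using r_concave[of "m + j"] by linarith
      then show ?thesis using Suc.IH by simp
    qed
  qed
  \<comment> \<open>The product on the left is twice the sum of the bounds for all increments still
    to come.\<close>
  have bound: "2 * r (m + j) + (?D - 1 - j) * (?D - j) \<le> 2 * m * ?D + ?D * (?D - 1)" for j
  proof (induction j)
    case 0
    then show ?case by (simp add: rm mult.commute)
  next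
    case (Suc j)
    have "(?D - 1 - Suc j) * (?D - Suc j) + 2 * (?D - 1 - j) \<le> (?D - 1 - j) * (?D - j)"
    proof (cases "?D - 1 - j")
      case 0
      then have "?D - Suc j = 0" by simp
      then show ?thesis using 0 by simp
    next
      case (Suc c)
      then have "?D - j = Suc (Suc c)" "?D - Suc j = Suc c" "?D - 1 - Suc j = c" by auto
      then show ?thesis using Suc by simp
    qed
    then show ?case using inc[of j] Suc.IH by simp
  qed
  obtain M where M: "r M = N" using ex_r_full by blast
  have "r M \<le> r (m + M)" by (rule lift_Suc_mono_le[of r]) (use r_mono in auto)
  then have "2 * N \<le> 2 * m * ?D + ?D * (?D - 1)" using bound[of M] M by linarith
  also have "\<dots> \<le> 2 * (s - 1) * ?D + ?D * (?D - 1)" using ms by simp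
  finally show False using s by simp
qed

end

section \<open>Splitting off a factor of degree one\<close>

context sv_tangents
begin

definition mixed :: "(nat \<Rightarrow> nat \<times> nat \<Rightarrow> 'k) \<Rightarrow> nat set \<Rightarrow> nat set \<Rightarrow> ((nat \<Rightarrow> nat \<Rightarrow> nat) \<Rightarrow> 'k) set" where
  "mixed P A B = W P A \<union> (\<lambda>h. sv_vec a e (P h)) ` B"

lemma mixed_sub: "mixed P A B \<subseteq> coord_vecs I"
  using W_sub by (auto simp: mixed_def)

lemma mixed_units: "mixed P A B \<subseteq> fvs.span units"
  using mixed_sub coord_units by blast

lemma open_cond_mixed:
  assumes "finite A" "finite B" shows "open_cond (\<lambda>P. d \<le> fvs.dim (mixed P A B))"
proof -
  let ?v = "\<lambda>P. case_sum (\<lambda>(h, q). sv_tangent a e (P h) (unit_vec q)) (\<lambda>h. sv_vec a e (P h)) :: _ \<Rightarrow> _ \<Rightarrow> 'k"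
  have "mixed P A B = ?v P ` (Inl ` (A \<times> sv_vars a) \<union> Inr ` B)" for P
    by (auto simp: mixed_def W_def tangent_gens_def image_Un image_image)
  moreover have "open_cond (\<lambda>P. d \<le> fvs.dim (?v P ` (Inl ` (A \<times> sv_vars a) \<union> Inr ` B)))"
  proof (rule open_cond_dim[of I])
    fix P Q :: "nat \<Rightarrow> nat \<times> nat \<Rightarrow> 'k" and s :: "nat \<times> nat \<times> nat + nat" and i
    have seg: "poly_fun (\<lambda>t. seg P Q t h q)" for h q
      unfolding seg_def by (intro poly_fun_add poly_fun_mult poly_fun_const poly_fun_id)
    show "poly_fun (\<lambda>t. ?v (seg P Q t) s i)"
    proof (cases s)
      case (Inl hq)
      obtain h q where hq: "hq = (h, q)" by (cases hq)
      have "poly_fun (\<lambda>t. sv_tangent a e (seg P Q t h) (unit_vec q) i)"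
        by (rule poly_fun_sv_tangent[OF seg poly_fun_const])
      then show ?thesis by (simp add: Inl hq)
    next
      case (Inr h)
      then show ?thesis using poly_fun_sv_vec[OF seg] by simp
    qed
  qed (use assms in auto)
  ultimately show ?thesis by simp
qed

text \<open>As long as the span is proper, some point of the variety lies outside it, because these
  points span everything. The index \<open>h\<close> is new, so the earlier points can stay in
  place.\<close>

lemma ex_mixed:
  assumes A: "finite A" and B: "finite B" and AB: "A \<inter> B = {}"
  shows "\<exists>P. min N (r (card A) + card B) \<le> fvs.dim (mixed P A B)"
  using B AB
proof (induction B rule: finite_induct)
  case empty
  obtain P where "fvs.dim (W P A) = r (card A)" using ex_dim_W_eq_r[OF A] by blast
  then show ?case by (intro exI[of _ P]) (simp add: mixed_def)
next
  case (insert h B)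
  then obtain P where P: "min N (r (card A) + card B) \<le> fvs.dim (mixed P A B)" by auto
  show ?case
  proof (cases "coord_vecs I \<subseteq> fvs.span (mixed P A B)")
    case True
    have "mixed P A B \<subseteq> fvs.span (mixed P A (insert h B))"
      by (auto simp: mixed_def intro: fvs.span_base)
    then have "fvs.span (mixed P A B) \<subseteq> fvs.span (mixed P A (insert h B))"
      by (rule fvs.span_minimal[OF _ fvs.subspace_span])
    then have "coord_vecs I \<subseteq> fvs.span (mixed P A (insert h B))" using True by blast
    then have "fvs.dim (coord_vecs I :: (_ \<Rightarrow> 'k) set) \<le> fvs.dim (mixed P A (insert h B))"
      by (rule fvs.dim_mono_finite[OF finite_units mixed_units])
    then show ?thesis by (intro exI[of _ P]) (simp add: dim_coord_vecs)
  next
    case False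
    have "\<exists>x. sv_vec a e x \<notin> fvs.span (mixed P A B)"
    proof (rule ccontr)
      assume "\<not> ?thesis"
      then have "range (\<lambda>x. sv_vec a e x) \<subseteq> fvs.span (mixed P A B)" by blast
      then have "fvs.span (range (\<lambda>x. sv_vec a e x)) \<subseteq> fvs.span (mixed P A B)"
        by (rule fvs.span_minimal[OF _ fvs.subspace_span])
      then show False using False span_sv_vec by blast
    qed
    then obtain x where x: "sv_vec a e x \<notin> fvs.span (mixed P A B)" by blast
    define Q where "Q = P(h := x)"
    have hA: "h \<notin> A" "h \<notin> B" using insert by auto
    have "W Q A = W P A" unfolding W_def Q_def using hA by (intro SUP_cong) auto
    moreover have "(\<lambda>g. sv_vec a e (Q g)) ` B = (\<lambda>g. sv_vec a e (P g)) ` B"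
      unfolding Q_def using hA by (intro image_cong) auto
    ultimately have Q: "mixed Q A (insert h B) = mixed P A B \<union> {sv_vec a e x}"
      unfolding mixed_def by (simp add: Q_def)
    obtain C where C: "C \<subseteq> mixed P A B" "finite C" "fvs.independent C" "card C = fvs.dim (mixed P A B)"
      using fvs.finite_basis[OF finite_units mixed_units] by metis
    have "sv_vec a e x \<notin> fvs.span C" using x fvs.span_mono[OF C(1)] by blast
    then have "fvs.independent (insert (sv_vec a e x) C)" "sv_vec a e x \<notin> C"
      using C(3) fvs.independent_insertI fvs.span_base by blast+
    moreover have "insert (sv_vec a e x) C \<subseteq> fvs.span (mixed Q A (insert h B))"
      unfolding Q using C(1) fvs.span_superset by blast
    ultimately have "card (insert (sv_vec a e x) C) \<le> fvs.dim (mixed Q A (insert h B))"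
      using fvs.independent_card_le_dim_finite(2)[OF finite_units mixed_units] by blast
    then show ?thesis using C \<open>sv_vec a e x \<notin> C\<close> P insert.hyps by (intro exI[of _ Q]) simp
  qed
qed

text \<open>Indices are grouped by \<open>h div S\<close>: group \<open>j\<close> contributes
  tangent spaces to block \<open>j\<close> and plain points to every other block. All blocks share
  one configuration, so the rank conditions, each attained separately, are combined as open
  conditions.\<close>

lemma ex_block_points:
  fixes n0 S :: nat
  assumes rS: "r S = S * r 1" and S: "S \<ge> 1" and N: "N \<ge> 1"
  shows "\<exists>P. sv_vec a e (P 0) \<noteq> 0 \<and> (\<forall>j\<le>n0. min N (S * (r 1 + n0)) \<le>
    fvs.dim (mixed P {h. h < (n0 + 1) * S \<and> h div S = j} {h. h < (n0 + 1) * S \<and> h div S \<noteq> j}))"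
proof -
  let ?A = "\<lambda>j. {h. h < (n0 + 1) * S \<and> h div S = j}" and ?B = "\<lambda>j. {h. h < (n0 + 1) * S \<and> h div S \<noteq> j}"
  let ?H = "{..<(n0 + 1) * S}"
  have cA: "card (?A j) = S" if j: "j \<le> n0" for j
  proof -
    have "?A j = {j * S..<j * S + S}"
    proof (intro equalityI subsetI)
      fix h assume "h \<in> ?A j"
      then show "h \<in> {j * S..<j * S + S}" using S dividend_less_div_times[of S h] div_times_less_eq_dividend[of h S] by auto
    next
      fix h assume h: "h \<in> {j * S..<j * S + S}"
      then have "h div S = j" by (intro div_nat_eqI) (auto simp: mult.commute)
      moreover have "j * S + S \<le> (n0 + 1) * S" using mult_le_mono1[OF j, of S] by simp
      moreover have "h < j * S + S" using h by simp
      ultimately show "h \<in> ?A j" using less_le_trans by blast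
    qed
    then show ?thesis by simp
  qed
  have cB: "card (?B j) = n0 * S" if j: "j \<le> n0" for j
  proof -
    have "?A j \<union> ?B j = ?H" "?A j \<inter> ?B j = {}" by auto
    then have "card (?A j) + card (?B j) = (n0 + 1) * S"
      using card_Un_disjoint[of "?A j" "?B j"] by simp
    then show ?thesis using cA[OF j] by simp
  qed
  \<comment> \<open>Index \<open>n0 + 1\<close> stores the extra condition that the point with index
    0 is nonzero, written as a rank so that it is open too.\<close>
  define G where "G j P = (if j \<le> n0 then min N (S * (r 1 + n0)) \<le> fvs.dim (mixed P (?A j) (?B j))
    else 1 \<le> fvs.dim (mixed P {} {0}))" for j P
  have "\<exists>P. \<forall>j\<in>{..n0 + 1}. G j P"
  proof (rule open_cond_inter_finite)
    show "open_cond (G j)" for j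
      unfolding G_def[abs_def] by (cases "j \<le> n0") (simp_all add: open_cond_mixed)
    show "\<exists>P. G j P" for j
    proof (cases "j \<le> n0")
      case True
      have "\<exists>P. min N (r (card (?A j)) + card (?B j)) \<le> fvs.dim (mixed P (?A j) (?B j))"
        by (rule ex_mixed) auto
      then show ?thesis using True cA[OF True] cB[OF True] rS by (simp add: G_def algebra_simps)
    next
      case False
      have "\<exists>P. min N (r (card ({} :: nat set)) + card {0::nat}) \<le> fvs.dim (mixed P {} {0})"
        by (rule ex_mixed) auto
      then show ?thesis using False N by (auto simp: G_def r_0)
    qed
  qed simp
  then obtain P where P: "\<And>j. j \<le> n0 + 1 \<Longrightarrow> G j P" by auto
  have "1 \<le> fvs.dim (mixed P {} {0})" using P[of "n0 + 1"] by (simp add: G_def)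
  moreover have "mixed P {} {0} = {sv_vec a e (P 0)}" by (simp add: mixed_def W_def)
  moreover have "fvs.dim {0 :: _ \<Rightarrow> 'k} = 0" using fvs.dim_le_card[of "{0}" "{}"] by simp
  ultimately have "sv_vec a e (P 0) \<noteq> 0" by (metis not_one_le_zero)
  moreover have "min N (S * (r 1 + n0)) \<le> fvs.dim (mixed P (?A j) (?B j))" if "j \<le> n0" for j
  proof -
    have "G j P" using P that by simp
    then show ?thesis unfolding G_def using that by (simp only: if_True)
  qed
  ultimately show ?thesis by blast
qed

end

text \<open>The \<open>j\<close>-th coordinate copy of the ambient space of the remaining factors.\<close>

definition emb :: "nat \<Rightarrow> nat list \<Rightarrow> nat list \<Rightarrow> nat \<Rightarrow> ((nat \<Rightarrow> nat \<Rightarrow> nat) \<Rightarrow> 'k::field) \<Rightarrow> (nat \<Rightarrow> nat \<Rightarrow> nat) \<Rightarrow> 'k" where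
  "emb n0 n d j v = (\<lambda>\<alpha>. if \<alpha> \<in> sv_index (n0 # n) (1 # d) \<and> \<alpha> 0 j = 1
      then v (\<lambda>i\<in>{..<length n}. \<alpha> (Suc i)) else 0)"

text \<open>The index in the \<open>j\<close>-th copy that corresponds to \<open>\<alpha>\<close>;
  it undoes the truncation of indices in \<open>emb\<close>.\<close>

definition lift_index :: "nat list \<Rightarrow> nat \<Rightarrow> (nat \<Rightarrow> nat \<Rightarrow> nat) \<Rightarrow> nat \<Rightarrow> nat \<Rightarrow> nat" where
  "lift_index n j \<alpha> = (\<lambda>i\<in>{..<Suc (length n)}. case i of 0 \<Rightarrow> (\<lambda>l. if l = j then 1 else 0) | Suc i \<Rightarrow> \<alpha> i)"

lemma exponents_1D:
  assumes "\<beta> \<in> exponents {..n0::nat} 1"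
  obtains j where "j \<le> n0" "\<And>l. \<beta> l = (if l = j then 1 else 0)"
proof -
  have s: "(\<Sum>l\<le>n0. \<beta> l) = 1" and z: "\<And>l. n0 < l \<Longrightarrow> \<beta> l = 0" using assms by (auto simp: exponents_def)
  then obtain j where j: "j \<le> n0" "\<beta> j \<noteq> 0" by (metis atMost_iff one_neq_zero sum.neutral)
  have r: "(\<Sum>l\<le>n0. \<beta> l) = \<beta> j + (\<Sum>l\<in>{..n0} - {j}. \<beta> l)" using j by (intro sum.remove) auto
  then have b1: "\<beta> j = 1" and s0: "(\<Sum>l\<in>{..n0} - {j}. \<beta> l) = 0" using s j(2) by linarith+
  have "\<beta> l = 0" if "l \<le> n0" "l \<noteq> j" for l
    using s0 that by (subst (asm) sum_eq_0_iff) auto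
  then have "\<beta> l = (if l = j then 1 else 0)" for l
    using z[of l] b1 by (cases "l \<le> n0") auto
  then show ?thesis using that j by blast
qed

lemma sv_index_ConsD:
  assumes "\<alpha> \<in> sv_index (n0 # n) (1 # d)"
  shows "\<alpha> 0 \<in> exponents {..n0} 1" "(\<lambda>i\<in>{..<length n}. \<alpha> (Suc i)) \<in> sv_index n d"
proof -
  have *: "\<alpha> i \<in> exponents {..(n0 # n) ! i} ((1 # d) ! i)" if "i < Suc (length n)" for i
    using assms that by (auto simp: sv_index_def)
  show "\<alpha> 0 \<in> exponents {..n0} 1" using *[of 0] by simp
  show "(\<lambda>i\<in>{..<length n}. \<alpha> (Suc i)) \<in> sv_index n d" 
    unfolding sv_index_def using * by (intro restrict_PiE_iff[THEN iffD2]) fastforce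
qed

lemma lift_index_mem:
  assumes "\<alpha> \<in> sv_index n d" "j \<le> n0"
  shows "lift_index n j \<alpha> \<in> sv_index (n0 # n) (1 # d)" "lift_index n j \<alpha> 0 j = 1"
    "(\<lambda>i\<in>{..<length n}. lift_index n j \<alpha> (Suc i)) = \<alpha>"
proof -
  have "lift_index n j \<alpha> i \<in> exponents {..(n0 # n) ! i} ((1 # d) ! i)" if "i < Suc (length n)" for i
    using assms that by (cases i) (auto simp: lift_index_def sv_index_def exponents_def)
  then show "lift_index n j \<alpha> \<in> sv_index (n0 # n) (1 # d)"
    by (auto simp: sv_index_def lift_index_def)
  show "lift_index n j \<alpha> 0 j = 1" by (simp add: lift_index_def)
  show "(\<lambda>i\<in>{..<length n}. lift_index n j \<alpha> (Suc i)) = \<alpha>"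
    using assms(1) by (auto simp: fun_eq_iff lift_index_def sv_index_def PiE_def extensional_def)
qed

lemma emb_in [simp]: "emb n0 n d j v \<in> coord_vecs (sv_index (n0 # n) (1 # d))"
  by (auto simp: emb_def coord_vecs_def)

lemma emb_add: "emb n0 n d j (v + w) = emb n0 n d j v + emb n0 n d j w"
  and emb_scale: "emb n0 n d j (fscale c v) = fscale c (emb n0 n d j v)"
  and emb_zero: "emb n0 n d j 0 = 0"
  by (auto simp: emb_def fun_eq_iff fscale_def)

lemma emb_lift:
  assumes "\<alpha> \<in> sv_index n d" "j \<le> n0" shows "emb n0 n d j v (lift_index n j \<alpha>) = v \<alpha>"
  using lift_index_mem[OF assms] by (simp add: emb_def)

lemma emb_span:
  assumes "v \<in> fvs.span B" shows "emb n0 n d j v \<in> fvs.span (emb n0 n d j ` B)"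
  using assms
proof (induction rule: fvs.span_induct_alt)
  case base
  show ?case unfolding emb_zero by (rule fvs.span_zero)
next
  case (step c x y)
  then show ?case unfolding emb_add emb_scale
    by (intro fvs.span_add fvs.span_scale) (auto intro: fvs.span_base)
qed

lemma dim_emb_le:
  fixes V :: "((nat \<Rightarrow> nat \<Rightarrow> nat) \<Rightarrow> 'k::field) set"
  assumes "finite V" shows "fvs.dim (emb n0 n d j ` V) \<le> fvs.dim V"
proof -
  obtain B where B: "B \<subseteq> V" "finite B" "V \<subseteq> fvs.span B" "card B = fvs.dim V"
    using fvs.finite_basis[OF assms fvs.span_superset] by metis
  have "emb n0 n d j ` V \<subseteq> fvs.span (emb n0 n d j ` B)" using B(3) emb_span by blast
  then have "fvs.dim (emb n0 n d j ` V) \<le> card (emb n0 n d j ` B)"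
    using fvs.dim_le_card B(2) by blast
  then show ?thesis using card_image_le[OF B(2), of "emb n0 n d j"] B(4) by simp
qed

lemma dim_emb_ge:
  fixes V :: "((nat \<Rightarrow> nat \<Rightarrow> nat) \<Rightarrow> 'k::field) set"
  assumes V: "finite V" "V \<subseteq> coord_vecs (sv_index n d)" and j: "j \<le> n0"
  shows "fvs.dim V \<le> fvs.dim (emb n0 n d j ` V)"
proof -
  obtain R where R: "R \<subseteq> V" "indep_family R (\<lambda>v. v)" "card R = fvs.dim ((\<lambda>v. v) ` V)"
    by (rule indep_subfamily_dim[of "sv_index n d" V "\<lambda>v. v"]) (use V in auto)
  have "indep_family R (emb n0 n d j)"
    unfolding indep_family_def
  proof (intro allI impI)
    fix c assume c: "(\<Sum>v\<in>R. fscale (c v) (emb n0 n d j v)) = 0"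
    have "(\<Sum>v\<in>R. fscale (c v) v) \<alpha> = 0" for \<alpha>
    proof (cases "\<alpha> \<in> sv_index n d")
      case True
      have "(\<Sum>v\<in>R. fscale (c v) (emb n0 n d j v)) (lift_index n j \<alpha>) = 0" using c by simp
      then show ?thesis unfolding sum_apply fscale_def emb_lift[OF True j] .
    next
      case False
      then have "v \<alpha> = 0" if "v \<in> R" for v using R V that by (auto simp: coord_vecs_def)
      then show ?thesis unfolding sum_apply fscale_def by (intro sum.neutral ballI) simp
    qed
    then have "(\<Sum>v\<in>R. fscale (c v) v) = 0" by (intro ext) simp
    then show "\<forall>v\<in>R. c v = 0" using R(2) unfolding indep_family_def by blast
  qed
  then have "card R \<le> fvs.dim (emb n0 n d j ` V)"
    by (intro dim_ge_indep_family[OF finite_sv_index[of "n0 # n" "1 # d"] emb_in V(1) R(1)])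
  then show ?thesis using R(3) by simp
qed

text \<open>An exponent of degree one determines its variable, so different copies are supported on
  disjoint sets of coordinates.\<close>

lemma dim_emb_sum:
  fixes V :: "nat \<Rightarrow> ((nat \<Rightarrow> nat \<Rightarrow> nat) \<Rightarrow> 'k::field) set"
  assumes V: "\<And>j. finite (V j)" "\<And>j. V j \<subseteq> coord_vecs (sv_index n d)" and m: "m \<le> n0 + 1"
  shows "(\<Sum>j<m. fvs.dim (V j)) \<le> fvs.dim (\<Union>j<m. emb n0 n d j ` V j)"
  using m
proof (induction m)
  case (Suc m)
  let ?U = "\<Union>j<m. emb n0 n d j ` V j" and ?E = "emb n0 n d m ` V m"
  let ?u = "unit_vec ` sv_index (n0 # n) (1 # d) :: ((nat \<Rightarrow> nat \<Rightarrow> nat) \<Rightarrow> 'k) set"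
  have fin: "finite ?u" by simp
  have sub: "coord_vecs (sv_index (n0 # n) (1 # d)) \<subseteq> fvs.span ?u" by (rule coord_vecs_subset_span) simp
  have U: "?U \<subseteq> fvs.span ?u" and E: "?E \<subseteq> fvs.span ?u" using sub emb_in by blast+
  have "v = 0" if v: "v \<in> fvs.span ?U" "v \<in> fvs.span ?E" for v
  proof
    fix \<alpha> show "v \<alpha> = 0 \<alpha>"
    proof (cases "\<alpha> \<in> sv_index (n0 # n) (1 # d) \<and> \<alpha> 0 m = 1")
      case True
      let ?Z = "{v :: (nat \<Rightarrow> nat \<Rightarrow> nat) \<Rightarrow> 'k. v \<alpha> = 0}"
      have "fvs.subspace ?Z" by (auto simp: fvs.subspace_def fscale_def)
      moreover obtain j where j: "\<And>l. \<alpha> 0 l = (if l = j then 1 else 0)"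
        using exponents_1D[OF sv_index_ConsD(1)] True by metis
      then have "j = m" using True by (metis zero_neq_one)
      then have "?U \<subseteq> ?Z" using j by (auto simp: emb_def)
      ultimately have "fvs.span ?U \<subseteq> ?Z" using fvs.span_minimal by blast
      then show ?thesis using v by auto
    next
      case False
      let ?Z = "{v :: (nat \<Rightarrow> nat \<Rightarrow> nat) \<Rightarrow> 'k. v \<alpha> = 0}"
      have "fvs.subspace ?Z" by (auto simp: fvs.subspace_def fscale_def)
      moreover have "?E \<subseteq> ?Z" using False by (auto simp: emb_def)
      ultimately have "fvs.span ?E \<subseteq> ?Z" using fvs.span_minimal by blast
      then show ?thesis using v by auto
    qed
  qed
  then have "fvs.dim (?U \<union> ?E) = fvs.dim ?U + fvs.dim ?E"
    by (intro fvs.dim_Un_disjoint[OF fin U E]) blast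
  moreover have "?U \<union> ?E = (\<Union>j<Suc m. emb n0 n d j ` V j)" by (auto simp: lessThan_Suc)
  moreover have "fvs.dim (V m) \<le> fvs.dim ?E" by (rule dim_emb_ge[OF V]) (use Suc.prems in simp)
  moreover have "(\<Sum>j<m. fvs.dim (V j)) \<le> fvs.dim ?U" by (rule Suc.IH) (use Suc.prems in simp)
  ultimately show ?case by (simp only: sum.lessThan_Suc)
qed simp

lemma monomial_Cons:
  assumes \<alpha>: "\<alpha> \<in> sv_index (n0 # n) (1 # d)" and j: "j \<le> n0" "\<And>l. \<alpha> 0 l = (if l = j then 1 else 0)"
  shows "monomial (sv_vars (n0 # n)) (case_prod \<alpha>) p =
    p (0, j) * monomial (sv_vars n) (case_prod (\<lambda>i\<in>{..<length n}. \<alpha> (Suc i))) (\<lambda>(i, l). p (Suc i, l))"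
proof -
  have M: "monomial (sv_vars b) (case_prod \<beta>) x = (\<Prod>i<length b. \<Prod>l\<le>b ! i. x (i, l) ^ \<beta> i l)"
    for b \<beta> and x :: "nat \<times> nat \<Rightarrow> 'a"
    unfolding monomial_def sv_vars_def by (subst prod.Sigma) (auto intro!: prod.cong)
  have "(\<Prod>l\<le>n0. p (0, l) ^ \<alpha> 0 l) = p (0, j)"
    using j(1) by (subst prod.remove[of _ j]) (auto simp: j(2))
  then show ?thesis unfolding M by (simp add: prod.lessThan_Suc_shift del: prod.lessThan_Suc)
qed

lemma sv_vec_Cons:
  fixes p :: "nat \<times> nat \<Rightarrow> 'k::field"
  shows "sv_vec (n0 # n) (1 # d) p = (\<Sum>j\<le>n0. fscale (p (0, j)) (emb n0 n d j (sv_vec n d (\<lambda>(i, l). p (Suc i, l)))))"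
proof
  fix \<alpha>
  show "sv_vec (n0 # n) (1 # d) p \<alpha> = (\<Sum>j\<le>n0. fscale (p (0, j)) (emb n0 n d j (sv_vec n d (\<lambda>(i, l). p (Suc i, l))))) \<alpha>"
  proof (cases "\<alpha> \<in> sv_index (n0 # n) (1 # d)")
    case True
    obtain j where j: "j \<le> n0" "\<And>l. \<alpha> 0 l = (if l = j then 1 else 0)"
      using exponents_1D[OF sv_index_ConsD(1)[OF True]] by metis
    let ?s = "sv_vec n d (\<lambda>(i, l). p (Suc i, l)) (\<lambda>i\<in>{..<length n}. \<alpha> (Suc i))"
    have "(\<Sum>l\<le>n0. fscale (p (0, l)) (emb n0 n d l (sv_vec n d (\<lambda>(i, l). p (Suc i, l))))) \<alpha>
      = (\<Sum>l\<le>n0. if l = j then p (0, j) * ?s else 0)"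
      unfolding sum_apply by (rule sum.cong) (use True in \<open>auto simp: fscale_def emb_def j(2) simp del: One_nat_def\<close>)
    also have "\<dots> = p (0, j) * ?s" using j(1) by simp
    finally show ?thesis using True monomial_Cons[OF True j] sv_index_ConsD(2)[OF True] by (simp add: sv_vec_def)
  next
    case False
    then have "emb n0 n d j v \<alpha> = 0" for j and v :: "_ \<Rightarrow> 'k" by (simp add: emb_def)
    then show ?thesis using False by (simp add: sv_vec_def sum_apply fscale_def)
  qed
qed

text \<open>Product rule for an expression linear in the first factor. If the first block of
  \<open>p\<close> is a multiple of the \<open>j\<close>-th coordinate vector, tangent vectors of
  the smaller variety occur only in copy \<open>j\<close>, whereas the point itself can be placed in
  any copy. This is the splitting into blocks.\<close>

lemma sv_tangent_Cons:
  fixes p z :: "nat \<times> nat \<Rightarrow> 'k::field_char_0"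
  shows "sv_tangent (n0 # n) (1 # d) p z =
    (\<Sum>j\<le>n0. fscale (z (0, j)) (emb n0 n d j (sv_vec n d (\<lambda>(i, l). p (Suc i, l))))
       + fscale (p (0, j)) (emb n0 n d j (sv_tangent n d (\<lambda>(i, l). p (Suc i, l)) (\<lambda>(i, l). z (Suc i, l)))))"
  (is "_ = (\<Sum>j\<le>n0. ?t j)")
proof
  fix \<alpha>
  show "sv_tangent (n0 # n) (1 # d) p z \<alpha> = (\<Sum>j\<le>n0. ?t j) \<alpha>"
  proof (cases "\<alpha> \<in> sv_index (n0 # n) (1 # d)")
    case True
    let ?J = "sv_vars (n0 # n)" and ?\<beta> = "\<lambda>i\<in>{..<length n}. \<alpha> (Suc i)"
    let ?p = "\<lambda>(i, l). p (Suc i, l)" and ?z = "\<lambda>(i, l). z (Suc i, l)"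
    obtain j where j: "j \<le> n0" "\<And>l. \<alpha> 0 l = (if l = j then 1 else 0)"
      using exponents_1D[OF sv_index_ConsD(1)[OF True]] by metis
    have "line_poly ?J (case_prod \<alpha>) p z = [:p (0, j), z (0, j):] * line_poly (sv_vars n) (case_prod ?\<beta>) ?p ?z"
      unfolding poly_eq_poly_eq_iff[symmetric]
    proof
      fix t
      have "(\<lambda>(i, l). p (Suc i, l) + t * z (Suc i, l)) = (\<lambda>q. ?p q + t * ?z q)" by auto
      then show "poly (line_poly ?J (case_prod \<alpha>) p z) t = poly ([:p (0, j), z (0, j):] * line_poly (sv_vars n) (case_prod ?\<beta>) ?p ?z) t"
        by (simp add: poly_line_poly monomial_Cons[OF True j] algebra_simps)
    qed
    then have "coeff (line_poly ?J (case_prod \<alpha>) p z) (Suc 0) =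
        coeff ([:p (0, j), z (0, j):] * line_poly (sv_vars n) (case_prod ?\<beta>) ?p ?z) (Suc 0)" by simp
    then have D: "dmonomial ?J (case_prod \<alpha>) p z = p (0, j) * dmonomial (sv_vars n) (case_prod ?\<beta>) ?p ?z
        + z (0, j) * monomial (sv_vars n) (case_prod ?\<beta>) ?p"
      unfolding coeff_line_poly_1 by (simp add: coeff_line_poly_1 coeff_line_poly_0)
    let ?s = "z (0, j) * sv_vec n d ?p ?\<beta> + p (0, j) * sv_tangent n d ?p ?z ?\<beta>"
    have "(\<Sum>l\<le>n0. ?t l) \<alpha> = (\<Sum>l\<le>n0. if l = j then ?s else 0)"
      unfolding sum_apply by (rule sum.cong) (use True in \<open>auto simp: fscale_def emb_def j(2) simp del: One_nat_def\<close>)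
    also have "\<dots> = ?s" using j(1) by simp
    finally show ?thesis using True D sv_index_ConsD(2)[OF True] by (simp add: sv_vec_def sv_tangent_def)
  next
    case False
    then have "emb n0 n d j v \<alpha> = 0" for j and v :: "_ \<Rightarrow> 'k" by (simp add: emb_def)
    then show ?thesis using False by (simp add: sv_tangent_def sum_apply fscale_def)
  qed
qed

section \<open>Dimensions of Segre-Veronese varieties and their secant varieties\<close>

text \<open>In each factor the last exponent is fixed by the degree, which leaves
  \<open>sum_list a\<close> free exponents.\<close>

lemma card_multidegree_le:
  assumes M: "\<And>i. i < length a \<Longrightarrow> D i < M"
  shows "card (multidegree a D) \<le> M ^ sum_list a"
proof -
  let ?S = "SIGMA i:{..<length a}. {..<a ! i}"
  let ?h = "\<lambda>\<beta>. restrict \<beta> ?S :: nat \<times> nat \<Rightarrow> nat"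
  have split: "(\<Sum>l\<le>a ! i. \<beta> (i, l)) = (\<Sum>l<a ! i. \<beta> (i, l)) + \<beta> (i, a ! i)" for \<beta> :: "nat \<times> nat \<Rightarrow> nat" and i
    by (simp flip: lessThan_Suc_atMost)
  have "inj_on ?h (multidegree a D)"
  proof (rule inj_onI)
    fix \<beta> \<gamma> assume b: "\<beta> \<in> multidegree a D" "\<gamma> \<in> multidegree a D" "?h \<beta> = ?h \<gamma>"
    have eq: "\<beta> (i, l) = \<gamma> (i, l)" if "i < length a" "l < a ! i" for i l
      using fun_cong[OF b(3), of "(i, l)"] that by simp
    have eq': "\<beta> (i, a ! i) = \<gamma> (i, a ! i)" if i: "i < length a" for i
    proof -
      have "(\<Sum>l<a ! i. \<beta> (i, l)) = (\<Sum>l<a ! i. \<gamma> (i, l))" using eq[OF i] by simp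
      moreover have "(\<Sum>l\<le>a ! i. \<beta> (i, l)) = (\<Sum>l\<le>a ! i. \<gamma> (i, l))"
        using b(1,2) i by (simp add: multidegree_def)
      ultimately show ?thesis unfolding split by simp
    qed
    show "\<beta> = \<gamma>"
    proof
      fix q :: "nat \<times> nat"
      obtain i l where q: "q = (i, l)" by (cases q)
      show "\<beta> q = \<gamma> q"
      proof (cases "q \<in> sv_vars a")
        case True
        then show ?thesis using eq[of i l] eq'[of i] q by (cases "l = a ! i") (auto simp: sv_vars_def)
      next
        case False
        then show ?thesis using b(1,2) q by (simp add: multidegree_def)
      qed
    qed
  qed
  moreover have "?h ` multidegree a D \<subseteq> ?S \<rightarrow>\<^sub>E {..<M}"
  proof (intro image_subsetI restrict_PiE_iff[THEN iffD2] ballI)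
    fix \<beta> q assume b: "\<beta> \<in> multidegree a D" and q: "q \<in> ?S"
    then obtain i l where il: "q = (i, l)" "i < length a" "l < a ! i" by auto
    then have "\<beta> (i, l) \<le> (\<Sum>l\<le>a ! i. \<beta> (i, l))" by (intro member_le_sum) auto
    also have "\<dots> < M" using b il M by (simp add: multidegree_def)
    finally show "\<beta> q \<in> {..<M}" using il by simp
  qed
  moreover have "finite (?S \<rightarrow>\<^sub>E {..<M})" by (intro finite_PiE) auto
  ultimately have "card (multidegree a D) \<le> card (?S \<rightarrow>\<^sub>E {..<M})" by (rule card_inj_on_le)
  also have "\<dots> = M ^ (\<Sum>i<length a. a ! i)" by (simp add: card_PiE)
  also have "(\<Sum>i<length a. a ! i) = sum_list a" by (simp add: sum_list_sum_nth atLeast0LessThan)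
  finally show ?thesis .
qed

text \<open>The product of pure powers of one nonzero coordinate per factor is a nonzero
  entry.\<close>

lemma sv_vec_nonzero:
  fixes x :: "nat \<times> nat \<Rightarrow> 'k::field"
  assumes "\<And>i. i < length a \<Longrightarrow> \<exists>l\<le>a ! i. x (i, l) \<noteq> 0"
  shows "sv_vec a e x \<noteq> 0"
proof -
  have "\<forall>i. \<exists>l. i < length a \<longrightarrow> l \<le> a ! i \<and> x (i, l) \<noteq> 0" using assms by blast
  then obtain l where l: "\<And>i. i < length a \<Longrightarrow> l i \<le> a ! i \<and> x (i, l i) \<noteq> 0" by metis
  define \<alpha> where "\<alpha> = (\<lambda>i\<in>{..<length a}. \<lambda>m. if m = l i then e ! i else 0)"
  have "\<alpha> \<in> sv_index a e" using l by (auto simp: \<alpha>_def sv_index_def exponents_def)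
  moreover have "monomial (sv_vars a) (case_prod \<alpha>) x \<noteq> 0"
    unfolding monomial_def using l by (auto simp: sv_vars_def \<alpha>_def)
  ultimately have "sv_vec a e x \<alpha> \<noteq> 0" by (simp add: sv_vec_def)
  then show ?thesis by auto
qed

lemma sv_vec_zero_block:
  fixes x :: "nat \<times> nat \<Rightarrow> 'k::field"
  assumes "i < length a" "e ! i \<ge> 1" "\<And>l. l \<le> a ! i \<Longrightarrow> x (i, l) = 0"
  shows "sv_vec a e x = 0"
proof
  fix \<alpha> show "sv_vec a e x \<alpha> = 0 \<alpha>"
  proof (cases "\<alpha> \<in> sv_index a e")
    case True
    obtain l where l: "l \<le> a ! i" "\<alpha> i l \<noteq> 0"
      using sv_indexD(1)[OF True assms(1)] assms(2) by (metis atMost_iff not_one_le_zero sum.neutral)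
    then have "x (i, l) ^ case_prod \<alpha> (i, l) = 0" using assms(3) by simp
    moreover have "(i, l) \<in> sv_vars a" using l assms(1) by (simp add: sv_vars_def)
    ultimately have "monomial (sv_vars a) (case_prod \<alpha>) x = 0"
      unfolding monomial_def by (intro prod_zero) auto
    then show ?thesis by (simp add: sv_vec_def)
  qed (simp add: sv_vec_def)
qed

lemma segre_veronese_eq:
  "segre_veronese a e = {proj_pt (sv_vec a e x) | x :: nat \<times> nat \<Rightarrow> 'k::field. \<forall>i<length a. \<exists>l\<le>a ! i. x (i, l) \<noteq> 0}"
    (is "?L = ?R")
proof (intro equalityI subsetI)
  fix p assume "p \<in> ?L"
  then obtain x :: "nat \<Rightarrow> nat \<Rightarrow> 'k" where x: "p = proj_pt (sv_map a e x)" "\<forall>i<length a. proj_pt (x i) \<in> proj_space {..a ! i}"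
    unfolding segre_veronese_def by blast
  have "\<exists>l\<le>a ! i. x i l \<noteq> 0" if i: "i < length a" for i
  proof -
    obtain w where w: "w \<in> coord_vecs {..a ! i}" "w \<noteq> 0" "proj_pt (x i) = proj_pt w"
      using x(2) i by (auto simp: proj_space_def)
    then obtain c where c: "c \<noteq> 0" "x i = fscale c w" using mem_proj_pt[of "x i"] by (auto simp: proj_pt_def)
    obtain l where "w l \<noteq> 0" using w(2) by (auto simp: fun_eq_iff)
    then show ?thesis using w(1) c by (auto simp: coord_vecs_def fscale_def intro!: exI[of _ l])
  qed
  moreover have "sv_map a e x = sv_vec a e (case_prod x)" using sv_map_eq_sv_vec[of a e "case_prod x"] by simp
  ultimately show "p \<in> ?R" using x(1) by (auto intro!: exI[of _ "case_prod x"])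
next
  fix p assume "p \<in> ?R"
  then obtain x :: "nat \<times> nat \<Rightarrow> 'k" where x: "p = proj_pt (sv_vec a e x)" "\<forall>i<length a. \<exists>l\<le>a ! i. x (i, l) \<noteq> 0" by blast
  \<comment> \<open>Coordinates beyond \<open>a ! i\<close> do not affect the image, but a point of
    \<open>proj_space {..a ! i}\<close> must have them zero.\<close>
  define y where "y i l = (if l \<le> a ! i then x (i, l) else 0)" for i l
  have "sv_map a e y = sv_vec a e (case_prod y)" using sv_map_eq_sv_vec[of a e "case_prod y"] by simp
  also have "\<dots> = sv_vec a e x" unfolding sv_vec_def
    by (auto simp: fun_eq_iff y_def sv_vars_def intro!: monomial_cong)
  finally have "p = proj_pt (sv_map a e y)" using x by simp
  moreover have "proj_pt (y i) \<in> proj_space {..a ! i}" if "i < length a" for i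
  proof -
    have "y i \<in> coord_vecs {..a ! i}" by (simp add: y_def coord_vecs_def)
    moreover have "\<exists>l\<le>a ! i. x (i, l) \<noteq> 0" using x(2) that by blast
    then obtain l where "l \<le> a ! i \<and> x (i, l) \<noteq> 0" by (rule exE)
    then have "y i l \<noteq> 0" by (simp add: y_def)
    then have "y i \<noteq> 0" by auto
    ultimately show ?thesis by (auto simp: proj_space_def)
  qed
  ultimately show "p \<in> ?L" unfolding segre_veronese_def by blast
qed

lemma segre_veronese_sub: "segre_veronese a e \<subseteq> proj_space (sv_index a e)"
proof
  fix p :: "((nat \<Rightarrow> nat \<Rightarrow> nat) \<Rightarrow> 'a) set" assume "p \<in> segre_veronese a e"
  then obtain x :: "nat \<times> nat \<Rightarrow> 'a" where x: "p = proj_pt (sv_vec a e x)" "\<forall>i<length a. \<exists>l\<le>a ! i. x (i, l) \<noteq> 0"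
    unfolding segre_veronese_eq mem_Collect_eq by (elim exE conjE)
  have "sv_vec a e x \<noteq> 0" by (rule sv_vec_nonzero) (rule x(2)[rule_format])
  then show "p \<in> proj_space (sv_index a e)" unfolding x(1) proj_space_def by (intro imageI) simp
qed

text \<open>Forms of degree \<open>T\<close> pull back to polynomials of multidegree
  \<open>T\<close> times \<open>e\<close>, and the number of their monomials is at most of order
  \<open>T ^ sum_list a\<close>.\<close>

lemma proj_dim_segre_veronese_le:
  "proj_dim (sv_index a e) (segre_veronese a e :: (_ \<Rightarrow> 'k::field_char_0) set set) \<le> enat (sum_list a)"
proof (rule proj_dim_le[where \<Phi> = "sv_vec a e" and C = "Suc (\<Sum>i<length a. e ! i)"])
  show "segre_veronese a e \<subseteq> range (\<lambda>x :: nat \<times> nat \<Rightarrow> 'k. proj_pt (sv_vec a e x))"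
    unfolding segre_veronese_eq by blast
  fix T
  let ?I = "sv_index a e" and ?J = "sv_vars a"
  let ?D = "\<lambda>i. T * e ! i"
  let ?B = "(\<lambda>\<beta>. monomial ?J \<beta> :: (nat \<times> nat \<Rightarrow> 'k) \<Rightarrow> 'k) ` multidegree a ?D"
  have "card ?B \<le> card (multidegree a ?D)" by (rule card_image_le[OF finite_multidegree])
  also have "\<dots> \<le> (Suc (\<Sum>i<length a. e ! i) * (T + 1)) ^ sum_list a"
  proof (rule card_multidegree_le)
    fix i assume i: "i < length a"
    define s where "s = (\<Sum>i<length a. e ! i)"
    have "e ! i \<le> s" unfolding s_def using i by (intro member_le_sum) auto
    then have "T * e ! i \<le> T * s" by (rule mult_le_mono2)
    moreover have "Suc s * (T + 1) = T * s + (T + s + 1)" by (simp add: algebra_simps)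
    ultimately show "T * e ! i < Suc (\<Sum>i<length a. e ! i) * (T + 1)" unfolding s_def by linarith
  qed
  finally have cB: "card ?B \<le> (Suc (\<Sum>i<length a. e ! i) * (T + 1)) ^ sum_list a" .
  have "(\<lambda>x. F (sv_vec a e x)) \<in> fvs.span ?B" if F: "F \<in> poly_space ?I (exponents ?I T)" for F :: "_ \<Rightarrow> 'k"
  proof -
    obtain c where c: "F = form ?I T c" using poly_space_is_form[OF finite_sv_index F] by metis
    have co: "(\<lambda>x :: nat \<times> nat \<Rightarrow> 'k. sv_vec a e x \<alpha>) \<in> poly_space ?J (multidegree a (\<lambda>i. e ! i))" if "\<alpha> \<in> ?I" for \<alpha>
    proof -
      have "(\<lambda>x :: nat \<times> nat \<Rightarrow> 'k. monomial ?J (case_prod \<alpha>) x) \<in> poly_space ?J (multidegree a (\<lambda>i. e ! i))"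
        by (rule sv_monomial_comp_multidegree[OF that], rule coordinate_multidegree) (auto simp: sv_vars_def)
      then show ?thesis using that by (simp add: sv_vec_def)
    qed
    have "(\<lambda>x. form ?I T c (sv_vec a e x)) \<in> poly_space ?J (multidegree a ?D)"
      unfolding form_def
    proof (rule poly_space_sum)
      fix \<gamma> assume \<gamma>: "\<gamma> \<in> exponents ?I T"
      have "(\<Sum>\<alpha>\<in>?I. \<Sum>_<\<gamma> \<alpha>. (!) e) = ?D"
      proof
        fix i
        have "(\<Sum>\<alpha>\<in>?I. \<Sum>_<\<gamma> \<alpha>. (!) e) i = (\<Sum>\<alpha>\<in>?I. \<gamma> \<alpha> * e ! i)" by (simp add: sum_apply)
        also have "\<dots> = ?D i" using \<gamma> by (simp add: exponents_def flip: sum_distrib_right)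
        finally show "(\<Sum>\<alpha>\<in>?I. \<Sum>_<\<gamma> \<alpha>. (!) e) i = ?D i" .
      qed
      note eq = this
      show "(\<lambda>x. monomial ?I \<gamma> (sv_vec a e x :: _ \<Rightarrow> 'k)) \<in> poly_space ?J (multidegree a ?D)"
        unfolding eq[symmetric] by (rule multidegree.monomial_comp_mem) (rule co)
    qed
    then show ?thesis unfolding c poly_space_def .
  qed
  then show "\<exists>B. finite B \<and> card B \<le> (Suc (\<Sum>i<length a. e ! i) * (T + 1)) ^ sum_list a \<and>
      (\<forall>F\<in>poly_space ?I (exponents ?I T). (\<lambda>x :: nat \<times> nat \<Rightarrow> 'k. F (sv_vec a e x)) \<in> fvs.span B)"
    using cB finite_multidegree by (intro exI[of _ ?B]) blast
qed (simp_all add: segre_veronese_sub)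

lemma proj_pt_in_secant:
  fixes P :: "nat \<Rightarrow> nat \<times> nat \<Rightarrow> 'k::field"
  assumes e: "\<And>i. i < length a \<Longrightarrow> e ! i \<ge> 1" and v: "v = (\<Sum>h<m. sv_vec a e (P h))" "v \<noteq> 0"
  shows "proj_pt v \<in> secant_variety (sv_index a e) m (segre_veronese a e)"
proof -
  let ?I = "sv_index a e" and ?X = "segre_veronese a e :: (_ \<Rightarrow> 'k) set set"
  define ok where "ok x \<longleftrightarrow> (\<forall>i<length a. \<exists>l\<le>a ! i. x (i, l) \<noteq> 0)" for x :: "nat \<times> nat \<Rightarrow> 'k"
  \<comment> \<open>A configuration vector with a zero block has image 0 and defines no point of the
    variety. It adds nothing to the sum, so an arbitrary point can take its place.\<close>
  define Q where "Q h = (if ok (P h) then P h else (\<lambda>_. 1))" for h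
  define x where "x h = proj_pt (sv_vec a e (Q h))" for h
  have "ok (Q h)" for h by (auto simp: Q_def ok_def)
  then have xX: "x h \<in> ?X" for h unfolding x_def segre_veronese_eq ok_def by blast
  have "sv_vec a e (P h) \<in> fvs.span (\<Union>(x ` {..<m}))" if h: "h < m" for h
  proof (cases "ok (P h)")
    case True
    have "sv_vec a e (P h) \<in> x h" using True by (simp add: x_def Q_def mem_proj_pt)
    then show ?thesis using h by (intro fvs.span_base) blast
  next
    case False
    then have "sv_vec a e (P h) = 0" using sv_vec_zero_block e unfolding ok_def by blast
    then show ?thesis by (simp add: fvs.span_zero)
  qed
  then have vs: "v \<in> fvs.span (\<Union>(x ` {..<m}))" unfolding v(1) by (intro fvs.span_sum) auto
  have "v \<in> coord_vecs ?I" unfolding v(1) by (intro fvs.subspace_sum[OF subspace_coord_vecs]) simp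
  then have "proj_pt v \<in> proj_space ?I" using v(2) by (auto simp: proj_space_def)
  moreover have "proj_pt v \<subseteq> fvs.span (\<Union>(x ` {..<m}))"
    using fvs.span_scale[OF vs] by (auto simp: proj_pt_def)
  ultimately have "proj_pt v \<in> proj_span ?I (x ` {..<m})" by (simp add: proj_span_def)
  then have "proj_pt v \<in> (\<Union>x \<in> {..<m} \<rightarrow> ?X. proj_span ?I (x ` {..<m}))" using xX by blast
  moreover have "(\<Union>x \<in> {..<m} \<rightarrow> ?X. proj_span ?I (x ` {..<m})) \<subseteq> topspace (zariski ?I)"
    unfolding topspace_zariski[OF finite_sv_index] by (auto simp: proj_span_def)
  ultimately show ?thesis unfolding secant_variety_def using closure_of_subset by blast
qed

text \<open>One half of Terracini's lemma.\<close>

lemma proj_dim_secant_ge: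
  fixes P :: "nat \<Rightarrow> nat \<times> nat \<Rightarrow> 'k::field_char_0"
  assumes e: "\<And>i. i < length a \<Longrightarrow> e ! i \<ge> 1"
    and w0: "w0 = (\<Sum>h<m. sv_vec a e (P h))" "w0 \<noteq> 0" "w0 \<in> fvs.span G"
    and G: "finite G" "\<And>v. v \<in> G \<Longrightarrow> \<exists>z. v = (\<Sum>h<m. sv_tangent a e (P h) (z h))"
    and R: "R + 1 \<le> fvs.dim G"
  shows "enat R \<le> proj_dim (sv_index a e) (secant_variety (sv_index a e) m (segre_veronese a e :: (_ \<Rightarrow> 'k) set set))"
proof -
  let ?I = "sv_index a e" and ?J = "sv_vars a"
  \<comment> \<open>A basis that contains \<open>w0\<close>: the base point of the cone uses up one
    vector, which is the difference between rank and projective dimension.\<close>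
  have "fvs.independent {w0}" using w0(2) by simp
  moreover have "insert w0 G \<subseteq> fvs.span (insert w0 G)" "{w0} \<subseteq> insert w0 G"
    using fvs.span_superset[of "insert w0 G"] by blast+
  ultimately obtain C where C: "{w0} \<subseteq> C" "C \<subseteq> insert w0 G" "finite C" "fvs.independent C" "card C = fvs.dim (insert w0 G)"
    using fvs.finite_basis_extend[of "insert w0 G" "insert w0 G" "{w0}"] G(1) by (metis finite_insert)
  have "fvs.dim G \<le> fvs.dim (insert w0 G)"
    by (rule fvs.dim_mono_finite[of "insert w0 G"]) (use G(1) in \<open>auto intro: fvs.span_base\<close>)
  then have cC: "R + 1 \<le> card C" using R C(5) by simp
  define B where "B = C - {w0}"
  define r where "r = card B"
  have rB: "r + 1 = card C" "R \<le> r" using C cC by (auto simp: r_def B_def card_Diff_singleton)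
  obtain f where f: "bij_betw f {..<r} B"
    using ex_bij_betw_nat_finite[of B] C(3) unfolding r_def B_def atLeast0LessThan by blast
  have fB: "f b \<in> B" if "b < r" for b using f that by (auto simp: bij_betw_def)
  then have "f b \<in> G" if "b < r" for b using that C(2) unfolding B_def by blast
  then have "\<forall>b. \<exists>z. b < r \<longrightarrow> f b = (\<Sum>h<m. sv_tangent a e (P h) (z h))" using G(2) by blast
  then obtain z where z: "\<And>b. b < r \<Longrightarrow> f b = (\<Sum>h<m. sv_tangent a e (P h) (z b h))" by metis
  define W where "W b = (case b of 0 \<Rightarrow> w0 | Suc b \<Rightarrow> f b)" for b
  define zz where "zz y h = (\<lambda>q. \<Sum>b<r. y b * z b h q)" for y :: "nat \<Rightarrow> 'k" and h
  \<comment> \<open>The sum of \<open>m\<close> moving points. It starts at \<open>w0\<close>, its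
    partial derivatives at 0 are the \<open>f b\<close>, and its nonzero values give points of the
    secant variety.\<close>
  define \<Psi> where "\<Psi> y = (\<Sum>h<m. sv_vec a e (\<lambda>q. P h q + zz y h q))" for y
  have "enat r \<le> proj_dim ?I (secant_variety ?I m (segre_veronese a e :: (_ \<Rightarrow> 'k) set set))"
  proof (rule proj_dim_ge[where \<Psi> = \<Psi> and W = W and d = "\<Sum>i<length a. e ! i"])
    show "finite ?I" by simp
    show "closedin (zariski ?I) (secant_variety ?I m (segre_veronese a e :: (_ \<Rightarrow> 'k) set set))"
      by (simp add: secant_variety_def)
    show "\<Psi> y \<in> coord_vecs ?I" for y
      unfolding \<Psi>_def by (intro fvs.subspace_sum[OF subspace_coord_vecs]) simp
    show "W b \<in> coord_vecs ?I" if "b \<le> r" for b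
    proof (cases b)
      case 0
      then show ?thesis unfolding W_def w0(1) by (auto intro: fvs.subspace_sum[OF subspace_coord_vecs])
    next
      case (Suc c)
      then show ?thesis using z[of c] that unfolding W_def
        by (auto intro: fvs.subspace_sum[OF subspace_coord_vecs])
    qed
    have inj: "inj_on W {..r}"
    proof (rule inj_onI)
      fix b c assume bc: "b \<in> {..r}" "c \<in> {..r}" "W b = W c"
      have "f b \<noteq> w0" if "b < r" for b using fB[OF that] by (simp add: B_def)
      from this[of "b - 1"] this[of "c - 1"] show "b = c"
        using bc f by (cases b; cases c) (auto simp: W_def bij_betw_def inj_on_def)
    qed
    have "W ` {..r} = insert w0 (f ` {..<r})"
      unfolding W_def by (force simp: image_iff split: nat.splits intro: bexI[of _ "Suc _"])
    also have "\<dots> = C" using f C(1) by (auto simp: bij_betw_def B_def)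
    finally show "indep_family {..r} W" using inj C(4) indep_family_iff[of "{..r}" W] by simp
    show "\<And>y z i. poly_fun (\<lambda>t. \<Psi> (\<lambda>b. y b + t * (z b - y b)) i)"
      unfolding \<Psi>_def zz_def sum_apply
      by (intro poly_fun_sum poly_fun_sv_vec poly_fun_add poly_fun_mult poly_fun_const poly_fun_id)
    show "proj_pt (\<Psi> y) \<in> secant_variety ?I m (segre_veronese a e)" if "\<Psi> y \<noteq> 0" for y
      by (rule proj_pt_in_secant[OF e _ that]) (simp_all add: \<Psi>_def)
  next
    fix y :: "nat \<Rightarrow> 'k" and \<alpha>
    show "\<exists>p. (\<forall>t. \<Psi> (\<lambda>b. t * y b) \<alpha> = poly p t) \<and> coeff p 0 = W 0 \<alpha> \<and>
        coeff p (Suc 0) = (\<Sum>b<r. y b * W (Suc b) \<alpha>)"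
    proof (cases "\<alpha> \<in> ?I")
      case True
      let ?p = "\<Sum>h<m. line_poly ?J (case_prod \<alpha>) (P h) (zz y h)"
      have "zz (\<lambda>b. t * y b) h q = t * zz y h q" for t h q
        by (simp add: zz_def sum_distrib_left mult.assoc)
      then have "\<Psi> (\<lambda>b. t * y b) \<alpha> = poly ?p t" for t
        by (simp add: \<Psi>_def sum_apply sv_vec_def True poly_sum poly_line_poly)
      moreover have "coeff ?p 0 = W 0 \<alpha>"
        by (simp add: coeff_sum coeff_line_poly_0 W_def w0(1) sum_apply sv_vec_def True)
      moreover have "coeff ?p (Suc 0) = (\<Sum>b<r. y b * W (Suc b) \<alpha>)"
      proof -
        have "coeff ?p (Suc 0) = (\<Sum>h<m. \<Sum>b<r. y b * sv_tangent a e (P h) (z b h) \<alpha>)"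
          by (simp add: coeff_sum coeff_line_poly_1 zz_def dmonomial_linear sv_tangent_def True)
        also have "\<dots> = (\<Sum>b<r. y b * W (Suc b) \<alpha>)"
          by (subst sum.swap) (simp add: W_def z sum_apply sum_distrib_left)
        finally show ?thesis .
      qed
      ultimately show ?thesis by blast
    next
      case False
      have "W (Suc b) \<alpha> = 0" if "b < r" for b
        using z[OF that] False by (simp add: W_def sum_apply sv_tangent_def)
      then show ?thesis using False
        by (intro exI[of _ 0]) (simp add: \<Psi>_def W_def w0(1) sum_apply sv_vec_def)
    qed
  next
    fix j :: nat and \<alpha> assume \<alpha>: "\<alpha> \<in> ?I"
    let ?tr = "\<lambda>y b. if b < j then y b else (0 :: 'k)"
    let ?le = "exponents_le {..<j}"
    have c: "(\<lambda>y. c) \<in> poly_space {..<j} (?le 1)" for c :: 'k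
    proof -
      have "fscale c (monomial {..<j} (\<lambda>_. 0)) \<in> poly_space {..<j} (?le 1)"
        unfolding poly_space_def by (intro fvs.span_scale fvs.span_base imageI) (simp add: exponents_le_def)
      then show ?thesis by (simp add: fscale_def monomial_def)
    qed
    have tr: "(\<lambda>y. ?tr y b) \<in> poly_space {..<j} (?le 1)" for b
    proof (cases "b < j")
      case True
      let ?u = "\<lambda>i. if i = b then 1 else (0::nat)"
      have "monomial {..<j} ?u y = y b" for y :: "nat \<Rightarrow> 'k"
        unfolding monomial_def using True by (subst prod.remove[of _ b]) auto
      then have E: "monomial {..<j} ?u = (\<lambda>y :: nat \<Rightarrow> 'k. ?tr y b)" using True by auto
      have "?u \<in> ?le 1" using True by (simp add: exponents_le_def)
      then show ?thesis unfolding E[symmetric] by (rule poly_space_monomial)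
    qed (use c in simp)
    have aff: "(\<lambda>y. P h q + zz (?tr y) h q) \<in> poly_space {..<j} (?le 1)" for h q
    proof -
      have "(\<lambda>y. \<Sum>b<r. z b h q * ?tr y b) \<in> poly_space {..<j} (?le 1)"
        by (rule poly_space_sum) (rule tr)
      then have "(\<lambda>_. P h q) + (\<lambda>y. \<Sum>b<r. z b h q * ?tr y b) \<in> poly_space {..<j} (?le 1)"
        using c unfolding poly_space_def by (intro fvs.span_add)
      then show ?thesis by (simp add: zz_def plus_fun_def mult.commute)
    qed
    have "(\<Sum>q\<in>?J. case_prod \<alpha> q) = (\<Sum>i<length a. \<Sum>l\<le>a ! i. \<alpha> i l)"
      unfolding sv_vars_def by (subst sum.Sigma) auto
    also have "\<dots> = (\<Sum>i<length a. e ! i)" using sv_indexD(1)[OF \<alpha>] by simp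
    finally have sJ: "(\<Sum>q\<in>?J. \<Sum>_<case_prod \<alpha> q. 1) = (\<Sum>i<length a. e ! i)" by simp
    have "(\<lambda>y. \<Sum>h<m. 1 * monomial ?J (case_prod \<alpha>) (\<lambda>q. P h q + zz (?tr y) h q)) \<in> poly_space {..<j} (?le (\<Sum>i<length a. e ! i))"
    proof (rule poly_space_sum)
      fix h
      show "(\<lambda>y. monomial ?J (case_prod \<alpha>) (\<lambda>q. P h q + zz (?tr y) h q)) \<in> poly_space {..<j} (?le (\<Sum>i<length a. e ! i))"
        unfolding sJ[symmetric] by (rule exponents_le.monomial_comp_mem) (rule aff)
    qed
    then show "(\<lambda>y. \<Psi> (?tr y) \<alpha>) \<in> poly_space {..<j} (?le (\<Sum>i<length a. e ! i))"
      using \<alpha> by (simp add: \<Psi>_def sum_apply sv_vec_def)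
  qed
  then show ?thesis using rB(2) by (meson enat_ord_simps(1) order_trans)
qed

section \<open>Arithmetic\<close>

lemma six_choose: "6 * ((n + 3) choose n) = (n + 1) * (n + 2) * (n + 3)"
proof -
  have h1: "(n + 3) choose n = (n + 3) choose 3" using binomial_symmetric[of n "n + 3"] by simp
  have h2: "3 * ((n + 3) choose 3) = (n + 3) * ((n + 2) choose 2)"
    using Suc_times_binomial_eq[of "n + 2" 2] by (simp add: numeral_3_eq_3 numeral_2_eq_2)
  have h3: "2 * ((n + 2) choose 2) = (n + 2) * (n + 1)"
    using Suc_times_binomial_eq[of "n + 1" 1] by (simp add: numeral_2_eq_2)
  have "6 * ((n + 3) choose n) = 2 * (3 * ((n + 3) choose 3))" by (simp add: h1)
  also have "\<dots> = (n + 3) * (2 * ((n + 2) choose 2))" unfolding h2 by (simp only: mult.left_commute)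
  also have "\<dots> = (n + 1) * (n + 2) * (n + 3)" unfolding h3 by (simp only: mult_ac)
  finally show ?thesis .
qed

text \<open>Six times the binomial \<open>(D + 2) choose 3\<close>; this cubic is the remainder term
  in \<open>point_count_bound\<close>.\<close>

definition rise :: "nat \<Rightarrow> nat" where "rise D = D * (D + 1) * (D + 2)"

lemma rise_Suc: "D * rise (Suc D) = (D + 3) * rise D"
  by (simp add: rise_def algebra_simps)

lemma six_choose_rise: "6 * ((n + 3) choose n) = rise (Suc n)"
  unfolding six_choose by (simp add: rise_def eval_nat_numeral)

text \<open>By \<open>rise_Suc\<close> the two sides grow by the factors
  \<open>(a + b + 3) / (a + b)\<close> and \<open>(a + 4) / (a + 1)\<close>; the first is not larger
  since \<open>b \<ge> 1\<close>.\<close>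

lemma rise_step:
  assumes b: "b \<ge> 1" and IH: "c * rise (a + b) \<le> rise (Suc a) * X"
  shows "c * rise (Suc a + b) \<le> rise (Suc (Suc a)) * X"
proof -
  have pos: "0 < (a + 1) * (a + b)" using b by simp
  have "(a + 1) * (a + b) * (c * rise (Suc a + b)) = c * (a + 1) * ((a + b) * rise (Suc (a + b)))" by (simp only: add_Suc mult_ac)
  also have "\<dots> = c * ((a + 1) * (a + b + 3)) * rise (a + b)" unfolding rise_Suc by (simp only: mult_ac)
  also have "(a + 1) * (a + b + 3) \<le> (a + 4) * (a + b)" using b by (simp add: algebra_simps)
  then have "c * ((a + 1) * (a + b + 3)) * rise (a + b) \<le> c * ((a + 4) * (a + b)) * rise (a + b)"
    by (intro mult_le_mono1 mult_le_mono2)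
  also have "\<dots> = (a + 4) * (a + b) * (c * rise (a + b))" by (simp only: mult_ac)
  also have "\<dots> \<le> (a + 4) * (a + b) * (rise (Suc a) * X)" using IH by (rule mult_le_mono2)
  also have "\<dots> = (a + b) * ((Suc a + 3) * rise (Suc a)) * X" by (simp add: mult_ac)
  also have "\<dots> = (a + b) * (Suc a * rise (Suc (Suc a))) * X" unfolding rise_Suc ..
  also have "\<dots> = (a + 1) * (a + b) * (rise (Suc (Suc a)) * X)" by (simp only: Suc_eq_plus1 mult_ac)
  finally show ?thesis using pos by (simp only: mult_le_cancel1)
qed

lemma rise_add: "b \<ge> 1 \<Longrightarrow> 6 * rise (a + b) \<le> rise (Suc a) * rise b"
proof (induction a)
  case (Suc a)
  then show ?case by (intro rise_step) auto
qed (simp add: rise_def)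

text \<open>The start is \<open>rise 2 = 24\<close>. The constant 18 is chosen because two binomials
  contribute 36 and a quotient of 2 is wanted.\<close>

lemma rise_two:
  assumes b: "b \<ge> 1" shows "18 * rise (Suc a + b) \<le> rise (Suc (Suc a)) * rise (Suc b)"
proof (induction a)
  case 0
  show ?case by (simp add: rise_def algebra_simps)
next
  case (Suc a)
  then show ?case using rise_step[OF b, of 18 "Suc a"] by simp
qed

text \<open>The induction has to start with two factors: for one, the right side would be
  \<open>rise (Suc n) / 3\<close>, smaller than \<open>rise n\<close> once \<open>n \<ge> 2\<close>.
  Each further factor is absorbed by \<open>rise_add\<close>.\<close>

lemma rise_le_prod:
  assumes n: "\<And>i. i < Suc (Suc k) \<Longrightarrow> n i \<ge> 1"
  shows "rise (\<Sum>i<Suc (Suc k). n i) \<le> 2 * (\<Prod>i<Suc (Suc k). (n i + 3) choose (n i))"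
  using n
proof (induction k)
  case 0
  obtain a b where ab: "n 0 = Suc a" "n 1 = Suc b" 
    using 0[of 0] 0[of 1] by (metis One_nat_def Suc_le_D less_Suc_eq zero_less_Suc)
  note c = six_choose_rise[symmetric]
  have "18 * rise (n 0 + n 1) \<le> rise (Suc (n 0)) * rise (Suc (n 1))"
    using rise_two[of "n 1" a] ab by simp
  also have "\<dots> = 36 * (((n 0 + 3) choose (n 0)) * ((n 1 + 3) choose (n 1)))" unfolding c by simp
  finally show ?case by (simp add: numeral_2_eq_2 lessThan_Suc add.commute mult.commute)
next
  case (Suc k)
  let ?K = "Suc (Suc k)"
  note c = six_choose_rise[symmetric]
  have "n 0 \<le> (\<Sum>i<?K. n i)" by (intro member_le_sum) auto
  then have s: "(\<Sum>i<?K. n i) \<ge> 1" using Suc.prems[of 0] by simp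
  have "6 * rise (n ?K + (\<Sum>i<?K. n i)) \<le> rise (Suc (n ?K)) * rise (\<Sum>i<?K. n i)" by (rule rise_add[OF s])
  also have "\<dots> \<le> rise (Suc (n ?K)) * (2 * (\<Prod>i<?K. (n i + 3) choose (n i)))"
    by (rule mult_le_mono2, rule Suc.IH) (use Suc.prems in simp)
  also have "\<dots> = 6 * (2 * ((\<Prod>i<?K. (n i + 3) choose (n i)) * ((n ?K + 3) choose (n ?K))))"
    unfolding c by (simp only: mult_ac)
  finally have "rise (n ?K + (\<Sum>i<?K. n i)) \<le> 2 * ((\<Prod>i<?K. (n i + 3) choose (n i)) * ((n ?K + 3) choose (n ?K)))"
    by (simp only: mult_le_cancel1 zero_less_numeral simp_thms)
  then show ?case unfolding prod.lessThan_Suc[of _ ?K] sum.lessThan_Suc[of _ ?K] add.commute[of "n ?K"] .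
qed

text \<open>Here \<open>D\<close> is \<open>|n|\<close>, so tangent spaces have rank
  \<open>D + 1\<close>. Since \<open>n0 \<ge> 1\<close>, the hypothesis gives
  \<open>(S - 1) * (D + 2) + 1 \<le> N\<close>. Multiplying the claim by \<open>D + 2\<close>
  reduces it to this bound plus the remainder \<open>rise D\<close>, which is at most
  \<open>2 * N\<close>.\<close>

lemma point_count_bound:
  fixes S :: nat
  assumes N: "rise D \<le> 2 * N" and n0: "n0 \<ge> 1" and S: "S \<ge> 1" "(S - 1) * (D + 1 + n0) < N"
  shows "2 * (S - 1) * (D + 1) + (D + 1) * (D + 1 - 1) < 2 * N"
proof -
  have "(S - 1) * (D + 2) \<le> (S - 1) * (D + 1 + n0)" using n0 by (intro mult_le_mono2) simp
  then have le: "(S - 1) * (D + 2) + 1 \<le> N" using S by linarith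
  have "(D + 2) * (2 * (S - 1) * (D + 1) + (D + 1) * D) + 2 * (D + 1) = 
      2 * (D + 1) * ((S - 1) * (D + 2) + 1) + rise D" by (simp add: rise_def algebra_simps)
  also have "\<dots> \<le> 2 * (D + 1) * N + 2 * N" using le N by (intro add_mono mult_le_mono2)
  also have "\<dots> = (D + 2) * (2 * N)" by (simp add: algebra_simps)
  finally have "(D + 2) * (2 * (S - 1) * (D + 1) + (D + 1) * D) < (D + 2) * (2 * N)" by simp
  then show ?thesis by (simp only: mult_less_cancel1 add_diff_cancel_right')
qed

section \<open>Nondefectivity\<close>

text \<open>\<open>A\<close> is the expected rank per point. With \<open>(n0 + 1) * S\<close>
  points, \<open>ex_block_points\<close> gives every block its expected rank. If there are fewer
  points, each one dropped costs at most \<open>A\<close>; if there are more, the blocks already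
  fill the space.\<close>

lemma split_secant_dim:
  fixes n0 m S :: nat and n d :: "nat list"
  defines "N \<equiv> card (sv_index n d)" and "A \<equiv> sum_list n + 1 + n0"
  assumes n: "n \<noteq> []" and d: "\<And>i. i < length n \<Longrightarrow> d ! i \<ge> 2"
    and S: "S \<ge> 1" "sv_tangents.r TYPE('k::field_char_0) n d S = S * (sum_list n + 1)" and N: "N \<ge> 1" and m: "m \<ge> 1"
    and range: "m \<le> (n0 + 1) * S \<and> S * A \<le> N \<or> (n0 + 1) * S \<le> m \<and> N \<le> S * A"
  shows "enat (min ((n0 + 1) * N) (m * A) - 1) \<le> proj_dim (sv_index (n0 # n) (1 # d))
     (secant_variety (sv_index (n0 # n) (1 # d)) m (segre_veronese (n0 # n) (1 # d) :: (_ \<Rightarrow> 'k) set set))"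
proof -
  interpret Y: sv_tangents n d "TYPE('k)" by unfold_locales (use n d in auto)
  let ?a = "n0 # n" and ?e = "1 # d"
  let ?M = "(n0 + 1) * S"
  have r1: "Y.r 1 = sum_list n + 1" by (rule Y.r_1)
  obtain P where P: "sv_vec n d (P 0) \<noteq> 0" and PB: "\<And>j. j \<le> n0 \<Longrightarrow> min N (S * A) \<le>
      fvs.dim (Y.mixed P {h. h < ?M \<and> h div S = j} {h. h < ?M \<and> h div S \<noteq> j})"
    using Y.ex_block_points[of S n0] S N unfolding N_def A_def r1 by auto
  \<comment> \<open>The coordinate point of the first factor over which point \<open>h\<close> lies;
    \<open>min\<close> takes care of the surplus points \<open>h \<ge> ?M\<close>.\<close>
  define j where "j h = min n0 (h div S)" for h
  have jle: "j h \<le> n0" for h by (simp add: j_def)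
  have jM: "j h = h div S" if "h < ?M" for h
  proof -
    have "h div S < n0 + 1" using that by (intro less_mult_imp_div_less)
    then show ?thesis by (simp add: j_def)
  qed
  define V where "V i = Y.mixed P {h. h < ?M \<and> h div S = i} {h. h < ?M \<and> h div S \<noteq> i}" for i
  define T where "T h = emb n0 n d (j h) ` tangent_gens n d (P h)" for h
  \<comment> \<open>Spans the tangent space of the larger variety at point \<open>h\<close>: tangent
    vectors in copy \<open>j h\<close>, the point itself in the other copies.\<close>
  define gens where "gens h = T h \<union> (\<lambda>i. emb n0 n d i (sv_vec n d (P h))) ` ({..n0} - {j h})" for h
  define G where "G m = (\<Union>h<m. gens h)" for m
  let ?u = "unit_vec ` sv_index ?a ?e :: ((nat \<Rightarrow> nat \<Rightarrow> nat) \<Rightarrow> 'k) set"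
  have finu: "finite ?u" by simp
  have cu: "coord_vecs (sv_index ?a ?e) \<subseteq> fvs.span ?u" by (rule coord_vecs_subset_span) simp
  have gens_sub: "gens h \<subseteq> fvs.span ?u" for h
    using cu emb_in unfolding gens_def T_def by blast
  have G_sub: "G m \<subseteq> fvs.span ?u" for m using gens_sub unfolding G_def by blast
  have fin_tg: "finite (tangent_gens n d x)" for x :: "nat \<times> nat \<Rightarrow> 'k" by (simp add: tangent_gens_def)
  have fin_gens: "finite (gens h)" for h by (simp add: gens_def T_def fin_tg)
  have dim_gens: "fvs.dim (gens h) \<le> A" for h
  proof -
    let ?s = "(\<lambda>i. emb n0 n d i (sv_vec n d (P h))) ` ({..n0} - {j h})"
    have "fvs.dim (gens h) \<le> fvs.dim (T h) + fvs.dim ?s"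
      unfolding gens_def
      by (rule fvs.dim_Un_le[OF finu]) (use gens_sub[of h] in \<open>auto simp: gens_def\<close>)
    moreover have "fvs.dim (T h) \<le> sum_list n + 1"
      unfolding T_def using dim_emb_le[OF fin_tg] dim_tangent_le[of n d "P h"] d by (meson le_trans)
    moreover have "fvs.dim ?s \<le> n0"
    proof -
      have "fvs.dim ?s \<le> card ?s" by (rule fvs.dim_le_card[OF fvs.span_superset]) simp
      also have "\<dots> \<le> card ({..n0} - {j h})" by (rule card_image_le) simp
      also have "\<dots> = n0" using jle[of h] by simp
      finally show ?thesis .
    qed
    ultimately show ?thesis by (simp add: A_def)
  qed
  have full: "(n0 + 1) * min N (S * A) \<le> fvs.dim (G ?M)"
  proof -
    have "(n0 + 1) * min N (S * A) = (\<Sum>i<n0 + 1. min N (S * A))" by simp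
    also have "\<dots> \<le> (\<Sum>i<n0 + 1. fvs.dim (V i))" by (rule sum_mono) (use PB in \<open>auto simp: V_def\<close>)
    also have "\<dots> \<le> fvs.dim (\<Union>i<n0 + 1. emb n0 n d i ` V i)"
      by (rule dim_emb_sum) (use Y.mixed_sub in \<open>auto simp: V_def Y.mixed_def Y.W_def fin_tg\<close>)
    also have "\<dots> \<le> fvs.dim (G ?M)"
    proof (rule fvs.dim_mono_finite[OF finu G_sub])
      have "emb n0 n d i v \<in> G ?M" if i: "i \<le> n0" and v: "v \<in> V i" for i v
      proof -
        from v consider h where "h < ?M" "h div S = i" "v \<in> tangent_gens n d (P h)"
          | h where "h < ?M" "h div S \<noteq> i" "v = sv_vec n d (P h)"
          by (auto simp: V_def Y.mixed_def Y.W_def)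
        then show ?thesis
        proof cases
          case 1
          then have "emb n0 n d i v \<in> gens h" using jM[of h] by (auto simp: gens_def T_def)
          then show ?thesis using 1 by (auto simp: G_def)
        next
          case 2
          then have "emb n0 n d i v \<in> gens h" using jM[of h] i by (auto simp: gens_def)
          then show ?thesis using 2 by (auto simp: G_def)
        qed
      qed
      then have "(\<Union>i<n0 + 1. emb n0 n d i ` V i) \<subseteq> G ?M" by auto
      then show "(\<Union>i<n0 + 1. emb n0 n d i ` V i) \<subseteq> fvs.span (G ?M)" using fvs.span_superset by blast
    qed
    finally show ?thesis .
  qed
  have rank: "min ((n0 + 1) * N) (m * A) \<le> fvs.dim (G m)"
    using range
  proof
    assume r: "m \<le> ?M \<and> S * A \<le> N"
    then have "{..<?M} = {..<m} \<union> {m..<?M}" by (intro ivl_disj_un(8)[symmetric]) simp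
    then have "G ?M = G m \<union> (\<Union>h\<in>{m..<?M}. gens h)"
      unfolding G_def by (simp only: UN_Un)
    then have "fvs.dim (G ?M) \<le> fvs.dim (G m) + fvs.dim (\<Union>h\<in>{m..<?M}. gens h)"
      using fvs.dim_Un_le[OF finu G_sub, of "\<Union>h\<in>{m..<?M}. gens h" m] gens_sub by (metis UN_least)
    also have "fvs.dim (\<Union>h\<in>{m..<?M}. gens h) \<le> (\<Sum>h\<in>{m..<?M}. fvs.dim (gens h))"
      by (rule fvs.dim_Union_le[OF finu]) (use gens_sub in auto)
    also have "\<dots> \<le> (\<Sum>h\<in>{m..<?M}. A)" by (rule sum_mono) (rule dim_gens)
    also have "\<dots> = (?M - m) * A" by simp
    finally have "fvs.dim (G ?M) \<le> fvs.dim (G m) + (?M - m) * A" by simp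
    moreover have "min N (S * A) = S * A" using r by simp
    then have "?M * A \<le> fvs.dim (G ?M)" using full by (simp only: mult.assoc)
    moreover have "?M * A = m * A + (?M - m) * A" using r by (simp flip: distrib_right)
    ultimately show ?thesis by linarith
  next
    assume r: "?M \<le> m \<and> N \<le> S * A"
    then have "(n0 + 1) * N \<le> fvs.dim (G ?M)" using full by (simp add: min_absorb1)
    also have "\<dots> \<le> fvs.dim (G m)"
    proof (rule fvs.dim_mono_finite[OF finu G_sub])
      have "G ?M \<subseteq> G m" unfolding G_def using r by (intro UN_mono) auto
      then show "G ?M \<subseteq> fvs.span (G m)" using fvs.span_superset by blast
    qed
    finally show ?thesis by simp
  qed
  \<comment> \<open>The points of the larger variety. Their sum serves as base point and might
    vanish; scaling the first block of point 0 by a nonzero \<open>c\<close> changes the sum but not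
    the span of the tangent vectors.\<close>
  define p where "p c h = (\<lambda>(i, l). case i of 0 \<Rightarrow> if l = j h then (if h = 0 then c else 1) else 0 | Suc i \<Rightarrow> P h (i, l))"
    for c :: 'k and h :: nat
  define \<gamma> where "\<gamma> c h = (if h = 0 then c else 1)" for c :: 'k and h :: nat
  have p0: "p c h (0, l) = (if l = j h then \<gamma> c h else 0)" and pS: "(\<lambda>(i, l). p c h (Suc i, l)) = P h" for c h l
    by (auto simp: p_def \<gamma>_def)
  have pick: "(\<Sum>i\<le>n0. fscale (p c h (0, i)) (f i)) = fscale (\<gamma> c h) (f (j h))" for c h and f :: "nat \<Rightarrow> (nat \<Rightarrow> nat \<Rightarrow> nat) \<Rightarrow> 'k"
  proof -
    have "(\<Sum>i\<le>n0. fscale (p c h (0, i)) (f i)) = (\<Sum>i\<le>n0. if i = j h then fscale (\<gamma> c h) (f (j h)) else 0)"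
      by (rule sum.cong) (auto simp: p0)
    then show ?thesis using jle[of h] by simp
  qed
  have svp: "sv_vec ?a ?e (p c h) = fscale (\<gamma> c h) (emb n0 n d (j h) (sv_vec n d (P h)))" for c h
    unfolding sv_vec_Cons pS pick ..
  define w where "w c = (\<Sum>h<m. sv_vec ?a ?e (p c h))" for c
  have "\<exists>c. c \<noteq> 0 \<and> w c \<noteq> 0"
  proof (cases "w 1 = 0")
    case True
    let ?v = "emb n0 n d (j 0) (sv_vec n d (P 0))"
    obtain \<alpha> where \<alpha>: "sv_vec n d (P 0) \<alpha> \<noteq> 0" using P by (auto simp: fun_eq_iff)
    then have "\<alpha> \<in> sv_index n d" by (auto simp: sv_vec_def split: if_splits)
    from emb_lift[OF this jle[of 0], of "sv_vec n d (P 0)"] have v: "?v \<noteq> 0" using \<alpha> by auto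
    have m0: "{..<m} = insert 0 {1..<m}" using m by auto
    have "w c = fscale c ?v + (\<Sum>h\<in>{1..<m}. emb n0 n d (j h) (sv_vec n d (P h)))" for c
      unfolding w_def svp m0 by (subst sum.insert) (auto simp: \<gamma>_def intro!: sum.cong)
    then have "w 2 = w 1 + ?v" by (simp add: fscale_def fun_eq_iff algebra_simps)
    then show ?thesis using True v by (intro exI[of _ 2]) simp
  qed (auto intro: exI[of _ 1])
  then obtain c where c: "c \<noteq> 0" "w c \<noteq> 0" by blast
  have \<gamma>: "\<gamma> c h \<noteq> 0" for h using c by (simp add: \<gamma>_def)
  have tz: "sv_tangent b e x (\<lambda>_. 0) = 0" for b e and x :: "nat \<times> nat \<Rightarrow> 'k"
    using sv_tangent_scale[of b e x 0 "\<lambda>_. 0"] by simp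
  have dir: "\<exists>z. v = sv_tangent ?a ?e (p c h) z" if v: "v \<in> gens h" for v h
  proof -
    consider q where "v = emb n0 n d (j h) (sv_tangent n d (P h) (unit_vec q))"
      | i where "i \<le> n0" "v = emb n0 n d i (sv_vec n d (P h))"
      using v by (auto simp: gens_def T_def tangent_gens_def)
    then show ?thesis
    proof cases
      case 1
      define z where "z = (\<lambda>(i, l). case i of 0 \<Rightarrow> 0 | Suc i \<Rightarrow> inverse (\<gamma> c h) * unit_vec q (i, l))"
      have z0: "z (0, l) = 0" for l by (simp add: z_def)
      have zS: "(\<lambda>(i, l). z (Suc i, l)) = (\<lambda>r. inverse (\<gamma> c h) * unit_vec q r)" by (auto simp: z_def)
      have "sv_tangent ?a ?e (p c h) z = v"
        unfolding sv_tangent_Cons pS zS z0 sum.distrib pick unfolding sv_tangent_scale emb_scale 1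
        using \<gamma>[of h] by (simp add: fvs.scale_scale)
      then show ?thesis by metis
    next
      case 2
      define z where "z = (\<lambda>(k, l). case k of 0 \<Rightarrow> (if l = i then 1 else 0 :: 'k) | Suc k \<Rightarrow> 0)"
      have z0: "z (0, l) = (if l = i then 1 else 0)" for l by (simp add: z_def)
      have zS: "(\<lambda>(k, l). z (Suc k, l)) = (\<lambda>_. 0)" by (auto simp: z_def)
      have "(\<Sum>l\<le>n0. fscale (z (0, l)) (emb n0 n d l (sv_vec n d (P h)))) = (\<Sum>l\<le>n0. if l = i then v else 0)"
        by (rule sum.cong) (auto simp: z0 2)
      also have "\<dots> = v" using 2 by simp
      finally have "sv_tangent ?a ?e (p c h) z = v"
        unfolding sv_tangent_Cons pS zS sum.distrib by (simp add: tz emb_zero)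
      then show ?thesis by metis
    qed
  qed
  have "enat (fvs.dim (G m) - 1) \<le> proj_dim (sv_index ?a ?e)
     (secant_variety (sv_index ?a ?e) m (segre_veronese ?a ?e :: (_ \<Rightarrow> 'k) set set))"
  proof (rule proj_dim_secant_ge[where P = "p c" and G = "G m" and ?w0.0 = "w c"])
    show "1 \<le> ?e ! i" if "i < length ?a" for i using that d[of "i - 1"] by (cases i) auto
    show "w c = (\<Sum>h<m. sv_vec ?a ?e (p c h))" by (simp add: w_def)
    show "w c \<noteq> 0" by (rule c)
    show "w c \<in> fvs.span (G m)"
      unfolding w_def svp
    proof (intro fvs.span_sum fvs.span_scale)
      fix h assume h: "h \<in> {..<m}"
      have "sv_vec n d (P h) \<in> fvs.span (tangent_gens n d (P h))"
        by (rule sv_vec_in_tangent[OF n]) (use d[of 0] n in simp)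
      then have "emb n0 n d (j h) (sv_vec n d (P h)) \<in> fvs.span (T h)" unfolding T_def by (rule emb_span)
      moreover have "T h \<subseteq> G m" using h by (auto simp: G_def gens_def)
      ultimately show "emb n0 n d (j h) (sv_vec n d (P h)) \<in> fvs.span (G m)" using fvs.span_mono by blast
    qed
    show "finite (G m)" by (simp add: G_def fin_gens)
    show "\<exists>z. v = (\<Sum>h<m. sv_tangent ?a ?e (p c h) (z h))" if v: "v \<in> G m" for v
    proof -
      obtain h z where h: "h < m" "v = sv_tangent ?a ?e (p c h) z" using v dir unfolding G_def by blast
      have "(\<Sum>g<m. sv_tangent ?a ?e (p c g) (if g = h then z else (\<lambda>_. 0))) = (\<Sum>g<m. if g = h then v else 0)"
        by (rule sum.cong) (use h tz in auto)
      also have "\<dots> = v" using h by simp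
      finally show ?thesis by (intro exI[of _ "\<lambda>g. if g = h then z else (\<lambda>_. 0)"]) simp
    qed
    have "1 \<le> min ((n0 + 1) * N) (m * A)" using N m by (simp add: A_def)
    then have "1 \<le> fvs.dim (G m)" using rank by (rule order_trans)
    then show "fvs.dim (G m) - 1 + 1 \<le> fvs.dim (G m)" by simp
  qed
  moreover have "enat (min ((n0 + 1) * N) (m * A) - 1) \<le> enat (fvs.dim (G m) - 1)" using rank by simp
  ultimately show ?thesis by (rule order_trans[rotated])
qed

theorem theorem1p2:
  fixes k n0 m N :: nat and n d :: "nat list"
  assumes "k \<ge> 2" and "n0 \<ge> 1" and "m \<ge> 1"
    and "length n = k" and "length d = k"
    and "\<forall>i<k. n ! i \<ge> 1" and "\<forall>i<k. d ! i \<ge> 1"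
    and "N = (\<Prod>i<k. (n ! i + d ! i) choose (n ! i))"
    and "\<forall>i<k. d ! i \<ge> 3"
    and "int m \<le> (int n0 + 1) * \<lfloor>real N / real (n0 + sum_list n + 1)\<rfloor> \<or>
         int m \<ge> (int n0 + 1) * \<lceil>real N / real (n0 + sum_list n + 1)\<rceil>"
  shows "\<not> defective (sv_index (n0 # n) (1 # d)) m
    (segre_veronese (n0 # n) (1 # d)
      :: ((nat \<Rightarrow> nat \<Rightarrow> nat) \<Rightarrow> 'k :: {alg_closed_field, field_char_0}) set set)"
proof -
  let ?I = "sv_index (n0 # n) (1 # d)"
  let ?X = "segre_veronese (n0 # n) (1 # d) :: ((nat \<Rightarrow> nat \<Rightarrow> nat) \<Rightarrow> 'k) set set"
  define D where "D = sum_list n"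
  define A where "A = D + 1 + n0"
  have NI: "N = card (sv_index n d)"
    unfolding card_sv_index assms(8) assms(4)
    by (rule prod.cong) (simp_all add: binomial_symmetric[of "n ! _" "n ! _ + d ! _"])
  have cI: "card ?I = (n0 + 1) * N"
    unfolding NI card_sv_index by (simp add: prod.lessThan_Suc_shift del: prod.lessThan_Suc)
  define k' where "k' = k - 2"
  have k': "k = Suc (Suc k')" using assms(1) by (simp add: k'_def)
  have rise: "rise D \<le> 2 * N"
  proof -
    have "D = (\<Sum>i<k. n ! i)" using assms(4) by (simp add: D_def sum_list_sum_nth atLeast0LessThan)
    then have "rise D \<le> 2 * (\<Prod>i<k. (n ! i + 3) choose (n ! i))"
      using rise_le_prod[of k' "\<lambda>i. n ! i"] assms(6) k' by simp
    also have "(\<Prod>i<k. (n ! i + 3) choose (n ! i)) \<le> (\<Prod>i<k. (n ! i + d ! i) choose (n ! i))"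
      using assms(9) by (intro prod_mono conjI binomial_right_mono) auto
    finally show ?thesis using assms(8) by simp
  qed
  have N1: "N \<ge> 1" unfolding assms(8) by (intro prod_ge_1) (simp add: Suc_le_eq)
  have A0: "A \<ge> 1" by (simp add: A_def)
  have AA: "n0 + sum_list n + 1 = A" by (simp add: A_def D_def)
  \<comment> \<open>The floor in the first case, the ceiling in the second. Both satisfy
    \<open>(S - 1) * A < N\<close>, which is what independence of \<open>S\<close> tangent spaces of
    the smaller variety requires. In the first case \<open>m \<ge> 1\<close> forces the floor to be
    positive.\<close>
  obtain S where S: "S \<ge> 1" "(S - 1) * A < N" "m \<le> (n0 + 1) * S \<and> S * A \<le> N \<or> (n0 + 1) * S \<le> m \<and> N \<le> S * A"
    using assms(10)
  proof
    assume le: "int m \<le> (int n0 + 1) * \<lfloor>real N / real (n0 + sum_list n + 1)\<rfloor>"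
    then have "int m \<le> int ((n0 + 1) * (N div A))"
      unfolding AA floor_divide_of_nat_eq by (simp add: algebra_simps)
    then have ml: "m \<le> (n0 + 1) * (N div A)" by linarith
    have S1: "N div A \<ge> 1" using ml assms(3) by (cases "N div A") auto
    have "N div A * A \<le> N" by (rule div_times_less_eq_dividend)
    moreover have "(N div A - 1) * A < N"
    proof -
      have "(N div A - 1) * A = N div A * A - A" by (simp add: diff_mult_distrib)
      also have "\<dots> < N" using div_times_less_eq_dividend[of N A] A0 N1 by linarith
      finally show ?thesis .
    qed
    ultimately show ?thesis using that[of "N div A"] S1 ml by blast
  next
    assume ge: "int m \<ge> (int n0 + 1) * \<lceil>real N / real (n0 + sum_list n + 1)\<rceil>"
    define S where "S = nat \<lceil>real N / real A\<rceil>"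
    have "real N / real A > 0" using N1 A0 by simp
    then have c0: "\<lceil>real N / real A\<rceil> \<ge> 1" by (simp only: one_le_ceiling)
    then have Sc: "int S = \<lceil>real N / real A\<rceil>" unfolding S_def by linarith
    then have S1: "S \<ge> 1" using c0 by linarith
    have "int ((n0 + 1) * S) \<le> int m" using ge unfolding AA by (simp add: Sc algebra_simps)
    then have "(n0 + 1) * S \<le> m" by linarith
    moreover have "real N / real A \<le> real S" using le_of_int_ceiling[of "real N / real A"] Sc by (metis of_int_of_nat_eq)
    then have "real N \<le> real (S * A)" using A0 by (simp add: field_simps)
    then have "N \<le> S * A" by linarith
    moreover have "(S - 1) * A < N"
    proof -
      have "real S - 1 < real N / real A" using ceiling_correct[of "real N / real A"] Sc by (metis of_int_of_nat_eq)
      then have "(real S - 1) * real A < real N" using A0 by (simp add: field_simps)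
      then have "real ((S - 1) * A) < real N" using S1 by (simp add: of_nat_diff)
      then show ?thesis by linarith
    qed
    ultimately show ?thesis using that[of S] S1 by blast
  qed
  have n: "n \<noteq> []" using assms(1,4) by auto
  have d2: "d ! i \<ge> 2" if "i < length n" for i using assms(4,9) that by fastforce
  interpret Y: sv_tangents n d "TYPE('k)" by unfold_locales (use n d2 in auto)
  have r1: "Y.r 1 = D + 1" unfolding D_def by (rule Y.r_1)
  have "2 * (S - 1) * (D + 1) + (D + 1) * (D + 1 - 1) < 2 * N"
    by (rule point_count_bound[OF rise assms(2) S(1)]) (use S(2) in \<open>simp add: A_def\<close>)
  then have rS: "Y.r S = S * (sum_list n + 1)"
    using Y.r_eq[of S] unfolding r1 NI[symmetric] D_def by simp
  have dimS: "enat (min ((n0 + 1) * N) (m * A) - 1) \<le> proj_dim ?I (secant_variety ?I m ?X)"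
    using split_secant_dim[OF n d2 S(1) rS _ assms(3)] S(3) N1 unfolding NI A_def D_def by simp
  \<comment> \<open>The expected dimension is monotone in the dimension of the variety, so an upper
    bound for the latter is enough.\<close>
  have dX: "proj_dim ?I ?X \<le> enat (n0 + D)"
    using proj_dim_segre_veronese_le[of "n0 # n" "1 # d"] unfolding D_def by simp
  have "expected_dim ?I m ?X \<le> min (enat (card ?I - 1)) (enat m * enat (n0 + D) + enat (m - 1))"
    unfolding expected_dim_def by (intro min.mono add_mono mult_left_mono dX) auto
  also have "\<dots> = enat (min (card ?I - 1) (m * (n0 + D) + (m - 1)))" by simp
  \<comment> \<open>Projective dimension is rank minus one; \<open>m \<ge> 1\<close> keeps the
    truncated differences exact.\<close>
  also have "m * (n0 + D) + (m - 1) = m * A - 1" using assms(3) by (simp add: A_def algebra_simps)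
  also have "min (card ?I - 1) (m * A - 1) = min ((n0 + 1) * N) (m * A) - 1"
    unfolding cI by (simp add: min_def)
  finally have "expected_dim ?I m ?X \<le> proj_dim ?I (secant_variety ?I m ?X)" using dimS by (rule order_trans)
  then show ?thesis unfolding defective_def by (simp add: not_less)
qed

end
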